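(* Let $\mathbb K\in\{\mathbb R,\mathbb C,\mathbb H\}$. A unitary representation of $\mathrm U(\infty,\mathbb K)_0$ is tame if and only if it extends to a continuous unitary representation of $\mathrm U_\infty(\mathcal H)_0$ for $\mathcal H=\ell^2(\mathbb N,\mathbb K)$.
   Context: Let $(e_j)_{j\in\mathbb N}$ be the canonical orthonormal basis of $\mathcal H=\ell^2(\mathbb N,\mathbb K)$. $\mathrm U_\infty(\mathcal H)$ is the group of $\mathbb K$-linear unitary operators $g$ on $\mathcal H$ with $g-\mathbf 1$ compact, with the operator norm topology; $\mathrm U_\infty(\mathcal H)_0$ is its identity component. $\mathrm U(n,\mathbb K)_0$ is the identity component of the unitary group of $\mathbb K^n\cong\mathrm{span}\{e_1,\dots,e_n\}$ (operators being extended by the identity on the orthogonal complement), and $\mathrm U(\infty,\mathbb K)_0=\bigcup_n\mathrm U(n,\mathbb K)_0\subseteq\mathrm U_\infty(\mathcal H)_0$ is the direct limit of these groups. For $n\in\mathbb N$ put $K_n=\{g\in\mathrm U(\infty,\mathbb K)_0: ge_j=e_j\text{ for all }j\le n\}$. A unitary representation $(\pi,\mathcal H_\pi)$ of $\mathrm U(\infty,\mathbb K)_0$ is called tame if $\bigcup_{n}\mathcal H_\pi^{K_n}$ is dense in $\mathcal H_\pi$, where $\mathcal H_\pi^{K_n}$ is the subspace of $K_n$-fixed vectors.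
   Formalization: The unitary representation of U(∞,K)_0 is assumed strongly continuous for the direct limit topology; without this the claim fails, e.g. for K=C the permutation representation on ℓ² of the orbit of e_1 is tame but has no continuous extension. *)

theory Defs
  imports "HOL-Analysis.Analysis" "HOL-Algebra.Group"
begin

section \<open>Quaternions\<close>

datatype quat = Quat (qRe: real) (qI: real) (qJ: real) (qK: real)

lemma quat_eq_iff: "x = y \<longleftrightarrow> qRe x = qRe y \<and> qI x = qI y \<and> qJ x = qJ y \<and> qK x = qK y"
  by (cases x; cases y) auto

definition quat_cnj :: "quat \<Rightarrow> quat" where
  "quat_cnj x = Quat (qRe x) (- qI x) (- qJ x) (- qK x)"

instantiation quat :: real_vector
begin

definition zero_quat :: quat where
  "0 = Quat 0 0 0 0"

definition plus_quat :: "quat \<Rightarrow> quat \<Rightarrow> quat" where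
  "x + y = Quat (qRe x + qRe y) (qI x + qI y) (qJ x + qJ y) (qK x + qK y)"

definition minus_quat :: "quat \<Rightarrow> quat \<Rightarrow> quat" where
  "x - y = Quat (qRe x - qRe y) (qI x - qI y) (qJ x - qJ y) (qK x - qK y)"

definition uminus_quat :: "quat \<Rightarrow> quat" where
  "- x = Quat (- qRe x) (- qI x) (- qJ x) (- qK x)"

definition scaleR_quat :: "real \<Rightarrow> quat \<Rightarrow> quat" where
  "scaleR r x = Quat (r * qRe x) (r * qI x) (r * qJ x) (r * qK x)"

instance
  by standard
     (auto simp: zero_quat_def plus_quat_def minus_quat_def uminus_quat_def scaleR_quat_def
        algebra_simps intro: quat.expand)

end

instantiation quat :: real_inner
begin

definition inner_quat :: "quat \<Rightarrow> quat \<Rightarrow> real" where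
  "inner x y = qRe x * qRe y + qI x * qI y + qJ x * qJ y + qK x * qK y"

definition norm_quat :: "quat \<Rightarrow> real" where
  "norm x = sqrt ((qRe x)\<^sup>2 + (qI x)\<^sup>2 + (qJ x)\<^sup>2 + (qK x)\<^sup>2)"

definition sgn_quat where
  "sgn x = x /\<^sub>R norm x" for x :: quat

definition dist_quat where
  "dist x y = norm (x - y)" for x y :: quat

definition uniformity_quat :: "(quat \<times> quat) filter" where
  "uniformity_quat = (INF e\<in>{0 <..}. principal {(x, y). dist x y < e})"

definition open_quat :: "quat set \<Rightarrow> bool" where
  "open_quat U \<longleftrightarrow> (\<forall>x\<in>U. eventually (\<lambda>(x', y). x' = x \<longrightarrow> y \<in> U) uniformity)"

instance
proof
  fix x :: quat
  have *: "a*a + b*b + c*c + d*d = 0 \<longleftrightarrow> a = 0 \<and> b = 0 \<and> c = 0 \<and> d = 0" for a b c d :: real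
    by (simp add: add_nonneg_eq_0_iff)
  show "inner x x = 0 \<longleftrightarrow> x = 0"
    unfolding inner_quat_def * by (simp add: quat_eq_iff zero_quat_def)
qed (auto simp: inner_quat_def norm_quat_def sgn_quat_def dist_quat_def uniformity_quat_def
      open_quat_def plus_quat_def scaleR_quat_def algebra_simps power2_eq_square)

end

instantiation quat :: real_normed_div_algebra
begin

definition one_quat :: quat where
  "1 = Quat 1 0 0 0"

definition times_quat :: "quat \<Rightarrow> quat \<Rightarrow> quat" where
  "x * y = Quat
     (qRe x * qRe y - qI x * qI y - qJ x * qJ y - qK x * qK y)
     (qRe x * qI y + qI x * qRe y + qJ x * qK y - qK x * qJ y)
     (qRe x * qJ y - qI x * qK y + qJ x * qRe y + qK x * qI y)
     (qRe x * qK y + qI x * qJ y - qJ x * qI y + qK x * qRe y)"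

definition inverse_quat :: "quat \<Rightarrow> quat" where
  "inverse x = scaleR (inverse ((norm x)\<^sup>2)) (quat_cnj x)"

definition divide_quat :: "quat \<Rightarrow> quat \<Rightarrow> quat" where
  "x div y = x * inverse y" for x y :: quat

instance
proof
  fix x y z :: quat and r :: real
  show "x * y * z = x * (y * z)" "(x + y) * z = x * z + y * z" "x * (y + z) = x * y + x * z"
    by (simp_all add: times_quat_def plus_quat_def algebra_simps)
  have scaleR: "r *\<^sub>R x * y = r *\<^sub>R (x * y)" "x * r *\<^sub>R y = r *\<^sub>R (x * y)"
    for r and x y :: quat
    by (simp_all add: times_quat_def scaleR_quat_def algebra_simps)
  then show "r *\<^sub>R x * y = r *\<^sub>R (x * y)" "x * r *\<^sub>R y = r *\<^sub>R (x * y)"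
    by blast+
  show "1 * x = x" "x * 1 = x" "(0::quat) \<noteq> 1"
    by (simp_all add: times_quat_def one_quat_def zero_quat_def)
  show "x div y = x * inverse y"
    by (rule divide_quat_def)
  show "inverse (0::quat) = 0"
    by (simp add: inverse_quat_def)
  have cnj: "quat_cnj x * x = scaleR ((norm x)\<^sup>2) 1" "x * quat_cnj x = scaleR ((norm x)\<^sup>2) 1"
    by (simp_all add: times_quat_def one_quat_def quat_cnj_def norm_quat_def scaleR_quat_def
          power2_eq_square)
  have "(norm (x * y))\<^sup>2 = (norm x * norm y)\<^sup>2"
    unfolding power_mult_distrib norm_quat_def
    by (simp add: times_quat_def) algebra
  then show "norm (x * y) = norm x * norm y"
    by (rule power2_eq_imp_eq) auto
  assume "x \<noteq> 0"
  then show "inverse x * x = 1" "x * inverse x = 1"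
    by (simp_all add: inverse_quat_def scaleR cnj)
qed

end

section \<open>The scalars: real numbers, complex numbers, quaternions\<close>

text \<open>The last axiom is what all three conjugations have in common (\<open>inner x 1\<close> is the real part
  of \<open>x\<close>), which allows the three cases to be treated uniformly.\<close>

class rch_scalar = real_normed_div_algebra + real_inner +
  fixes kcnj :: "'a \<Rightarrow> 'a"
  assumes kcnj_eq: "kcnj x = (2 * inner x 1) *\<^sub>R 1 - x"

instantiation real :: rch_scalar
begin
definition kcnj_real :: "real \<Rightarrow> real" where "kcnj_real x = x"
instance by standard (simp add: kcnj_real_def)
end

instantiation complex :: rch_scalar
begin
definition kcnj_complex :: "complex \<Rightarrow> complex" where "kcnj_complex = cnj"
instance by standard (simp add: kcnj_complex_def inner_complex_def complex_eq_iff)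
end

instantiation quat :: rch_scalar
begin
definition kcnj_quat :: "quat \<Rightarrow> quat" where "kcnj_quat = quat_cnj"
instance
  by standard
     (simp add: kcnj_quat_def quat_cnj_def inner_quat_def one_quat_def scaleR_quat_def minus_quat_def)
end

section \<open>The Hilbert space of square-summable sequences\<close>

typedef (overloaded) 'k ell2 = "{x :: nat \<Rightarrow> 'k::rch_scalar. summable (\<lambda>n. (norm (x n))\<^sup>2)}"
  morphisms coord Abs_ell2
  by (rule exI [of _ "\<lambda>_. 0"]) simp

setup_lifting type_definition_ell2

lemma ell2_eqI: "(\<And>n. coord x n = coord y n) \<Longrightarrow> x = y"
  by (metis coord_inject ext)

lemma summable_coord: "summable (\<lambda>n. (norm (coord x n))\<^sup>2)"
  using coord [of x] by simp

lemma norm_add_sq_le: "(norm (x + y))\<^sup>2 \<le> 2 * (norm x)\<^sup>2 + 2 * (norm y)\<^sup>2"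
  for x y :: "'a::real_inner"
proof -
  have "0 \<le> (norm (x - y))\<^sup>2" by simp
  then show ?thesis
    by (simp add: power2_norm_eq_inner inner_add_left inner_add_right inner_diff_left
          inner_diff_right inner_commute)
qed

lemma summable_sq_add:
  fixes x y :: "nat \<Rightarrow> 'a::real_inner"
  assumes "summable (\<lambda>n. (norm (x n))\<^sup>2)" "summable (\<lambda>n. (norm (y n))\<^sup>2)"
  shows "summable (\<lambda>n. (norm (x n + y n))\<^sup>2)"
  by (rule summable_comparison_test' [where g = "\<lambda>n. 2 * (norm (x n))\<^sup>2 + 2 * (norm (y n))\<^sup>2" and N = 0])
     (use assms in \<open>auto intro!: summable_add summable_mult norm_add_sq_le\<close>)

lemma summable_inner:
  fixes x y :: "nat \<Rightarrow> 'a::real_inner"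
  assumes "summable (\<lambda>n. (norm (x n))\<^sup>2)" "summable (\<lambda>n. (norm (y n))\<^sup>2)"
  shows "summable (\<lambda>n. inner (x n) (y n))"
proof (rule summable_comparison_test' [where g = "\<lambda>n. (norm (x n))\<^sup>2 + (norm (y n))\<^sup>2" and N = 0])
  show "summable (\<lambda>n. (norm (x n))\<^sup>2 + (norm (y n))\<^sup>2)"
    by (intro summable_add assms)
next
  fix n :: nat
  have "\<bar>inner (x n) (y n)\<bar> \<le> norm (x n) * norm (y n)"
    by (rule Cauchy_Schwarz_ineq2)
  also have "\<dots> \<le> (norm (x n))\<^sup>2 + (norm (y n))\<^sup>2"
    using sum_squares_bound [of "norm (x n)" "norm (y n)"]
      mult_nonneg_nonneg [OF norm_ge_zero [of "x n"] norm_ge_zero [of "y n"]] by linarith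
  finally show "norm (inner (x n) (y n)) \<le> (norm (x n))\<^sup>2 + (norm (y n))\<^sup>2" by simp
qed

instantiation ell2 :: (rch_scalar) real_vector
begin

lift_definition zero_ell2 :: "'a ell2" is "\<lambda>_. 0"
  by simp

lift_definition plus_ell2 :: "'a ell2 \<Rightarrow> 'a ell2 \<Rightarrow> 'a ell2" is "\<lambda>x y n. x n + y n"
  by (rule summable_sq_add)

lift_definition uminus_ell2 :: "'a ell2 \<Rightarrow> 'a ell2" is "\<lambda>x n. - x n"
  by simp

lift_definition minus_ell2 :: "'a ell2 \<Rightarrow> 'a ell2 \<Rightarrow> 'a ell2" is "\<lambda>x y n. x n - y n"
  using summable_sq_add [where y = "\<lambda>n. - y n" for y] by fastforce

lift_definition scaleR_ell2 :: "real \<Rightarrow> 'a ell2 \<Rightarrow> 'a ell2" is "\<lambda>r x n. r *\<^sub>R x n"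
  by (simp add: power_mult_distrib summable_mult)

instance
  by standard (transfer; simp add: algebra_simps)+

end

instantiation ell2 :: (rch_scalar) real_inner
begin

definition inner_ell2 :: "'a ell2 \<Rightarrow> 'a ell2 \<Rightarrow> real" where
  "inner x y = (\<Sum>n. inner (coord x n) (coord y n))"

definition norm_ell2 :: "'a ell2 \<Rightarrow> real" where
  "norm x = sqrt (\<Sum>n. (norm (coord x n))\<^sup>2)"

definition sgn_ell2 where
  "sgn x = x /\<^sub>R norm x" for x :: "'a ell2"

definition dist_ell2 where
  "dist x y = norm (x - y)" for x y :: "'a ell2"

definition uniformity_ell2 :: "('a ell2 \<times> 'a ell2) filter" where
  "uniformity_ell2 = (INF e\<in>{0 <..}. principal {(x, y). dist x y < e})"

definition open_ell2 :: "'a ell2 set \<Rightarrow> bool" where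
  "open_ell2 U \<longleftrightarrow> (\<forall>x\<in>U. eventually (\<lambda>(x', y). x' = x \<longrightarrow> y \<in> U) uniformity)"

instance
proof
  fix x y z :: "'a ell2" and r :: real
  note s = summable_inner [OF summable_coord summable_coord]
  show "inner x y = inner y x"
    by (simp add: inner_ell2_def inner_commute)
  show "inner (x + y) z = inner x z + inner y z"
    by (simp add: inner_ell2_def plus_ell2.rep_eq inner_add_left suminf_add [OF s s])
  show "inner (r *\<^sub>R x) y = r * inner x y"
    by (simp add: inner_ell2_def scaleR_ell2.rep_eq suminf_mult [OF s])
  show "0 \<le> inner x x"
    unfolding inner_ell2_def by (rule suminf_nonneg [OF s]) simp
  show "inner x x = 0 \<longleftrightarrow> x = 0"
  proof
    assume "inner x x = 0"
    then have "inner (coord x n) (coord x n) = 0" for n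
      unfolding inner_ell2_def using suminf_eq_zero_iff [OF s [of x x]] by simp
    then show "x = 0"
      by (intro ell2_eqI) (simp add: zero_ell2.rep_eq)
  qed (simp add: inner_ell2_def zero_ell2.rep_eq)
  show "norm x = sqrt (inner x x)"
    by (simp add: norm_ell2_def inner_ell2_def power2_norm_eq_inner)
qed (simp_all add: sgn_ell2_def dist_ell2_def uniformity_ell2_def open_ell2_def)

end

text \<open>Over the quaternions the space is a right vector space, so that matrices act from the left and
  the sesquilinear form is conjugate linear in its first argument.\<close>

lift_definition scaleK :: "'k::rch_scalar ell2 \<Rightarrow> 'k \<Rightarrow> 'k ell2" (infixl "\<cdot>\<^sub>K" 75)
  is "\<lambda>x c n. x n * c"
  by (simp add: norm_mult power_mult_distrib summable_mult2)

definition kinner :: "'k::rch_scalar ell2 \<Rightarrow> 'k ell2 \<Rightarrow> 'k" where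
  "kinner x y = (\<Sum>n. kcnj (coord x n) * coord y n)"

lift_definition basis_vec :: "nat \<Rightarrow> 'k::rch_scalar ell2" is "\<lambda>j n. if n = j then 1 else 0"
  by (rule summable_finite [of "{j}" for j]) auto

section \<open>Groups of unitary operators on the sequence space\<close>

text \<open>Operators are elements of the normed space of bounded real-linear maps, whose metric is the
  one of the operator norm.\<close>

type_synonym 'k op = "'k ell2 \<Rightarrow>\<^sub>L 'k ell2"

definition k_unitary :: "'k::rch_scalar op \<Rightarrow> bool" where
  "k_unitary g \<longleftrightarrow>
     (\<forall>x c. blinfun_apply g (x \<cdot>\<^sub>K c) = blinfun_apply g x \<cdot>\<^sub>K c) \<and>
     surj (blinfun_apply g) \<and>
     (\<forall>x y. kinner (blinfun_apply g x) (blinfun_apply g y) = kinner x y)"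

definition compact_operator :: "('a::real_normed_vector \<Rightarrow>\<^sub>L 'b::real_normed_vector) \<Rightarrow> bool" where
  "compact_operator T \<longleftrightarrow> (\<forall>B. bounded B \<longrightarrow> compact (closure (blinfun_apply T ` B)))"

definition U_infty :: "'k::rch_scalar op set" where
  "U_infty = {g. k_unitary g \<and> compact_operator (g - id_blinfun)}"

definition U_infty_0 :: "'k::rch_scalar op set" where
  "U_infty_0 = connected_component_set U_infty id_blinfun"

text \<open>Indices start at \<open>0\<close>, so the first \<open>n\<close> basis vectors are those with index less than \<open>n\<close>.\<close>

definition span_first :: "nat \<Rightarrow> 'k::rch_scalar ell2 set" where
  "span_first n = {x. \<exists>c. x = (\<Sum>j<n. basis_vec j \<cdot>\<^sub>K c j)}"

definition U_fin :: "nat \<Rightarrow> 'k::rch_scalar op set" where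
  "U_fin n = {g. k_unitary g \<and> blinfun_apply g ` span_first n = span_first n \<and>
     (\<forall>x. (\<forall>y\<in>span_first n. kinner y x = 0) \<longrightarrow> blinfun_apply g x = x)}"

definition U_fin_0 :: "nat \<Rightarrow> 'k::rch_scalar op set" where
  "U_fin_0 n = connected_component_set (U_fin n) id_blinfun"

definition U_lim_0 :: "'k::rch_scalar op set" where
  "U_lim_0 = (\<Union>n. U_fin_0 n)"

definition direct_limit_topology :: "'k::rch_scalar op topology" where
  "direct_limit_topology = topology (\<lambda>W. W \<subseteq> U_lim_0 \<and>
     (\<forall>n. openin (top_of_set (U_fin_0 n)) (W \<inter> U_fin_0 n)))"

lemma openin_direct_limit_topology:
  "openin direct_limit_topology W \<longleftrightarrow>
     W \<subseteq> U_lim_0 \<and> (\<forall>n. openin (top_of_set (U_fin_0 n)) (W \<inter> U_fin_0 n))"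
proof -
  have "istopology (\<lambda>W :: 'a op set. W \<subseteq> U_lim_0 \<and>
     (\<forall>n. openin (top_of_set (U_fin_0 n)) (W \<inter> U_fin_0 n)))"
    unfolding istopology_def
  proof (rule conjI; intro allI impI)
    fix S T :: "'a op set"
    assume S: "S \<subseteq> U_lim_0 \<and> (\<forall>n. openin (top_of_set (U_fin_0 n)) (S \<inter> U_fin_0 n))"
      and T: "T \<subseteq> U_lim_0 \<and> (\<forall>n. openin (top_of_set (U_fin_0 n)) (T \<inter> U_fin_0 n))"
    have eq: "(S \<inter> U_fin_0 n) \<inter> (T \<inter> U_fin_0 n) = S \<inter> T \<inter> U_fin_0 n" for n
      by blast
    have "openin (top_of_set (U_fin_0 n)) (S \<inter> T \<inter> U_fin_0 n)" for n
      using openin_Int [OF S [THEN conjunct2, rule_format, of n] T [THEN conjunct2, rule_format, of n]]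
      by (simp only: eq)
    with S show "S \<inter> T \<subseteq> U_lim_0 \<and>
        (\<forall>n. openin (top_of_set (U_fin_0 n)) (S \<inter> T \<inter> U_fin_0 n))"
      by blast
  next
    fix \<W> :: "'a op set set"
    assume W: "\<forall>W\<in>\<W>. W \<subseteq> U_lim_0 \<and>
        (\<forall>n. openin (top_of_set (U_fin_0 n)) (W \<inter> U_fin_0 n))"
    have "openin (top_of_set (U_fin_0 n)) (\<Union>W\<in>\<W>. W \<inter> U_fin_0 n)" for n
      using W by (intro openin_Union) blast
    then have "openin (top_of_set (U_fin_0 n)) (\<Union>\<W> \<inter> U_fin_0 n)" for n
      by (simp only: Int_Union2)
    with W show "\<Union>\<W> \<subseteq> U_lim_0 \<and>
        (\<forall>n. openin (top_of_set (U_fin_0 n)) (\<Union>\<W> \<inter> U_fin_0 n))"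
      by blast
  qed
  then show ?thesis
    unfolding direct_limit_topology_def by (simp add: topology_inverse')
qed

lemma topspace_direct_limit_topology: "topspace direct_limit_topology = U_lim_0"
proof
  have "U_lim_0 \<inter> U_fin_0 n = (U_fin_0 n :: 'a op set)" for n
    by (auto simp: U_lim_0_def)
  then have "openin direct_limit_topology (U_lim_0 :: 'a op set)"
    unfolding openin_direct_limit_topology by auto
  then show "(U_lim_0 :: 'a op set) \<subseteq> topspace direct_limit_topology"
    by (rule openin_subset)
  show "topspace direct_limit_topology \<subseteq> (U_lim_0 :: 'a op set)"
    using openin_topspace openin_direct_limit_topology by blast
qed

section \<open>Unitary representations on complex Hilbert spaces\<close>

text \<open>The inner product is linear in its second argument.\<close>

class chilbert_space = banach +
  fixes scaleC :: "complex \<Rightarrow> 'a \<Rightarrow> 'a" (infixr "*\<^sub>C" 75)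
    and cinner :: "'a \<Rightarrow> 'a \<Rightarrow> complex"
  assumes scaleC_add_right: "a *\<^sub>C (x + y) = a *\<^sub>C x + a *\<^sub>C y"
    and scaleC_add_left: "(a + b) *\<^sub>C x = a *\<^sub>C x + b *\<^sub>C x"
    and scaleC_scaleC: "a *\<^sub>C (b *\<^sub>C x) = (a * b) *\<^sub>C x"
    and scaleC_of_real: "complex_of_real r *\<^sub>C x = r *\<^sub>R x"
    and cinner_commute: "cinner x y = cnj (cinner y x)"
    and cinner_add_right: "cinner x (y + z) = cinner x y + cinner x z"
    and cinner_scaleC_right: "cinner x (a *\<^sub>C y) = a * cinner x y"
    and cinner_self: "cinner x x = complex_of_real ((norm x)\<^sup>2)"

instantiation complex :: chilbert_space
begin
definition scaleC_complex :: "complex \<Rightarrow> complex \<Rightarrow> complex" where "scaleC_complex = (*)"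
definition cinner_complex :: "complex \<Rightarrow> complex \<Rightarrow> complex" where "cinner_complex x y = cnj x * y"
instance
  by standard
     (simp_all add: scaleC_complex_def cinner_complex_def algebra_simps scaleR_conv_of_real
        complex_norm_square del: of_real_power)
end

definition c_unitary :: "('v::chilbert_space \<Rightarrow>\<^sub>L 'v) \<Rightarrow> bool" where
  "c_unitary u \<longleftrightarrow>
     (\<forall>a x. blinfun_apply u (a *\<^sub>C x) = a *\<^sub>C blinfun_apply u x) \<and>
     surj (blinfun_apply u) \<and>
     (\<forall>x y. cinner (blinfun_apply u x) (blinfun_apply u y) = cinner x y)"

definition op_group :: "('a::real_normed_vector \<Rightarrow>\<^sub>L 'a) set \<Rightarrow> ('a \<Rightarrow>\<^sub>L 'a) monoid" where
  "op_group S = \<lparr>carrier = S, mult = (o\<^sub>L), one = id_blinfun\<rparr>"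

text \<open>A unitary representation of the group with carrier \<open>topspace T\<close>, continuous for \<open>T\<close> and the
  strong operator topology. Only the values of \<open>\<pi>\<close> on \<open>topspace T\<close> matter.\<close>

definition unitary_rep :: "'k::rch_scalar op topology \<Rightarrow> ('k op \<Rightarrow> 'v::chilbert_space \<Rightarrow>\<^sub>L 'v) \<Rightarrow> bool" where
  "unitary_rep T \<pi> \<longleftrightarrow>
     \<pi> \<in> hom (op_group (topspace T)) (op_group {u. c_unitary u}) \<and>
     (\<forall>v. continuous_map T euclidean (\<lambda>g. blinfun_apply (\<pi> g) v))"

definition K_sub :: "nat \<Rightarrow> 'k::rch_scalar op set" where
  "K_sub n = {g \<in> U_lim_0. \<forall>j<n. blinfun_apply g (basis_vec j) = basis_vec j}"

definition fixed_vectors :: "'k::rch_scalar op set \<Rightarrow> ('k op \<Rightarrow> 'v::chilbert_space \<Rightarrow>\<^sub>L 'v) \<Rightarrow> 'v set" where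
  "fixed_vectors S \<pi> = {v. \<forall>g\<in>S. blinfun_apply (\<pi> g) v = v}"

definition tame :: "('k::rch_scalar op \<Rightarrow> 'v::chilbert_space \<Rightarrow>\<^sub>L 'v) \<Rightarrow> bool" where
  "tame \<pi> \<longleftrightarrow> closure (\<Union>n. fixed_vectors (K_sub n) \<pi>) = UNIV"

definition extends_to_U_infty_0 :: "('k::rch_scalar op \<Rightarrow> 'v::chilbert_space \<Rightarrow>\<^sub>L 'v) \<Rightarrow> bool" where
  "extends_to_U_infty_0 \<pi> \<longleftrightarrow>
     (\<exists>\<rho>. unitary_rep (top_of_set U_infty_0) \<rho> \<and> (\<forall>g\<in>U_lim_0. \<rho> g = \<pi> g))"

end

theory Submission
  imports Defs
begin

text \<open>Tameness and extendability are both equivalent to a third property: every orbit map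
  \<open>g \<mapsto> \<pi> g v\<close> on the direct limit is continuous at the identity for the operator norm
  (\<open>norm_continuous\<close>).

  \<^emph>\<open>Norm continuity and extension.\<close> Unitaries preserve the operator norm under multiplication from
  either side, so an orbit map that is continuous at the identity is uniformly continuous and extends
  to the norm closure of the direct limit. This closure contains the whole identity component of the
  group of compact perturbations (\<open>U_infty_0_subset_closure\<close>): by connectedness only a unitary \<open>g\<close>
  near the identity has to be approximated, and there \<open>g = (1 + S) (1 - S)\<^sup>-\<^sup>1\<close> with \<open>S\<close> compact and
  skew, so that truncating \<open>S\<close> to the first coordinates gives finite unitaries that converge to \<open>g\<close>
  and are joined to the identity by the Cayley transforms of \<open>t S\<close>.

  \<^emph>\<open>Tame representations are norm continuous.\<close> Let \<open>v\<close> be fixed by \<open>K_sub n\<close>. An element \<open>g\<close> moves \<open>v\<close>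
  as far as some \<open>h\<close> in the fixed finite-dimensional group \<open>U_fin_0 (3 n)\<close>, and \<open>h\<close> can be chosen with
  \<open>\<parallel>h - 1\<parallel> \<le> 7\<^sup>n \<parallel>g - 1\<parallel>\<close> (\<open>double_coset_form\<close>): conjugate by \<open>K_sub n\<close> so that \<open>g\<close> sends the first \<open>n\<close>
  basis vectors into the first \<open>2 n\<close> coordinates, and then reproduce this motion by a product of
  rotations that is close to the identity. Continuity on that one group is enough.

  \<^emph>\<open>Norm continuous representations are tame.\<close> Let \<open>\<pi> p\<close> move \<open>v\<close> by little whenever \<open>\<parallel>p - 1\<parallel> \<le> \<delta>\<close>.
  Elements that act on disjoint sets of coordinates can be multiplied without increasing the distance
  to the identity (\<open>norm_disjoint_le\<close>). So the convex hull of the vectors \<open>\<pi> p v\<close> lies near \<open>v\<close>, and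
  it is stable under averaging with an element within \<open>\<delta>\<close> of the identity that acts on later coordinates. By the parallelogram law such an element almost fixes an almost shortest vector \<open>w\<close> of
  the hull (\<open>almost_fixed_by_small\<close>). Every element of \<open>K_sub n\<close> is a product of \<open>N\<close> elements of
  \<open>K_sub n\<close> at distance at most \<open>\<delta>\<close>, where \<open>N\<close> depends on \<open>\<delta>\<close> alone (\<open>bounded_generation\<close>, a finite
  version of the Eilenberg swindle). So \<open>w\<close> is almost fixed by a whole group \<open>K_sub M\<close>, and the shortest
  vector in the closed convex hull of its orbit is fixed.\<close>

section \<open>Scalars\<close>

text \<open>Completeness gives the convergence of the sesquilinear form, local compactness makes bounded
  operators of finite rank compact.\<close>

class lc_scalar = rch_scalar + banach + heine_borel

instance quat :: heine_borel
proof
  fix f :: "nat \<Rightarrow> quat"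
  define t where "t = (\<lambda>q. (qRe q, qI q, qJ q, qK q))"
  have t_norm: "dist (t p) (t q) = dist p q" for p q
    by (simp add: t_def dist_norm norm_Pair norm_quat_def minus_quat_def)
  assume "bounded (range f)"
  then obtain x e where "\<And>n. dist x (f n) \<le> e"
    unfolding bounded_def by blast
  then have "bounded (range (t \<circ> f))"
    unfolding bounded_def by (intro exI [of _ "t x"] exI [of _ e]) (simp add: t_norm)
  then obtain l r where r: "strict_mono r" and l: "((t \<circ> f) \<circ> r) \<longlonglongrightarrow> l"
    using bounded_imp_convergent_subsequence by blast
  obtain a b c d where "l = (a, b, c, d)"
    by (cases l) auto
  then have l': "l = t (Quat a b c d)"
    by (simp add: t_def)
  have "(f \<circ> r) \<longlonglongrightarrow> Quat a b c d"
    using l unfolding l' by (subst (asm) tendsto_dist_iff, subst tendsto_dist_iff) (simp add: t_norm)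
  with r show "\<exists>l r. strict_mono r \<and> (f \<circ> r) \<longlonglongrightarrow> l"
    by blast
qed

instance quat :: banach ..

instance real :: lc_scalar ..
instance complex :: lc_scalar ..
instance quat :: lc_scalar ..

lemma inner_mult_left_same: "inner (a * x) (a * y) = (norm a)\<^sup>2 * inner x y"
  for a x y :: "'k::rch_scalar"
proof -
  have "inner (a * x) (a * y) = ((norm (a * (x + y)))\<^sup>2 - (norm (a * x))\<^sup>2 - (norm (a * y))\<^sup>2) / 2"
    unfolding distrib_left by (rule dot_norm)
  then show ?thesis
    unfolding norm_mult power_mult_distrib dot_norm [of x y] by (simp add: right_diff_distrib)
qed

lemma inner_mult_right_same: "inner (x * a) (y * a) = (norm a)\<^sup>2 * inner x y"
  for a x y :: "'k::rch_scalar"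
proof -
  have "inner (x * a) (y * a) = ((norm ((x + y) * a))\<^sup>2 - (norm (x * a))\<^sup>2 - (norm (y * a))\<^sup>2) / 2"
    unfolding distrib_right by (rule dot_norm)
  then show ?thesis
    unfolding norm_mult power_mult_distrib dot_norm [of x y] by (simp add: algebra_simps diff_divide_distrib)
qed

text \<open>As in any composition algebra, comparing the scaling law for \<open>a + 1\<close>, \<open>a\<close> and \<open>1\<close> shows that
  multiplication by the conjugate is the adjoint of multiplication. The rules for conjugation of
  products follow by uniqueness of adjoints.\<close>

lemma inner_mult_kcnj_left: "inner (a * x) y = inner x (kcnj a * y)"
  for a x y :: "'k::rch_scalar"
proof -
  have "(norm (a + 1))\<^sup>2 = (norm a)\<^sup>2 + 2 * inner a 1 + 1"
    by (simp add: power2_norm_eq_inner inner_add inner_commute norm_eq_1 [THEN iffD1, OF norm_one])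
  then show ?thesis
    using inner_mult_left_same [of "a + 1" x y] inner_mult_left_same [of a x y]
    by (simp add: kcnj_eq algebra_simps inner_add inner_diff)
qed

lemma inner_mult_kcnj_right: "inner (x * a) y = inner x (y * kcnj a)"
  for a x y :: "'k::rch_scalar"
proof -
  have "(norm (a + 1))\<^sup>2 = (norm a)\<^sup>2 + 2 * inner a 1 + 1"
    by (simp add: power2_norm_eq_inner inner_add inner_commute norm_eq_1 [THEN iffD1, OF norm_one])
  then show ?thesis
    using inner_mult_right_same [of x "a + 1" y] inner_mult_right_same [of x a y]
    by (simp add: kcnj_eq algebra_simps inner_add inner_diff)
qed

lemma kcnj_kcnj [simp]: "kcnj (kcnj a) = (a::'k::rch_scalar)"
  by (simp add: kcnj_eq inner_diff norm_eq_1 [THEN iffD1, OF norm_one])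

lemma kcnj_zero [simp]: "kcnj 0 = (0::'k::rch_scalar)" and kcnj_one [simp]: "kcnj 1 = (1::'k)"
  by (simp_all add: kcnj_eq norm_eq_1 [THEN iffD1, OF norm_one] algebra_simps scaleR_2)

lemma inner_ext: "(\<And>z. inner x z = inner y z) \<Longrightarrow> x = y" for x y :: "'a::real_inner"
  using vector_eq_rdot by blast

lemma kcnj_mult: "kcnj (a * b) = kcnj b * kcnj a" for a b :: "'k::rch_scalar"
proof (rule inner_ext)
  fix z
  show "inner (kcnj (a * b)) z = inner (kcnj b * kcnj a) z"
    using inner_mult_kcnj_left [of "a * b" z 1] inner_mult_kcnj_left [of a "b * z" 1]
      inner_mult_kcnj_left [of b z "kcnj a"]
    by (simp add: mult.assoc inner_commute)
qed

lemma norm_kcnj [simp]: "norm (kcnj a) = norm (a::'k::rch_scalar)"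
  by (metis inner_commute inner_mult_kcnj_left kcnj_kcnj mult.right_neutral norm_eq_sqrt_inner
      inner_mult_kcnj_right mult.left_neutral)

section \<open>The sesquilinear form\<close>

lemma coord_simps [simp]:
  "coord (x + y) n = coord x n + coord y n"
  "coord (x - y) n = coord x n - coord y n"
  "coord (- x) n = - coord x n"
  "coord (r *\<^sub>R x) n = r *\<^sub>R coord x n"
  "coord 0 n = 0"
  "coord (x \<cdot>\<^sub>K c) n = coord x n * c"
  "coord (basis_vec j) n = (if n = j then 1 else 0)"
  by (transfer; simp)+

lemma coord_sum [simp]: "coord (\<Sum>i\<in>A. f i) n = (\<Sum>i\<in>A. coord (f i) n)"
  by (induction A rule: infinite_finite_induct) auto

lemma inner_scaleK: "inner (x \<cdot>\<^sub>K c) y = inner x (y \<cdot>\<^sub>K kcnj c)"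
  by (simp add: inner_ell2_def inner_mult_kcnj_right)

lemma scaleK_simps [simp]:
  "(x + y) \<cdot>\<^sub>K c = x \<cdot>\<^sub>K c + y \<cdot>\<^sub>K c"
  "(x - y) \<cdot>\<^sub>K c = x \<cdot>\<^sub>K c - y \<cdot>\<^sub>K c"
  "(- x) \<cdot>\<^sub>K c = - (x \<cdot>\<^sub>K c)"
  "(r *\<^sub>R x) \<cdot>\<^sub>K c = r *\<^sub>R (x \<cdot>\<^sub>K c)"
  "0 \<cdot>\<^sub>K c = 0" "x \<cdot>\<^sub>K 0 = 0" "x \<cdot>\<^sub>K 1 = x"
  "x \<cdot>\<^sub>K (c + d) = x \<cdot>\<^sub>K c + x \<cdot>\<^sub>K d"
  "x \<cdot>\<^sub>K (c - d) = x \<cdot>\<^sub>K c - x \<cdot>\<^sub>K d"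
  "x \<cdot>\<^sub>K (r *\<^sub>R c) = r *\<^sub>R (x \<cdot>\<^sub>K c)"
  "(x \<cdot>\<^sub>K c) \<cdot>\<^sub>K d = x \<cdot>\<^sub>K (c * d)"
  by (rule ell2_eqI; simp add: algebra_simps)+

lemma norm_scaleK: "norm (x \<cdot>\<^sub>K c) = norm x * norm c"
proof -
  have "(norm (x \<cdot>\<^sub>K c))\<^sup>2 = (norm x * norm c)\<^sup>2"
    unfolding power_mult_distrib norm_ell2_def
    by (simp add: norm_mult power_mult_distrib suminf_nonneg summable_coord summable_mult2
        suminf_mult2)
  then show ?thesis by (rule power2_eq_imp_eq) auto
qed

lemma norm_coord_le: "norm (coord x n) \<le> norm x"
proof -
  have "(\<Sum>i\<in>{n}. (norm (coord x i))\<^sup>2) \<le> (\<Sum>i. (norm (coord x i))\<^sup>2)"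
    by (intro sum_le_suminf summable_coord) auto
  then show ?thesis
    unfolding norm_ell2_def by (intro real_le_rsqrt) simp
qed

text \<open>The real inner product determines the \<open>K\<close>-valued form: \<open>kinner x\<close> is the adjoint of
  \<open>c \<mapsto> x \<cdot>\<^sub>K c\<close>. The sesquilinearity rules below are read off from this.\<close>

lemma inner_kinner: "inner (kinner x y) c = inner y (x \<cdot>\<^sub>K c)"
  for x y :: "'k::lc_scalar ell2"
proof -
  have "summable (\<lambda>n. norm (kcnj (coord x n) * coord y n))"
  proof (rule summable_comparison_test')
    show "summable (\<lambda>n. (norm (coord x n))\<^sup>2 + (norm (coord y n))\<^sup>2)"
      by (intro summable_add summable_coord)
    show "norm (norm (kcnj (coord x n) * coord y n)) \<le> (norm (coord x n))\<^sup>2 + (norm (coord y n))\<^sup>2"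
      for n
    proof -
      have "0 \<le> norm (coord x n) * norm (coord y n)" by simp
      then have "norm (coord x n) * norm (coord y n) \<le> (norm (coord x n))\<^sup>2 + (norm (coord y n))\<^sup>2"
        using sum_squares_bound [of "norm (coord x n)" "norm (coord y n)"] by linarith
      then show ?thesis by (simp add: norm_mult)
    qed
  qed
  then have s: "summable (\<lambda>n. kcnj (coord x n) * coord y n)"
    by (rule summable_norm_cancel)
  have "inner (kinner x y) c = (\<Sum>n. inner (kcnj (coord x n) * coord y n) c)"
    unfolding kinner_def by (rule bounded_linear.suminf [OF bounded_linear_inner_left s])
  then show ?thesis
    by (simp add: inner_ell2_def inner_mult_kcnj_left)
qed

lemma kinner_add_right: "kinner x (y + z) = kinner x y + kinner x z"
  and kinner_diff_right: "kinner x (y - z) = kinner x y - kinner x z"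
  and kinner_scaleR_right: "kinner x (r *\<^sub>R y) = r *\<^sub>R kinner x y"
  and kinner_minus_right: "kinner x (- y) = - kinner x y"
  and kinner_zero_right: "kinner x 0 = 0"
  and kinner_scaleK_right: "kinner x (y \<cdot>\<^sub>K c) = kinner x y * c"
  for x y z :: "'k::lc_scalar ell2"
  by (rule inner_ext; simp add: inner_kinner inner_add inner_diff inner_scaleK inner_mult_kcnj_right)+

lemma kinner_commute: "kcnj (kinner x y) = kinner y x" for x y :: "'k::lc_scalar ell2"
proof (rule inner_ext)
  fix c
  have "inner (kcnj (kinner x y)) c = inner (kinner x y) (kcnj c)"
    by (metis inner_commute inner_mult_kcnj_left kcnj_kcnj mult.right_neutral
        inner_mult_kcnj_right mult.left_neutral)
  then show "inner (kcnj (kinner x y)) c = inner (kinner y x) c"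
    by (metis inner_commute inner_kinner inner_scaleK kcnj_kcnj)
qed

lemma kcnj_add: "kcnj (a + b) = kcnj a + kcnj b" and kcnj_diff: "kcnj (a - b) = kcnj a - kcnj b"
  and kcnj_minus: "kcnj (- a) = - kcnj a" and kcnj_scaleR: "kcnj (r *\<^sub>R a) = r *\<^sub>R kcnj a"
  for a b :: "'k::rch_scalar"
  by (simp_all add: kcnj_eq inner_add inner_diff algebra_simps)

lemma kinner_add_left: "kinner (x + y) z = kinner x z + kinner y z"
  and kinner_diff_left: "kinner (x - y) z = kinner x z - kinner y z"
  and kinner_scaleR_left: "kinner (r *\<^sub>R x) z = r *\<^sub>R kinner x z"
  and kinner_minus_left: "kinner (- x) z = - kinner x z"
  and kinner_zero_left: "kinner 0 z = 0"
  and kinner_scaleK_left: "kinner (x \<cdot>\<^sub>K c) z = kcnj c * kinner x z"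
  for x y z :: "'k::lc_scalar ell2"
  by (simp_all add: kinner_commute [of z, symmetric] kinner_add_right kinner_diff_right
      kinner_scaleR_right kinner_minus_right kinner_zero_right kinner_scaleK_right
      kcnj_add kcnj_diff kcnj_minus kcnj_scaleR kcnj_mult)

lemmas kinner_simps [simp] =
  kinner_add_right kinner_diff_right kinner_scaleR_right kinner_minus_right kinner_zero_right
  kinner_scaleK_right kinner_add_left kinner_diff_left kinner_scaleR_left kinner_minus_left
  kinner_zero_left kinner_scaleK_left

lemma kinner_basis_left [simp]: "kinner (basis_vec j) y = coord y j" for y :: "'k::lc_scalar ell2"
  unfolding kinner_def by (subst suminf_finite [of "{j}"]) auto

lemma kinner_basis_right [simp]: "kinner y (basis_vec j) = kcnj (coord y j)"
  for y :: "'k::lc_scalar ell2"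
  by (simp flip: kinner_commute [of _ y])

lemma kinner_eq_0_commute: "kinner x y = 0 \<longleftrightarrow> kinner y x = 0" for x y :: "'k::lc_scalar ell2"
  by (metis kcnj_zero kinner_commute)

lemma kinner_self: "kinner x x = (norm x)\<^sup>2 *\<^sub>R 1" for x :: "'k::lc_scalar ell2"
proof -
  let ?a = "kinner x x"
  have "2 *\<^sub>R ?a = (2 * inner ?a 1) *\<^sub>R 1"
    using kinner_commute [of x x] by (simp add: kcnj_eq scaleR_2 diff_eq_eq)
  then have "?a = inner ?a 1 *\<^sub>R 1"
    by (metis scaleR_scaleR scaleR_cancel_left zero_neq_numeral)
  then show ?thesis
    by (simp add: inner_kinner power2_norm_eq_inner)
qed

lemma norm_kinner_le: "norm (kinner x y) \<le> norm x * norm y" for x y :: "'k::lc_scalar ell2"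
proof -
  let ?c = "kinner x y"
  have "norm ?c * norm ?c = inner y (x \<cdot>\<^sub>K ?c)"
    by (simp flip: inner_kinner power2_norm_eq_inner power2_eq_square)
  also have "\<dots> \<le> norm y * norm (x \<cdot>\<^sub>K ?c)"
    by (rule norm_cauchy_schwarz)
  finally have "norm ?c * norm ?c \<le> (norm x * norm y) * norm ?c"
    by (simp add: norm_scaleK mult_ac)
  then show ?thesis
    by (cases "norm ?c = 0") (auto simp: mult_le_cancel_right)
qed

lemma norm_basis_vec [simp]: "norm (basis_vec j :: 'k::lc_scalar ell2) = 1"
  unfolding norm_ell2_def by (subst suminf_finite [of "{j}"]) auto

section \<open>Unitary operators\<close>

lemmas op_simps [simp] = blinfun.add_left blinfun.diff_left blinfun.scaleR_left blinfun.minus_left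
  blinfun.zero_left blinfun.add_right blinfun.diff_right blinfun.scaleR_right blinfun.minus_right
  blinfun.zero_right

text \<open>One notion for the sequence space and for the representation space.\<close>

definition isom_op :: "('a::real_normed_vector \<Rightarrow>\<^sub>L 'a) \<Rightarrow> bool" where
  "isom_op g \<longleftrightarrow> surj (blinfun_apply g) \<and> (\<forall>x. norm (blinfun_apply g x) = norm x)"

text \<open>The inverse as a bounded operator; only its values for \<open>isom_op g\<close> are meaningful.\<close>

definition inv_op :: "('a::real_normed_vector \<Rightarrow>\<^sub>L 'a) \<Rightarrow> ('a \<Rightarrow>\<^sub>L 'a)" where
  "inv_op g = Blinfun (inv_into UNIV (blinfun_apply g))"

lemma isom_op_norm: "isom_op g \<Longrightarrow> norm (blinfun_apply g x) = norm x"
  by (simp add: isom_op_def)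

lemma isom_op_bij: "isom_op g \<Longrightarrow> bij (blinfun_apply g)"
  unfolding isom_op_def bij_def inj_def
  by (metis blinfun.diff_right eq_iff_diff_eq_0 norm_eq_zero)

lemma
  assumes "isom_op g"
  shows inv_op_left [simp]: "blinfun_apply (inv_op g) (blinfun_apply g x) = x"
    and inv_op_right [simp]: "blinfun_apply g (blinfun_apply (inv_op g) x) = x"
    and isom_op_inv: "isom_op (inv_op g)"
proof -
  note b = isom_op_bij [OF assms]
  have l: "inv_into UNIV (blinfun_apply g) (blinfun_apply g x) = x" for x
    using b by (simp add: bij_is_inj)
  have r: "blinfun_apply g (inv_into UNIV (blinfun_apply g) x) = x" for x
    using b by (simp add: bij_is_surj surj_f_inv_f)
  have n: "norm (inv_into UNIV (blinfun_apply g) x) = norm x" for x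
    using isom_op_norm [OF assms, of "inv_into UNIV (blinfun_apply g) x"] by (simp add: r)
  have "bounded_linear (inv_into UNIV (blinfun_apply g))"
  proof (rule bounded_linear_intro)
    show "inv_into UNIV (blinfun_apply g) (x + y) = inv_into UNIV (blinfun_apply g) x + inv_into UNIV (blinfun_apply g) y" for x y
      by (metis blinfun.add_right l r)
    show "inv_into UNIV (blinfun_apply g) (c *\<^sub>R x) = c *\<^sub>R inv_into UNIV (blinfun_apply g) x" for c x
      by (metis blinfun.scaleR_right l r)
    show "norm (inv_into UNIV (blinfun_apply g) x) \<le> norm x * 1" for x
      by (simp add: n)
  qed
  then have a: "blinfun_apply (inv_op g) = inv_into UNIV (blinfun_apply g)"
    unfolding inv_op_def by (rule bounded_linear_Blinfun_apply)
  show "blinfun_apply (inv_op g) (blinfun_apply g x) = x"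
    "blinfun_apply g (blinfun_apply (inv_op g) x) = x"
    by (simp_all add: a l r)
  show "isom_op (inv_op g)"
    unfolding isom_op_def a using b n by (simp add: bij_imp_bij_inv bij_is_surj)
qed

lemma inv_op_compose: "isom_op g \<Longrightarrow> inv_op g o\<^sub>L g = id_blinfun" "isom_op g \<Longrightarrow> g o\<^sub>L inv_op g = id_blinfun"
  by (auto intro!: blinfun_eqI)

lemma isom_op_id [simp]: "isom_op id_blinfun"
  by (auto simp: isom_op_def)

lemma isom_op_compose: "isom_op g \<Longrightarrow> isom_op h \<Longrightarrow> isom_op (g o\<^sub>L h)"
  unfolding isom_op_def blinfun_compose.rep_eq using comp_surj [of "blinfun_apply h" "blinfun_apply g"]
  by (auto simp: comp_def)

lemma norm_isom_compose_left: "isom_op g \<Longrightarrow> norm (g o\<^sub>L T) = norm T"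
  by (simp add: norm_blinfun.rep_eq onorm_def isom_op_norm)

lemma compose_eq_apply:
  "a o\<^sub>L b = c o\<^sub>L d \<Longrightarrow> blinfun_apply a (blinfun_apply b x) = blinfun_apply c (blinfun_apply d x)"
  by (metis blinfun_apply_blinfun_compose)

lemma blinfun_compose_assoc: "(f o\<^sub>L g) o\<^sub>L h = f o\<^sub>L (g o\<^sub>L h)"
  by (auto intro!: blinfun_eqI)

lemma compose_id [simp]: "g o\<^sub>L id_blinfun = g" "id_blinfun o\<^sub>L g = g"
  by (auto intro!: blinfun_eqI)

lemma norm_isom_compose_right:
  fixes T g :: "'a::real_normed_vector \<Rightarrow>\<^sub>L 'a"
  assumes "isom_op g"
  shows "norm (T o\<^sub>L g) = norm T"
proof (rule antisym)
  have *: "norm (T o\<^sub>L g) \<le> norm T" if "isom_op g" for T g :: "'a \<Rightarrow>\<^sub>L 'a"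
  proof (rule norm_blinfun_bound)
    show "norm (blinfun_apply (T o\<^sub>L g) x) \<le> norm T * norm x" for x
      using norm_blinfun [of T "blinfun_apply g x"] that by (simp add: isom_op_norm)
  qed simp
  show "norm (T o\<^sub>L g) \<le> norm T"
    by (rule * [OF assms])
  have "norm T = norm ((T o\<^sub>L g) o\<^sub>L inv_op g)"
    using assms by (simp add: blinfun_compose_assoc inv_op_compose)
  also have "\<dots> \<le> norm (T o\<^sub>L g)"
    by (rule * [OF isom_op_inv [OF assms]])
  finally show "norm T \<le> norm (T o\<^sub>L g)" .
qed

lemma inner_isom:
  fixes g :: "'a::real_inner \<Rightarrow>\<^sub>L 'a"
  assumes "isom_op g"
  shows "inner (blinfun_apply g x) (blinfun_apply g y) = inner x y"
  using isom_op_norm [OF assms, of "x + y"] by (simp add: dot_norm isom_op_norm [OF assms])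

definition klin :: "'k::rch_scalar op \<Rightarrow> bool" where
  "klin T \<longleftrightarrow> (\<forall>x c. blinfun_apply T (x \<cdot>\<^sub>K c) = blinfun_apply T x \<cdot>\<^sub>K c)"

lemma klinD: "klin T \<Longrightarrow> blinfun_apply T (x \<cdot>\<^sub>K c) = blinfun_apply T x \<cdot>\<^sub>K c"
  by (simp add: klin_def)

text \<open>A \<open>K\<close>-linear map that preserves the norm preserves the real inner product, hence also the
  \<open>K\<close>-valued form, which is determined by it.\<close>

lemma k_unitary_iff: "k_unitary g \<longleftrightarrow> klin g \<and> isom_op g" for g :: "'k::lc_scalar op"
proof
  assume g: "k_unitary g"
  have "norm (blinfun_apply g x) = norm x" for x
  proof -
    have "(norm (blinfun_apply g x))\<^sup>2 = (norm x)\<^sup>2"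
      using g kinner_self [of "blinfun_apply g x"] kinner_self [of x]
      by (simp add: k_unitary_def)
    then show ?thesis by (rule power2_eq_imp_eq) auto
  qed
  with g show "klin g \<and> isom_op g"
    by (simp add: klin_def isom_op_def k_unitary_def)
next
  assume g: "klin g \<and> isom_op g"
  have "kinner (blinfun_apply g x) (blinfun_apply g y) = kinner x y" for x y
  proof (rule inner_ext)
    show "inner (kinner (blinfun_apply g x) (blinfun_apply g y)) c = inner (kinner x y) c" for c
      using g by (simp add: inner_kinner inner_isom flip: klinD)
  qed
  with g show "k_unitary g"
    by (simp add: klin_def isom_op_def k_unitary_def)
qed

lemma
  fixes g :: "'k::lc_scalar op"
  assumes "k_unitary g"
  shows k_unitary_isom [simp]: "isom_op g" and k_unitary_klin: "klin g"
    and k_unitary_kinner: "kinner (blinfun_apply g x) (blinfun_apply g y) = kinner x y"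
    and k_unitary_norm: "norm (blinfun_apply g x) = norm x"
proof -
  show "kinner (blinfun_apply g x) (blinfun_apply g y) = kinner x y"
    using assms by (simp add: k_unitary_def)
qed (use assms in \<open>auto simp: k_unitary_iff klinD isom_op_norm\<close>)

lemma klin_compose: "klin S \<Longrightarrow> klin T \<Longrightarrow> klin (S o\<^sub>L T)"
  and klin_id: "klin id_blinfun"
  and klin_add: "klin S \<Longrightarrow> klin T \<Longrightarrow> klin (S + T)"
  and klin_diff: "klin S \<Longrightarrow> klin T \<Longrightarrow> klin (S - T)"
  and klin_minus: "klin S \<Longrightarrow> klin (- S)"
  and klin_scaleR: "klin S \<Longrightarrow> klin (r *\<^sub>R S)"
  by (simp_all add: klin_def)

lemma k_unitary_id: "k_unitary (id_blinfun :: 'k::lc_scalar op)"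
  by (simp add: k_unitary_iff klin_id)

lemma k_unitary_compose: "k_unitary g \<Longrightarrow> k_unitary h \<Longrightarrow> k_unitary (g o\<^sub>L h)" for g h :: "'k::lc_scalar op"
  by (simp add: k_unitary_iff klin_compose isom_op_compose)

lemma k_unitary_inv: "k_unitary g \<Longrightarrow> k_unitary (inv_op g)" for g :: "'k::lc_scalar op"
  by (simp add: k_unitary_iff isom_op_inv klin_def) (metis inv_op_left inv_op_right)

section \<open>Supports\<close>

lemma k_unitary_coord_fixed:
  fixes g :: "'k::lc_scalar op"
  assumes "k_unitary g" "blinfun_apply g (basis_vec j) = basis_vec j"
  shows "coord (blinfun_apply g x) j = coord x j"
  using k_unitary_kinner [OF assms(1), of "basis_vec j" x] by (simp add: assms(2))

text \<open>A unitary \<open>g\<close> leaves the coordinates in \<open>I\<close> unchanged, so \<open>inner (g x) x = \<parallel>x\<parallel>\<^sup>2\<close>; as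
  \<open>\<parallel>g x\<parallel> = \<parallel>x\<parallel>\<close>, equality holds in the Cauchy-Schwarz inequality.\<close>

lemma k_unitary_fixes:
  fixes g :: "'k::lc_scalar op"
  assumes g: "k_unitary g" and fixd: "\<And>j. j \<in> I \<Longrightarrow> blinfun_apply g (basis_vec j) = basis_vec j"
    and x: "\<And>j. j \<notin> I \<Longrightarrow> coord x j = 0"
  shows "blinfun_apply g x = x"
proof -
  have "inner (blinfun_apply g x) x = inner x x"
    unfolding inner_ell2_def
    by (rule arg_cong [where f = suminf])
      (metis (mono_tags, opaque_lifting) x fixd k_unitary_coord_fixed [OF g] inner_zero_right)
  moreover have "(norm (blinfun_apply g x))\<^sup>2 = (norm x)\<^sup>2"
    by (simp add: k_unitary_norm [OF g])
  ultimately have "(norm (blinfun_apply g x - x))\<^sup>2 = 0"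
    by (simp only: power2_norm_eq_inner inner_diff inner_commute)
  then show ?thesis by simp
qed

lemma span_first_iff: "x \<in> span_first n \<longleftrightarrow> (\<forall>j\<ge>n. coord x j = 0)"
proof
  assume "\<forall>j\<ge>n. coord x j = 0"
  then have "x = (\<Sum>j<n. basis_vec j \<cdot>\<^sub>K coord x j)"
    by (intro ell2_eqI) (auto simp: if_distrib [of "\<lambda>u. u * _"] cong: if_cong)
  then show "x \<in> span_first n"
    unfolding span_first_def by blast
qed (auto simp: span_first_def)

lemma U_fin_iff: "g \<in> U_fin n \<longleftrightarrow> k_unitary g \<and> (\<forall>j\<ge>n. blinfun_apply g (basis_vec j) = basis_vec j)"
  for g :: "'k::lc_scalar op"
proof
  assume "g \<in> U_fin n"
  then have g: "k_unitary g"
    and fx: "\<And>x. (\<forall>y\<in>span_first n. kinner y x = 0) \<Longrightarrow> blinfun_apply g x = x"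
    by (auto simp: U_fin_def)
  have "blinfun_apply g (basis_vec j) = basis_vec j" if "n \<le> j" for j
    by (rule fx) (use that in \<open>simp add: span_first_iff\<close>)
  with g show "k_unitary g \<and> (\<forall>j\<ge>n. blinfun_apply g (basis_vec j) = basis_vec j)"
    by blast
next
  assume *: "k_unitary g \<and> (\<forall>j\<ge>n. blinfun_apply g (basis_vec j) = basis_vec j)"
  then have g: "k_unitary g" by simp
  have cf: "coord (blinfun_apply g x) j = coord x j" if "n \<le> j" for x j
    by (rule k_unitary_coord_fixed) (use * that in auto)
  have sf: "blinfun_apply g x \<in> span_first n \<longleftrightarrow> x \<in> span_first n" for x
    by (simp add: span_first_iff cf)
  have "blinfun_apply g ` span_first n = span_first n"
    using sf g by (metis (no_types, opaque_lifting) image_iff inv_op_right k_unitary_isom subsetI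
        subset_antisym)
  moreover have "blinfun_apply g x = x" if "\<forall>y\<in>span_first n. kinner y x = 0" for x
  proof (rule k_unitary_fixes [where I = "{n..}"])
    show "coord x j = 0" if j: "j \<notin> {n..}" for j
    proof -
      have "basis_vec j \<in> span_first n" using j by (simp add: span_first_iff)
      then show ?thesis
        using \<open>\<forall>y\<in>span_first n. kinner y x = 0\<close> by (metis kinner_basis_left)
    qed
  qed (use * in auto)
  ultimately show "g \<in> U_fin n"
    using g by (simp add: U_fin_def)
qed

section \<open>Identity components\<close>

text \<open>Left multiplication by \<open>g\<close> maps the component of the identity onto a connected set that
  contains \<open>g\<close>.\<close>

lemma connected_component_compose:
  fixes G :: "('a::real_normed_vector \<Rightarrow>\<^sub>L 'a) set"
  assumes G: "\<And>a b. a \<in> G \<Longrightarrow> b \<in> G \<Longrightarrow> a o\<^sub>L b \<in> G"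
    and g: "g \<in> connected_component_set G id_blinfun" and h: "h \<in> connected_component_set G id_blinfun"
  shows "g o\<^sub>L h \<in> connected_component_set G id_blinfun"
proof -
  let ?C = "connected_component_set G id_blinfun"
  have "g \<in> G" using g connected_component_subset by blast
  then have "(\<lambda>x. g o\<^sub>L x) ` ?C \<subseteq> G"
    using G connected_component_subset by blast
  moreover have "connected ((\<lambda>x. g o\<^sub>L x) ` ?C)"
    by (intro connected_continuous_image continuous_intros) auto
  moreover have "id_blinfun \<in> ?C"
    by (metis g connected_component_eq_empty connected_component_refl_eq empty_iff mem_Collect_eq)
  then have "g \<in> (\<lambda>x. g o\<^sub>L x) ` ?C"
    by (intro image_eqI [of _ _ id_blinfun]) auto
  ultimately have "(\<lambda>x. g o\<^sub>L x) ` ?C \<subseteq> connected_component_set G g"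
    by (intro connected_component_maximal)
  then show ?thesis
    using h connected_component_eq [OF g] by blast
qed

lemma connected_component_inv:
  fixes G :: "('a::real_normed_vector \<Rightarrow>\<^sub>L 'a) set"
  assumes G: "\<And>a b. a \<in> G \<Longrightarrow> b \<in> G \<Longrightarrow> a o\<^sub>L b \<in> G"
    and g: "g \<in> connected_component_set G id_blinfun" and h: "h \<in> G" "h o\<^sub>L g = id_blinfun"
  shows "h \<in> connected_component_set G id_blinfun"
proof -
  let ?C = "connected_component_set G id_blinfun"
  have "(\<lambda>x. h o\<^sub>L x) ` ?C \<subseteq> G"
    using G h connected_component_subset by blast
  moreover have "connected ((\<lambda>x. h o\<^sub>L x) ` ?C)"
    by (intro connected_continuous_image continuous_intros) auto
  moreover have "id_blinfun \<in> (\<lambda>x. h o\<^sub>L x) ` ?C"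
    using h g by (intro image_eqI [of _ _ g]) auto
  ultimately have "(\<lambda>x. h o\<^sub>L x) ` ?C \<subseteq> ?C"
    by (intro connected_component_maximal)
  moreover have "id_blinfun \<in> ?C"
    by (metis g connected_component_eq_empty connected_component_refl_eq empty_iff mem_Collect_eq)
  then have "h \<in> (\<lambda>x. h o\<^sub>L x) ` ?C"
    by (intro image_eqI [of _ _ id_blinfun]) auto
  ultimately show ?thesis by blast
qed

lemma U_fin_compose: "g \<in> U_fin n \<Longrightarrow> h \<in> U_fin n \<Longrightarrow> g o\<^sub>L h \<in> U_fin n" for g h :: "'k::lc_scalar op"
  by (simp add: U_fin_iff k_unitary_compose)

lemma U_fin_inv: "g \<in> U_fin n \<Longrightarrow> inv_op g \<in> U_fin n" for g :: "'k::lc_scalar op"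
  by (simp add: U_fin_iff k_unitary_inv) (metis inv_op_left k_unitary_isom)

lemma U_fin_0_subset: "U_fin_0 n \<subseteq> (U_fin n :: 'k::lc_scalar op set)"
  unfolding U_fin_0_def by (rule connected_component_subset)

lemma connected_U_fin_0: "connected (U_fin_0 n)"
  unfolding U_fin_0_def by (rule connected_connected_component)

lemma U_fin_0_id: "id_blinfun \<in> (U_fin_0 n :: 'k::lc_scalar op set)"
  by (simp add: U_fin_0_def connected_component_refl_eq U_fin_iff k_unitary_id)

lemma U_fin_0_compose: "g \<in> U_fin_0 n \<Longrightarrow> h \<in> U_fin_0 n \<Longrightarrow> g o\<^sub>L h \<in> U_fin_0 n"
  for g h :: "'k::lc_scalar op"
  unfolding U_fin_0_def by (rule connected_component_compose [OF U_fin_compose])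

lemma U_fin_0_inv:
  fixes g :: "'k::lc_scalar op"
  assumes "g \<in> U_fin_0 n"
  shows "inv_op g \<in> U_fin_0 n"
proof -
  have g: "g \<in> U_fin n" using assms U_fin_0_subset by blast
  then have "isom_op g" by (simp add: U_fin_iff)
  show ?thesis
    unfolding U_fin_0_def
  proof (rule connected_component_inv [OF U_fin_compose])
    show "g \<in> connected_component_set (U_fin n) id_blinfun"
      using assms by (simp only: U_fin_0_def)
    show "inv_op g \<in> U_fin n"
      by (rule U_fin_inv [OF g])
    show "inv_op g o\<^sub>L g = id_blinfun"
      by (rule inv_op_compose) fact
  qed
qed

lemma U_fin_0_mono: "m \<le> n \<Longrightarrow> U_fin_0 m \<subseteq> (U_fin_0 n :: 'k::lc_scalar op set)"
  unfolding U_fin_0_def by (rule connected_component_mono) (auto simp: U_fin_iff)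

lemma U_fin_0_connectI:
  fixes S :: "'k::lc_scalar op set"
  assumes "connected S" "id_blinfun \<in> S" "S \<subseteq> U_fin n"
  shows "S \<subseteq> U_fin_0 n"
  unfolding U_fin_0_def using assms by (intro connected_component_maximal)

lemma U_lim_0_iff: "g \<in> U_lim_0 \<longleftrightarrow> (\<exists>n. g \<in> U_fin_0 n)"
  by (auto simp: U_lim_0_def)

lemma U_lim_0_unitary: "g \<in> U_lim_0 \<Longrightarrow> k_unitary g" for g :: "'k::lc_scalar op"
  using U_fin_0_subset U_fin_iff U_lim_0_iff by blast

lemma U_lim_0_id: "id_blinfun \<in> (U_lim_0 :: 'k::lc_scalar op set)"
  using U_fin_0_id by (auto simp: U_lim_0_iff)

lemma U_lim_0_compose:
  fixes g h :: "'k::lc_scalar op"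
  assumes "g \<in> U_lim_0" "h \<in> U_lim_0"
  shows "g o\<^sub>L h \<in> U_lim_0"
proof -
  obtain m n where "g \<in> U_fin_0 m" "h \<in> U_fin_0 n"
    using assms by (auto simp: U_lim_0_iff)
  then have "g \<in> U_fin_0 (max m n)" "h \<in> U_fin_0 (max m n)"
    using U_fin_0_mono [of m "max m n"] U_fin_0_mono [of n "max m n"] by auto
  then show ?thesis
    using U_fin_0_compose U_lim_0_iff by blast
qed

lemma U_lim_0_inv: "g \<in> U_lim_0 \<Longrightarrow> inv_op g \<in> U_lim_0" for g :: "'k::lc_scalar op"
  using U_fin_0_inv by (auto simp: U_lim_0_iff)

lemma K_sub_iff: "g \<in> K_sub n \<longleftrightarrow> g \<in> U_lim_0 \<and> (\<forall>j<n. blinfun_apply g (basis_vec j) = basis_vec j)"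
  by (simp add: K_sub_def)

lemma K_sub_compose: "g \<in> K_sub n \<Longrightarrow> h \<in> K_sub n \<Longrightarrow> g o\<^sub>L h \<in> K_sub n" for g h :: "'k::lc_scalar op"
  by (simp add: K_sub_iff U_lim_0_compose)

lemma K_sub_id: "id_blinfun \<in> (K_sub n :: 'k::lc_scalar op set)"
  by (simp add: K_sub_iff U_lim_0_id)

lemma K_sub_inv: "g \<in> K_sub n \<Longrightarrow> inv_op g \<in> K_sub n" for g :: "'k::lc_scalar op"
  by (simp add: K_sub_iff U_lim_0_inv) (metis inv_op_left k_unitary_isom U_lim_0_unitary)

lemma U_fin_0D:
  fixes g :: "'k::lc_scalar op"
  assumes "g \<in> U_fin_0 n"
  shows "k_unitary g" "j \<ge> n \<Longrightarrow> blinfun_apply g (basis_vec j) = basis_vec j"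
proof -
  have "g \<in> U_fin n" using assms U_fin_0_subset by blast
  then show "k_unitary g" "j \<ge> n \<Longrightarrow> blinfun_apply g (basis_vec j) = basis_vec j"
    by (simp_all add: U_fin_iff)
qed

lemma K_subD:
  fixes g :: "'k::lc_scalar op"
  assumes "g \<in> K_sub n"
  shows "k_unitary g" "j < n \<Longrightarrow> blinfun_apply g (basis_vec j) = basis_vec j"
proof -
  show "k_unitary g" using assms U_lim_0_unitary by (auto simp: K_sub_iff)
  show "j < n \<Longrightarrow> blinfun_apply g (basis_vec j) = basis_vec j"
    using assms by (simp add: K_sub_iff)
qed

section \<open>Coordinate projections and shifts\<close>

lift_definition mask :: "nat set \<Rightarrow> 'k::rch_scalar ell2 \<Rightarrow> 'k ell2"
  is "\<lambda>I x n. if n \<in> I then x n else 0"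
  by (rule summable_comparison_test', assumption) auto

lift_definition shift_left :: "nat \<Rightarrow> 'k::rch_scalar ell2 \<Rightarrow> 'k ell2" is "\<lambda>m x n. x (n + m)"
  by (rule summable_ignore_initial_segment)

lift_definition shift_right :: "nat \<Rightarrow> 'k::rch_scalar ell2 \<Rightarrow> 'k ell2"
  is "\<lambda>m x n. if n < m then 0 else x (n - m)"
proof -
  fix m and x :: "nat \<Rightarrow> 'k"
  assume "summable (\<lambda>n. (norm (x n))\<^sup>2)"
  then show "summable (\<lambda>n. (norm (if n < m then 0 else x (n - m)))\<^sup>2)"
    by (subst summable_iff_shift [of _ m, symmetric]) simp
qed

lemma inner_disjoint: "(\<And>j. coord x j = 0 \<or> coord y j = 0) \<Longrightarrow> inner x y = 0"
proof -
  assume *: "\<And>j. coord x j = 0 \<or> coord y j = 0"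
  have "inner (coord x j) (coord y j) = 0" for j
    using * [of j] by auto
  then show "inner x y = 0" by (simp add: inner_ell2_def)
qed

lemma norm_add_disjoint:
  "(\<And>j. coord x j = 0 \<or> coord y j = 0) \<Longrightarrow> (norm (x + y))\<^sup>2 = (norm x)\<^sup>2 + (norm y)\<^sup>2"
  using inner_disjoint [of x y] by (simp add: power2_norm_eq_inner inner_add inner_commute)

lemma norm_mask_split: "(norm x)\<^sup>2 = (norm (mask I x))\<^sup>2 + (norm (mask (- I) x))\<^sup>2"
proof -
  have "mask I x + mask (- I) x = x"
    by (rule ell2_eqI) (simp add: mask.rep_eq)
  moreover have "(norm (mask I x + mask (- I) x))\<^sup>2 = (norm (mask I x))\<^sup>2 + (norm (mask (- I) x))\<^sup>2"
    by (rule norm_add_disjoint) (simp add: mask.rep_eq)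
  ultimately show ?thesis by simp
qed

lemma norm_mask_le: "norm (mask I x) \<le> norm x"
  by (rule power2_le_imp_le) (simp_all add: norm_mask_split [of x I])

lemma inner_shift: "inner (shift_right m x) y = inner x (shift_left m y)"
proof -
  have "summable (\<lambda>n. inner (coord (shift_right m x) n) (coord y n))"
    by (intro summable_inner summable_coord)
  from suminf_split_initial_segment [OF this, of m]
  show ?thesis
    by (simp add: inner_ell2_def shift_right.rep_eq shift_left.rep_eq)
qed

lemma shift_left_right [simp]: "shift_left m (shift_right m x) = x"
  by (rule ell2_eqI) (simp add: shift_right.rep_eq shift_left.rep_eq)

lemma norm_shift_right [simp]: "norm (shift_right m x) = norm x"
  by (simp add: norm_eq_sqrt_inner inner_shift)

lemma shift_right_left: "shift_right m (shift_left m x) = mask {m..} x"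
  by (rule ell2_eqI) (simp add: shift_right.rep_eq shift_left.rep_eq mask.rep_eq)

lemma norm_shift_left: "norm (shift_left m x) = norm (mask {m..} x)"
  by (metis norm_shift_right shift_right_left)

definition Mask :: "nat set \<Rightarrow> 'k::rch_scalar op" where "Mask I = Blinfun (mask I)"
definition Shl :: "nat \<Rightarrow> 'k::rch_scalar op" where "Shl m = Blinfun (shift_left m)"
definition Shr :: "nat \<Rightarrow> 'k::rch_scalar op" where "Shr m = Blinfun (shift_right m)"

lemma Mask_apply [simp]: "blinfun_apply (Mask I) = mask I"
  unfolding Mask_def
proof (rule bounded_linear_Blinfun_apply, rule bounded_linear_intro)
  show "norm (mask I x) \<le> norm x * 1" for x :: "'a ell2"
    by (simp add: norm_mask_le)
qed (rule ell2_eqI; simp add: mask.rep_eq)+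

lemma Shl_apply [simp]: "blinfun_apply (Shl m) = shift_left m"
  unfolding Shl_def
proof (rule bounded_linear_Blinfun_apply, rule bounded_linear_intro)
  show "norm (shift_left m x) \<le> norm x * 1" for x :: "'a ell2"
    by (simp add: norm_shift_left norm_mask_le)
qed (rule ell2_eqI; simp add: shift_left.rep_eq)+

lemma Shr_apply [simp]: "blinfun_apply (Shr m) = shift_right m"
  unfolding Shr_def
proof (rule bounded_linear_Blinfun_apply, rule bounded_linear_intro)
  show "norm (shift_right m x) \<le> norm x * 1" for x :: "'a ell2"
    by simp
qed (rule ell2_eqI; simp add: shift_right.rep_eq)+

lemma coord_mask [simp]: "coord (mask I x) n = (if n \<in> I then coord x n else 0)"
  and coord_shift_left [simp]: "coord (shift_left m x) n = coord x (n + m)"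
  and coord_shift_right [simp]: "coord (shift_right m x) n = (if n < m then 0 else coord x (n - m))"
  by (simp_all add: mask.rep_eq shift_left.rep_eq shift_right.rep_eq)

lemma klin_Mask: "klin (Mask I)" and klin_Shl: "klin (Shl m)" and klin_Shr: "klin (Shr m)"
  by (auto simp: klin_def intro!: ell2_eqI)

section \<open>Disjoint supports\<close>

text \<open>If \<open>p\<close> acts on the coordinates below \<open>M\<close> and \<open>b\<close> on the others, then \<open>p b - 1\<close> is the orthogonal
  direct sum of \<open>p - 1\<close> and \<open>b - 1\<close>. This is the reason why unboundedly many small elements have a
  small product.\<close>

lemma
  fixes p b :: "'k::lc_scalar op"
  assumes p: "k_unitary p" "\<And>j. j \<ge> M \<Longrightarrow> blinfun_apply p (basis_vec j) = basis_vec j"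
    and b: "k_unitary b" "\<And>j. j < M \<Longrightarrow> blinfun_apply b (basis_vec j) = basis_vec j"
  shows disjoint_commute: "p o\<^sub>L b = b o\<^sub>L p"
    and norm_disjoint_le: "norm (p - id_blinfun) \<le> \<delta> \<Longrightarrow> norm (b - id_blinfun) \<le> \<delta> \<Longrightarrow>
      norm ((p o\<^sub>L b) - id_blinfun) \<le> \<delta>"
proof -
  have pc: "coord (blinfun_apply p x) j = coord x j" if "j \<ge> M" for x j
    by (rule k_unitary_coord_fixed) (use p that in auto)
  have bc: "coord (blinfun_apply b x) j = coord x j" if "j < M" for x j
    by (rule k_unitary_coord_fixed) (use b that in auto)
  have pf: "blinfun_apply p z = z" if "\<And>j. j < M \<Longrightarrow> coord z j = 0" for z
    by (rule k_unitary_fixes [where I = "{M..}"]) (use p that in auto)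
  have bf: "blinfun_apply b y = y" if "\<And>j. j \<ge> M \<Longrightarrow> coord y j = 0" for y
    by (rule k_unitary_fixes [where I = "{..<M}"]) (use b that in auto)
  have split: "mask {..<M} x + mask {M..} x = x" for x :: "'k ell2"
    by (rule ell2_eqI) auto
  have pb: "blinfun_apply p (blinfun_apply b x) =
      blinfun_apply p (mask {..<M} x) + blinfun_apply b (mask {M..} x)" for x
  proof -
    have "blinfun_apply b (mask {..<M} x + mask {M..} x) = mask {..<M} x + blinfun_apply b (mask {M..} x)"
      by (simp add: bf)
    moreover have "blinfun_apply p (blinfun_apply b (mask {M..} x)) = blinfun_apply b (mask {M..} x)"
      by (rule pf) (simp add: bc)
    ultimately show ?thesis unfolding split by simp
  qed
  have bp: "blinfun_apply b (blinfun_apply p x) =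
      blinfun_apply p (mask {..<M} x) + blinfun_apply b (mask {M..} x)" for x
  proof -
    have "blinfun_apply p (mask {..<M} x + mask {M..} x) = blinfun_apply p (mask {..<M} x) + mask {M..} x"
      by (simp add: pf)
    moreover have "blinfun_apply b (blinfun_apply p (mask {..<M} x)) = blinfun_apply p (mask {..<M} x)"
      by (rule bf) (simp add: pc)
    ultimately show ?thesis unfolding split by simp
  qed
  show "p o\<^sub>L b = b o\<^sub>L p"
    by (rule blinfun_eqI) (simp add: pb bp)
  assume le: "norm (p - id_blinfun) \<le> \<delta>" "norm (b - id_blinfun) \<le> \<delta>"
  then have \<delta>: "0 \<le> \<delta>" using norm_ge_zero order_trans by blast
  show "norm ((p o\<^sub>L b) - id_blinfun) \<le> \<delta>"
  proof (rule norm_blinfun_bound [OF \<delta>])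
    fix x :: "'k ell2"
    let ?y = "mask {..<M} x" and ?z = "mask {M..} x"
    have y: "norm (blinfun_apply p ?y - ?y) \<le> \<delta> * norm ?y"
      using norm_blinfun [of "p - id_blinfun" ?y] mult_right_mono [OF le(1), of "norm ?y"] by simp
    have z: "norm (blinfun_apply b ?z - ?z) \<le> \<delta> * norm ?z"
      using norm_blinfun [of "b - id_blinfun" ?z] mult_right_mono [OF le(2), of "norm ?z"] by simp
    have "blinfun_apply ((p o\<^sub>L b) - id_blinfun) x = blinfun_apply p ?y + blinfun_apply b ?z - (?y + ?z)"
      by (simp only: split blinfun_apply_blinfun_compose pb blinfun.diff_left id_blinfun.rep_eq id_apply)
    then have "blinfun_apply ((p o\<^sub>L b) - id_blinfun) x = (blinfun_apply p ?y - ?y) + (blinfun_apply b ?z - ?z)"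
      by (simp only: add_diff_add)
    then have "(norm (blinfun_apply ((p o\<^sub>L b) - id_blinfun) x))\<^sup>2 =
        (norm ((blinfun_apply p ?y - ?y) + (blinfun_apply b ?z - ?z)))\<^sup>2"
      by simp
    also have "\<dots> = (norm (blinfun_apply p ?y - ?y))\<^sup>2 + (norm (blinfun_apply b ?z - ?z))\<^sup>2"
      by (rule norm_add_disjoint) (use linorder_not_le in \<open>auto simp: pc bc\<close>)
    also have "\<dots> \<le> (\<delta> * norm ?y)\<^sup>2 + (\<delta> * norm ?z)\<^sup>2"
      using y z by (intro add_mono power_mono) auto
    also have "\<dots> = (\<delta> * norm x)\<^sup>2"
    proof -
      have "- {..<M} = {M..}" by auto
      then show ?thesis
        using norm_mask_split [of x "{..<M}"] by (simp add: power_mult_distrib flip: distrib_left)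
    qed
    finally show "norm (blinfun_apply ((p o\<^sub>L b) - id_blinfun) x) \<le> \<delta> * norm x"
      by (rule power2_le_imp_le) (use \<delta> in simp)
  qed
qed

section \<open>Translates of operators\<close>

text \<open>The copy of \<open>g\<close> that acts on the coordinates from \<open>a\<close> onwards.\<close>

definition translate :: "nat \<Rightarrow> 'k::rch_scalar op \<Rightarrow> 'k op" where
  "translate a g = Mask {..<a} + (Shr a o\<^sub>L g o\<^sub>L Shl a)"

lemma translate_apply:
  "blinfun_apply (translate a g) x = mask {..<a} x + shift_right a (blinfun_apply g (shift_left a x))"
  by (simp add: translate_def)

lemma coord_translate [simp]: "coord (blinfun_apply (translate a g) x) n =
    (if n < a then coord x n else coord (blinfun_apply g (shift_left a x)) (n - a))"
  by (simp add: translate_apply)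

lemma shift_left_translate [simp]:
  "shift_left a (blinfun_apply (translate a g) x) = blinfun_apply g (shift_left a x)"
  by (rule ell2_eqI) simp

lemma translate_id [simp]: "translate a id_blinfun = id_blinfun"
  by (intro blinfun_eqI ell2_eqI) simp

lemma translate_compose: "translate a (g o\<^sub>L h) = translate a g o\<^sub>L translate a h"
  by (intro blinfun_eqI ell2_eqI) simp

lemma translate_translate: "translate a (translate b g) = translate (a + b) g"
proof (intro blinfun_eqI ell2_eqI)
  fix x :: "'a ell2" and n
  have "shift_left b (shift_left a x) = shift_left (a + b) x"
    by (rule ell2_eqI) (simp add: ac_simps)
  then show "coord (blinfun_apply (translate a (translate b g)) x) n =
      coord (blinfun_apply (translate (a + b) g) x) n"
    by (auto simp: add.commute)
qed

lemma norm_translate_le: "norm (translate a g - id_blinfun) \<le> norm (g - id_blinfun)"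
proof (rule norm_blinfun_bound)
  fix x
  have "blinfun_apply (translate a g - id_blinfun) x = shift_right a (blinfun_apply (g - id_blinfun) (shift_left a x))"
    by (rule ell2_eqI) simp
  then have "norm (blinfun_apply (translate a g - id_blinfun) x) \<le> norm (g - id_blinfun) * norm (shift_left a x)"
    by (metis norm_blinfun norm_shift_right)
  also have "\<dots> \<le> norm (g - id_blinfun) * norm x"
    by (intro mult_left_mono) (simp_all add: norm_shift_left norm_mask_le)
  finally show "norm (blinfun_apply (translate a g - id_blinfun) x) \<le> norm (g - id_blinfun) * norm x" .
qed simp

lemma k_unitary_translate:
  fixes g :: "'k::lc_scalar op"
  assumes "k_unitary g"
  shows "k_unitary (translate a g)"
proof -
  note i = k_unitary_isom [OF assms]
  have k: "klin (translate a g)"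
    unfolding translate_def
    by (intro klin_add klin_compose klin_Mask klin_Shl klin_Shr k_unitary_klin assms)
  have "norm (blinfun_apply (translate a g) x) = norm x" for x
  proof -
    have e: "- {..<a} = {a..}" by auto
    have "(norm (blinfun_apply (translate a g) x))\<^sup>2 =
        (norm (mask {..<a} x))\<^sup>2 + (norm (shift_right a (blinfun_apply g (shift_left a x))))\<^sup>2"
      unfolding translate_apply by (rule norm_add_disjoint) auto
    also have "\<dots> = (norm x)\<^sup>2"
      using norm_mask_split [of x "{..<a}"] by (simp add: k_unitary_norm [OF assms] norm_shift_left e)
    finally show ?thesis by (rule power2_eq_imp_eq) auto
  qed
  moreover have "blinfun_apply (translate a g) (blinfun_apply (translate a (inv_op g)) y) = y" for y
  proof -
    have "translate a g o\<^sub>L translate a (inv_op g) = id_blinfun"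
      by (simp add: inv_op_compose [OF i] flip: translate_compose)
    then show ?thesis
      by (metis blinfun_apply_blinfun_compose id_blinfun.rep_eq id_apply)
  qed
  ultimately show ?thesis
    using k unfolding k_unitary_iff isom_op_def by (metis surjI)
qed

lemma translate_fixes:
  fixes g :: "'k::lc_scalar op"
  assumes "j < a \<or> blinfun_apply g (basis_vec (j - a)) = basis_vec (j - a)"
  shows "blinfun_apply (translate a g) (basis_vec j) = basis_vec j"
proof (cases "j < a")
  case True
  then have "shift_left a (basis_vec j :: 'k ell2) = 0"
    by (intro ell2_eqI) auto
  with True show ?thesis by (intro ell2_eqI) auto
next
  case False
  then have "shift_left a (basis_vec j :: 'k ell2) = basis_vec (j - a)"
    by (intro ell2_eqI) auto
  with False show ?thesis using assms by (intro ell2_eqI) auto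
qed

lemma translate_U_fin_0:
  fixes g :: "'k::lc_scalar op"
  assumes "g \<in> U_fin_0 m"
  shows "translate a g \<in> U_fin_0 (a + m)"
proof -
  have "translate a ` U_fin_0 m \<subseteq> (U_fin_0 (a + m) :: 'k op set)"
  proof (rule U_fin_0_connectI)
    show "connected (translate a ` U_fin_0 m :: 'k op set)"
      unfolding translate_def
      by (intro connected_continuous_image continuous_intros connected_U_fin_0)
    show "id_blinfun \<in> (translate a ` U_fin_0 m :: 'k op set)"
      using U_fin_0_id translate_id by (metis image_eqI)
    show "translate a ` U_fin_0 m \<subseteq> (U_fin (a + m) :: 'k op set)"
    proof (clarify)
      fix h :: "'k op" assume "h \<in> U_fin_0 m"
      then have "h \<in> U_fin m" using U_fin_0_subset by blast
      then show "translate a h \<in> U_fin (a + m)"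
        by (auto simp: U_fin_iff k_unitary_translate intro!: translate_fixes)
    qed
  qed
  with assms show ?thesis by blast
qed

lemma translate_K_sub: "g \<in> U_lim_0 \<Longrightarrow> translate a g \<in> K_sub a" for g :: "'k::lc_scalar op"
  using translate_U_fin_0 by (auto simp: K_sub_iff U_lim_0_iff intro!: translate_fixes)

section \<open>Rotations\<close>

text \<open>A skew operator with \<open>J\<^sup>3 = - J\<close> is a complex structure on its range and zero on the orthogonal
  complement, so \<open>rot J t\<close> is the exponential of \<open>t J\<close>. The rotations of a plane and the simultaneous
  rotations that exchange two blocks of coordinates are both of this form.\<close>

definition rot_gen :: "'k::rch_scalar op \<Rightarrow> bool" where
  "rot_gen J \<longleftrightarrow> klin J \<and>
     (\<forall>x y. inner (blinfun_apply J x) y = - inner x (blinfun_apply J y)) \<and>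
     (\<forall>x. blinfun_apply J (blinfun_apply J (blinfun_apply J x)) = - blinfun_apply J x)"

definition rot :: "'k::rch_scalar op \<Rightarrow> real \<Rightarrow> 'k op" where
  "rot J t = id_blinfun + sin t *\<^sub>R J + (1 - cos t) *\<^sub>R (J o\<^sub>L J)"

lemma rot_apply: "blinfun_apply (rot J t) x =
    x + sin t *\<^sub>R blinfun_apply J x + (1 - cos t) *\<^sub>R blinfun_apply J (blinfun_apply J x)"
  by (simp add: rot_def)

lemma rot_0 [simp]: "rot J 0 = id_blinfun"
  by (simp add: rot_def)

lemma rot_fixes: "blinfun_apply J x = 0 \<Longrightarrow> blinfun_apply (rot J t) x = x"
  by (simp add: rot_apply)

context
  fixes J :: "'k::lc_scalar op"
  assumes J: "rot_gen J"
begin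

lemma rot_gen_cube: "blinfun_apply J (blinfun_apply J (blinfun_apply J x)) = - blinfun_apply J x"
  using J by (simp add: rot_gen_def)

lemma rot_gen_skew: "inner (blinfun_apply J x) y = - inner x (blinfun_apply J y)"
  using J unfolding rot_gen_def by blast

lemma rot_add: "rot J s o\<^sub>L rot J t = rot J (s + t)"
proof (rule blinfun_eqI)
  fix x
  let ?a = "blinfun_apply J x" and ?b = "blinfun_apply J (blinfun_apply J x)"
  have "blinfun_apply (rot J s o\<^sub>L rot J t) x =
      x + (sin s + sin t - sin s * (1 - cos t) - (1 - cos s) * sin t) *\<^sub>R ?a
        + ((1 - cos s) + (1 - cos t) + sin s * sin t - (1 - cos s) * (1 - cos t)) *\<^sub>R ?b"
    by (simp add: rot_apply rot_gen_cube algebra_simps)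
  also have "\<dots> = blinfun_apply (rot J (s + t)) x"
    by (simp add: rot_apply sin_add cos_add algebra_simps)
  finally show "blinfun_apply (rot J s o\<^sub>L rot J t) x = blinfun_apply (rot J (s + t)) x" .
qed

lemma rot_cancel [simp]:
  "blinfun_apply (rot J t) (blinfun_apply (rot J (- t)) x) = x"
  "blinfun_apply (rot J (- t)) (blinfun_apply (rot J t) x) = x"
  using rot_add [of t "- t"] rot_add [of "- t" t]
  by (metis add.right_inverse add.left_inverse blinfun_apply_blinfun_compose id_blinfun.rep_eq id_apply rot_0)+

lemma inner_rot: "inner (blinfun_apply (rot J t) x) y = inner x (blinfun_apply (rot J (- t)) y)"
  by (simp add: rot_apply inner_add inner_diff rot_gen_skew)

lemma k_unitary_rot: "k_unitary (rot J t)"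
proof -
  have "klin J" using J by (simp add: rot_gen_def)
  then have "klin (rot J t)"
    unfolding rot_def by (intro klin_add klin_scaleR klin_compose klin_id)
  moreover have "surj (blinfun_apply (rot J t))"
    using rot_cancel(1) by (rule surjI [where f = "blinfun_apply (rot J (- t))"])
  moreover have "norm (blinfun_apply (rot J t) x) = norm x" for x
    by (simp add: norm_eq_sqrt_inner inner_rot)
  ultimately show ?thesis
    by (simp add: k_unitary_iff isom_op_def)
qed

lemma norm_rot_gen_le: "norm (blinfun_apply J x) \<le> norm x"
proof -
  let ?a = "blinfun_apply J x" and ?b = "blinfun_apply J (blinfun_apply J x)"
  have "(norm ?b)\<^sup>2 = (norm ?a)\<^sup>2"
    by (simp add: power2_norm_eq_inner rot_gen_skew rot_gen_cube)
  then have b: "norm ?b = norm ?a" by (rule power2_eq_imp_eq) auto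
  have "norm ?a * norm ?a = - inner x ?b"
    using rot_gen_skew [of x ?a] by (simp only: power2_norm_eq_inner flip: power2_eq_square)
  also have "\<dots> \<le> norm x * norm ?a"
    using Cauchy_Schwarz_ineq2 [of x ?b] by (simp add: b)
  finally show ?thesis
    by (cases "norm ?a = 0") (auto simp: mult_le_cancel_right)
qed

text \<open>The bound does not depend on the rank of \<open>J\<close>; this makes the number of steps in the bounded
  generation lemma uniform.\<close>

lemma norm_rot_le: "norm (rot J t - id_blinfun) \<le> 2 * \<bar>t\<bar>"
proof (rule norm_blinfun_bound)
  fix x
  have s: "\<bar>sin t\<bar> \<le> \<bar>t\<bar>" by (rule abs_sin_x_le_abs_x)
  have c: "\<bar>1 - cos t\<bar> \<le> \<bar>t\<bar>"
  proof -
    have "1 - cos t = 2 * (sin (t / 2))\<^sup>2"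
      using cos_double_sin [of "t / 2"] by simp
    also have "(sin (t / 2))\<^sup>2 = \<bar>sin (t / 2)\<bar> * \<bar>sin (t / 2)\<bar>"
      by (simp add: power2_eq_square)
    also have "\<dots> \<le> \<bar>t / 2\<bar> * 1"
      by (intro mult_mono abs_sin_x_le_abs_x) auto
    finally show ?thesis by simp
  qed
  have "blinfun_apply (rot J t - id_blinfun) x =
      sin t *\<^sub>R blinfun_apply J x + (1 - cos t) *\<^sub>R blinfun_apply J (blinfun_apply J x)"
    by (simp add: rot_apply)
  also have "norm \<dots> \<le> \<bar>sin t\<bar> * norm (blinfun_apply J x) + \<bar>1 - cos t\<bar> * norm (blinfun_apply J (blinfun_apply J x))"
    by (rule norm_triangle_le) simp
  also have "\<dots> \<le> \<bar>t\<bar> * norm x + \<bar>t\<bar> * norm x"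
    by (intro add_mono mult_mono s c norm_rot_gen_le order_trans [OF norm_rot_gen_le norm_rot_gen_le]) auto
  finally show "norm (blinfun_apply (rot J t - id_blinfun) x) \<le> 2 * \<bar>t\<bar> * norm x"
    by simp
qed simp

lemma rot_U_fin_0:
  assumes "\<And>j. j \<ge> M \<Longrightarrow> blinfun_apply J (basis_vec j) = 0"
  shows "rot J t \<in> U_fin_0 M"
proof -
  have "range (rot J) \<subseteq> U_fin_0 M"
  proof (rule U_fin_0_connectI)
    have "continuous_on UNIV (rot J)"
      unfolding rot_def by (intro continuous_intros)
    then show "connected (range (rot J))"
      by (rule connected_continuous_image) simp
    show "id_blinfun \<in> range (rot J)"
      by (metis rot_0 rangeI)
    show "range (rot J) \<subseteq> U_fin M"
      using assms by (auto simp: U_fin_iff k_unitary_rot rot_fixes)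
  qed
  then show ?thesis by blast
qed

lemma rot_right_angle: "blinfun_apply (rot J (pi / 2)) x =
    x + blinfun_apply J x + blinfun_apply J (blinfun_apply J x)"
  by (simp add: rot_apply)

end

section \<open>Moving vectors by rotations in a plane\<close>

definition plane_gen :: "'k::lc_scalar ell2 \<Rightarrow> 'k ell2 \<Rightarrow> 'k op" where
  "plane_gen a u = Blinfun (\<lambda>x. u \<cdot>\<^sub>K kinner a x - a \<cdot>\<^sub>K kinner u x)"

lemma norm_plane_gen_le: "norm (u \<cdot>\<^sub>K kinner a x - a \<cdot>\<^sub>K kinner u x) \<le> 2 * (norm a * norm u) * norm x"
  for a u x :: "'k::lc_scalar ell2"
proof -
  have "norm (u \<cdot>\<^sub>K kinner a x - a \<cdot>\<^sub>K kinner u x) \<le> norm u * norm (kinner a x) + norm a * norm (kinner u x)"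
    by (rule order_trans [OF norm_triangle_ineq4]) (simp add: norm_scaleK)
  also have "\<dots> \<le> norm u * (norm a * norm x) + norm a * (norm u * norm x)"
    by (intro add_mono mult_left_mono norm_kinner_le) auto
  finally show ?thesis by (simp add: algebra_simps)
qed

lemma plane_gen_apply [simp]: "blinfun_apply (plane_gen a u) x = u \<cdot>\<^sub>K kinner a x - a \<cdot>\<^sub>K kinner u x"
proof -
  have "bounded_linear (\<lambda>x. u \<cdot>\<^sub>K kinner a x - a \<cdot>\<^sub>K kinner u x)"
    by (rule bounded_linear_intro [where K = "2 * (norm a * norm u)"])
      (use norm_plane_gen_le [of u a] in \<open>simp_all add: algebra_simps\<close>)
  then show ?thesis
    unfolding plane_gen_def by (simp add: bounded_linear_Blinfun_apply)
qed

lemma inner_scaleK_kinner: "inner (u \<cdot>\<^sub>K c) y = inner (kinner u y) c" for u y :: "'k::lc_scalar ell2"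
  by (metis inner_commute inner_kinner)

lemma rot_gen_plane_gen:
  fixes a u :: "'k::lc_scalar ell2"
  assumes "norm a = 1" "norm u = 1" "kinner a u = 0"
  shows "rot_gen (plane_gen a u)"
proof -
  have "kinner u a = 0" using assms(3) kinner_eq_0_commute by blast
  with assms show ?thesis
    unfolding rot_gen_def klin_def
    by (auto simp: kinner_self inner_diff inner_scaleK_kinner inner_commute [of _ "_ \<cdot>\<^sub>K _"])
      (simp add: inner_commute)
qed

lemma kinner_disjoint: "(\<And>j. coord x j = 0 \<or> coord y j = 0) \<Longrightarrow> kinner x y = 0"
  for x y :: "'k::lc_scalar ell2"
proof -
  assume *: "\<And>j. coord x j = 0 \<or> coord y j = 0"
  have "(\<lambda>j. kcnj (coord x j) * coord y j) = (\<lambda>j. 0)"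
    using * by (intro ext) (metis kcnj_zero mult_zero_left mult_zero_right)
  then show "kinner x y = 0" by (simp only: kinner_def suminf_zero)
qed

lemma U_fin_span_first:
  fixes g :: "'k::lc_scalar op"
  assumes "g \<in> U_fin_0 m" "x \<in> span_first m"
  shows "blinfun_apply g x \<in> span_first m"
  using assms U_fin_0_subset by (auto simp: U_fin_def)

text \<open>The scalar \<open>kinner a f\<close> can be non-real, and then the real plane spanned by \<open>a\<close> and \<open>f\<close> has no
  basis that is orthonormal over the scalars. Rotating \<open>a\<close> to an auxiliary vector \<open>u\<close> orthogonal to both, and then \<open>u\<close> to \<open>f\<close>,
  avoids the problem; the two rotations nearly cancel when \<open>a\<close> is close to \<open>f\<close>, since the generator
  depends linearly on the vector.\<close>

lemma move_vector:
  fixes a f u :: "'k::lc_scalar ell2"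
  assumes a: "norm a = 1" "kinner a u = 0" and f: "norm f = 1" "kinner f u = 0"
    and u: "norm u = 1" and M: "a \<in> span_first M" "f \<in> span_first M" "u \<in> span_first M"
  shows "\<exists>r\<in>U_fin_0 M. blinfun_apply r a = f \<and> norm (r - id_blinfun) \<le> 6 * norm (a - f) \<and>
    (\<forall>x. kinner a x = 0 \<longrightarrow> kinner f x = 0 \<longrightarrow> kinner u x = 0 \<longrightarrow> blinfun_apply r x = x)"
proof -
  let ?A = "plane_gen a u" and ?F = "plane_gen f u"
  have ua: "kinner u a = 0" and uf: "kinner u f = 0"
    using a(2) f(2) kinner_eq_0_commute by blast+
  have A: "rot_gen ?A" and F: "rot_gen ?F"
    by (intro rot_gen_plane_gen a f u)+
  define r where "r = rot ?F (- (pi / 2)) o\<^sub>L rot ?A (pi / 2)"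
  have "blinfun_apply ?A (basis_vec j) = 0" "blinfun_apply ?F (basis_vec j) = 0" if "j \<ge> M" for j
    using that M by (simp_all add: span_first_iff)
  then have "rot ?A (pi / 2) \<in> U_fin_0 M" "rot ?F (- (pi / 2)) \<in> U_fin_0 M"
    using rot_U_fin_0 [OF A] rot_U_fin_0 [OF F] by blast+
  then have 1: "r \<in> U_fin_0 M"
    unfolding r_def by (simp add: U_fin_0_compose)
  have "blinfun_apply (rot ?A (pi / 2)) a = u" "blinfun_apply (rot ?F (pi / 2)) f = u"
    using a f u ua uf by (simp_all add: rot_right_angle [OF A] rot_right_angle [OF F] kinner_self)
  then have 2: "blinfun_apply r a = f"
    unfolding r_def blinfun_apply_blinfun_compose by (metis rot_cancel(2) [OF F])
  have d: "norm (blinfun_apply ?A x - blinfun_apply ?F x) \<le> 2 * norm (a - f) * norm x" for x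
  proof -
    have "blinfun_apply ?A x - blinfun_apply ?F x = u \<cdot>\<^sub>K kinner (a - f) x - (a - f) \<cdot>\<^sub>K kinner u x"
      by simp
    then show ?thesis
      using norm_plane_gen_le [of u "a - f" x] by (simp only: u mult_1_right)
  qed
  have 3: "norm (r - id_blinfun) \<le> 6 * norm (a - f)"
  proof (rule norm_blinfun_bound)
    fix x
    let ?Ax = "blinfun_apply ?A x" and ?Fx = "blinfun_apply ?F x"
    have "blinfun_apply (rot ?F (- (pi / 2))) (blinfun_apply (rot ?F (pi / 2)) x) = x"
      by (rule rot_cancel(2) [OF F])
    then have "blinfun_apply (r - id_blinfun) x =
        blinfun_apply (rot ?F (- (pi / 2))) (blinfun_apply (rot ?A (pi / 2)) x - blinfun_apply (rot ?F (pi / 2)) x)"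
      by (simp only: r_def blinfun.diff_left blinfun.diff_right blinfun_apply_blinfun_compose
          id_blinfun.rep_eq id_apply)
    then have "norm (blinfun_apply (r - id_blinfun) x) =
        norm (blinfun_apply (rot ?A (pi / 2)) x - blinfun_apply (rot ?F (pi / 2)) x)"
      by (simp only: k_unitary_norm [OF k_unitary_rot [OF F]])
    \<comment> \<open>With \<open>rot J (pi / 2) = 1 + J + J\<^sup>2\<close> this is \<open>A\<^sup>2 - F\<^sup>2 = A (A - F) + (A - F) F\<close>.\<close>
    also have "\<dots> = norm ((?Ax - ?Fx) + (blinfun_apply ?A (?Ax - ?Fx) +
        (blinfun_apply ?A ?Fx - blinfun_apply ?F ?Fx)))"
      unfolding rot_right_angle [OF A] rot_right_angle [OF F] blinfun.diff_right
      by (rule arg_cong [where f = norm]) (simp only: algebra_simps)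
    also have "\<dots> \<le> norm (?Ax - ?Fx) + (norm (blinfun_apply ?A (?Ax - ?Fx)) +
        norm (blinfun_apply ?A ?Fx - blinfun_apply ?F ?Fx))"
      by (intro norm_triangle_le add_left_mono norm_triangle_ineq order_refl)
    also have "\<dots> \<le> 2 * norm (a - f) * norm x + (2 * norm (a - f) * norm x + 2 * norm (a - f) * norm x)"
    proof (intro add_mono d)
      show "norm (blinfun_apply ?A (?Ax - ?Fx)) \<le> 2 * norm (a - f) * norm x"
        by (rule order_trans [OF norm_rot_gen_le [OF A] d])
      have "2 * norm (a - f) * norm ?Fx \<le> 2 * norm (a - f) * norm x"
        by (intro mult_left_mono norm_rot_gen_le [OF F]) simp
      with d [of ?Fx] show "norm (blinfun_apply ?A ?Fx - blinfun_apply ?F ?Fx) \<le> 2 * norm (a - f) * norm x"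
        by linarith
    qed
    finally show "norm (blinfun_apply (r - id_blinfun) x) \<le> 6 * norm (a - f) * norm x"
      by (simp add: mult_ac)
  qed simp
  have "blinfun_apply r x = x" if "kinner a x = 0" "kinner f x = 0" "kinner u x = 0" for x
    using that by (simp add: r_def rot_fixes)
  with 1 2 3 show ?thesis by blast
qed

text \<open>The images of the basis vectors are corrected one after the other, each time through a new
  coordinate \<open>M + k\<close>. Moving \<open>h e\<^sub>k\<close> to \<open>g e\<^sub>k\<close> adds to the distance from the identity at
  most \<open>6 \<parallel>h e\<^sub>k - g e\<^sub>k\<parallel> \<le> 6 \<parallel>h - 1\<parallel> + 6 \<parallel>g - 1\<parallel>\<close>, hence the factor \<open>7\<close>.\<close>

lemma frame_lift:
  fixes g :: "'k::lc_scalar op"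
  assumes g: "k_unitary g" and M: "n \<le> M" "\<And>j. j < n \<Longrightarrow> blinfun_apply g (basis_vec j) \<in> span_first M"
    and k: "k \<le> n"
  shows "\<exists>h\<in>U_fin_0 (M + k). (\<forall>j<k. blinfun_apply h (basis_vec j) = blinfun_apply g (basis_vec j)) \<and>
    norm (h - id_blinfun) \<le> (7 ^ k - 1) * norm (g - id_blinfun)"
  using k
proof (induction k)
  case 0
  show ?case by (intro bexI [of _ id_blinfun]) (simp_all add: U_fin_0_id)
next
  case (Suc k)
  then obtain h where h: "h \<in> U_fin_0 (M + k)"
    and hj: "\<And>j. j < k \<Longrightarrow> blinfun_apply h (basis_vec j) = blinfun_apply g (basis_vec j)"
    and hn: "norm (h - id_blinfun) \<le> (7 ^ k - 1) * norm (g - id_blinfun)"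
    by auto
  have hu: "k_unitary h" using h U_fin_0_subset U_fin_iff by blast
  define e f u where "e = blinfun_apply h (basis_vec k)" and "f = blinfun_apply g (basis_vec k)"
    and "u = (basis_vec (M + k) :: 'k ell2)"
  have eM: "e \<in> span_first (M + k)"
    unfolding e_def by (rule U_fin_span_first [OF h]) (use Suc.prems M(1) in \<open>simp add: span_first_iff\<close>)
  have fM: "f \<in> span_first M"
    unfolding f_def by (rule M) (use Suc.prems in simp)
  have "\<exists>r\<in>U_fin_0 (Suc (M + k)). blinfun_apply r e = f \<and> norm (r - id_blinfun) \<le> 6 * norm (e - f) \<and>
    (\<forall>x. kinner e x = 0 \<longrightarrow> kinner f x = 0 \<longrightarrow> kinner u x = 0 \<longrightarrow> blinfun_apply r x = x)"
  proof (rule move_vector)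
    show "norm e = 1" "norm f = 1" "norm u = 1"
      by (simp_all add: e_def f_def u_def k_unitary_norm [OF hu] k_unitary_norm [OF g])
    show "kinner e u = 0" "kinner f u = 0"
      using eM fM by (simp_all add: u_def span_first_iff)
    show "e \<in> span_first (Suc (M + k))" "f \<in> span_first (Suc (M + k))"
      using eM fM by (auto simp: span_first_iff)
    show "u \<in> span_first (Suc (M + k))"
      by (simp add: u_def span_first_iff)
  qed
  then obtain r where r: "r \<in> U_fin_0 (M + Suc k)" "blinfun_apply r e = f"
    and rn: "norm (r - id_blinfun) \<le> 6 * norm (e - f)"
    and rx: "\<And>x. kinner e x = 0 \<Longrightarrow> kinner f x = 0 \<Longrightarrow> kinner u x = 0 \<Longrightarrow> blinfun_apply r x = x"
    by auto
  have "r o\<^sub>L h \<in> U_fin_0 (M + Suc k)"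
    using r(1) h U_fin_0_mono [of "M + k" "M + Suc k"] by (intro U_fin_0_compose) auto
  moreover have "blinfun_apply (r o\<^sub>L h) (basis_vec j) = blinfun_apply g (basis_vec j)" if "j < Suc k" for j
  proof (cases "j = k")
    case True
    then show ?thesis using r(2) by (simp add: e_def f_def)
  next
    case False
    then have j: "j < k" using that by simp
    have "blinfun_apply r (blinfun_apply g (basis_vec j)) = blinfun_apply g (basis_vec j)"
    proof (rule rx)
      show "kinner e (blinfun_apply g (basis_vec j)) = 0"
        unfolding e_def hj [OF j, symmetric] k_unitary_kinner [OF hu] using j by simp
      show "kinner f (blinfun_apply g (basis_vec j)) = 0"
        unfolding f_def k_unitary_kinner [OF g] using j by simp
      show "kinner u (blinfun_apply g (basis_vec j)) = 0"
        using M(2) [of j] j Suc.prems by (simp add: u_def span_first_iff)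
    qed
    then show ?thesis by (simp add: hj [OF j])
  qed
  moreover have "norm ((r o\<^sub>L h) - id_blinfun) \<le> (7 ^ Suc k - 1) * norm (g - id_blinfun)"
  proof -
    have ef: "norm (e - f) \<le> norm (h - id_blinfun) + norm (g - id_blinfun)"
    proof -
      have "e - f = blinfun_apply (h - id_blinfun) (basis_vec k) - blinfun_apply (g - id_blinfun) (basis_vec k)"
        by (simp add: e_def f_def)
      then have "norm (e - f) \<le> norm (blinfun_apply (h - id_blinfun) (basis_vec k)) +
          norm (blinfun_apply (g - id_blinfun) (basis_vec k))"
        by (simp only: norm_triangle_ineq4)
      also have "\<dots> \<le> norm (h - id_blinfun) + norm (g - id_blinfun)"
        using norm_blinfun [of "h - id_blinfun" "basis_vec k"] norm_blinfun [of "g - id_blinfun" "basis_vec k"]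
        by (intro add_mono) (simp_all only: norm_basis_vec mult_1_right)
      finally show ?thesis .
    qed
    have "(r o\<^sub>L h) - id_blinfun = ((r - id_blinfun) o\<^sub>L h) + (h - id_blinfun)"
      by (rule blinfun_eqI) simp
    then have "norm ((r o\<^sub>L h) - id_blinfun) \<le> norm ((r - id_blinfun) o\<^sub>L h) + norm (h - id_blinfun)"
      by (simp only: norm_triangle_ineq)
    also have "\<dots> = norm (r - id_blinfun) + norm (h - id_blinfun)"
      by (simp add: norm_isom_compose_right hu)
    also have "\<dots> \<le> 7 * norm (h - id_blinfun) + 6 * norm (g - id_blinfun)"
      using rn ef by linarith
    also have "\<dots> \<le> 7 * ((7 ^ k - 1) * norm (g - id_blinfun)) + 6 * norm (g - id_blinfun)"
      using hn by linarith
    also have "\<dots> = (7 ^ Suc k - 1) * norm (g - id_blinfun)"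
      by (simp add: algebra_simps)
    finally show ?thesis .
  qed
  ultimately show ?case by blast
qed

text \<open>Only the component of the \<open>i\<close>-th image outside the first \<open>n + i\<close> coordinates has to be moved, and
  it can be moved to a multiple of the next basis vector by an element that fixes everything in the
  first \<open>n + i\<close> coordinates.\<close>

lemma compress_frame:
  fixes g :: "'k::lc_scalar op"
  assumes g: "g \<in> U_lim_0" and i: "i \<le> n"
  shows "\<exists>k\<in>K_sub n. \<forall>j<i. blinfun_apply k (blinfun_apply g (basis_vec j)) \<in> span_first (n + i)"
  using i
proof (induction i)
  case 0
  show ?case using K_sub_id by blast
next
  case (Suc i)
  then obtain k where k: "k \<in> K_sub n"
    and ki: "\<And>j. j < i \<Longrightarrow> blinfun_apply k (blinfun_apply g (basis_vec j)) \<in> span_first (n + i)"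
    by auto
  define a where "a = blinfun_apply k (blinfun_apply g (basis_vec i))"
  define q where "q = mask {n + i..} a"
  have aq: "a = mask {..<n + i} a + q"
    unfolding q_def by (rule ell2_eqI) simp
  show ?case
  proof (cases "q = 0")
    case True
    have "blinfun_apply k (blinfun_apply g (basis_vec j)) \<in> span_first (n + Suc i)" if "j < Suc i" for j
    proof (cases "j = i")
      case True
      have "a = mask {..<n + i} a" using aq \<open>q = 0\<close> by simp
      then have "coord a l = 0" if "l \<ge> n + i" for l
        using that by (metis coord_mask lessThan_iff linorder_not_less)
      with True show ?thesis by (simp add: span_first_iff a_def [symmetric])
    qed (use that ki [of j] in \<open>auto simp: span_first_iff\<close>)
    with k show ?thesis by blast
  next
    case False
    obtain M1 M2 where M12: "g \<in> U_fin_0 M1" "k \<in> U_fin_0 M2"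
      using g k by (auto simp: K_sub_iff U_lim_0_iff)
    define M where "M = Suc (n + i) + (M1 + M2)"
    have "g \<in> U_fin_0 M" "k \<in> U_fin_0 M"
      using M12 U_fin_0_mono [of M1 M] U_fin_0_mono [of M2 M] by (auto simp: M_def)
    then have aM: "a \<in> span_first M"
      unfolding a_def by (intro U_fin_span_first) (simp_all add: span_first_iff M_def)
    define b where "b = (1 / norm q) *\<^sub>R q"
    have b0: "coord b l = 0" if "l < n + i \<or> l \<ge> M" for l
      using that aM by (auto simp: b_def q_def span_first_iff)
    have "\<exists>r\<in>U_fin_0 (Suc M). blinfun_apply r b = basis_vec (n + i) \<and>
        norm (r - id_blinfun) \<le> 6 * norm (b - basis_vec (n + i)) \<and>
        (\<forall>x. kinner b x = 0 \<longrightarrow> kinner (basis_vec (n + i)) x = 0 \<longrightarrow> kinner (basis_vec M) x = 0 \<longrightarrow>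
          blinfun_apply r x = x)"
    proof (rule move_vector)
      show "norm b = 1" using False by (simp add: b_def)
    qed (use b0 in \<open>auto simp: span_first_iff M_def\<close>)
    then obtain r where r: "r \<in> U_fin_0 (Suc M)" "blinfun_apply r b = basis_vec (n + i)"
      and rx: "\<And>x. kinner b x = 0 \<Longrightarrow> kinner (basis_vec (n + i)) x = 0 \<Longrightarrow> kinner (basis_vec M) x = 0 \<Longrightarrow>
          blinfun_apply r x = x"
      by auto
    have fx: "blinfun_apply r x = x" if "x \<in> span_first (n + i)" for x
    proof (rule rx)
      show "kinner b x = 0"
        using that b0 by (intro kinner_disjoint) (metis linorder_not_less span_first_iff)
    qed (use that in \<open>auto simp: span_first_iff M_def\<close>)
    have "r \<in> K_sub n"
      using r(1) by (auto simp: K_sub_iff U_lim_0_iff span_first_iff intro!: fx)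
    then have "r o\<^sub>L k \<in> K_sub n"
      using k by (rule K_sub_compose)
    moreover have "blinfun_apply (r o\<^sub>L k) (blinfun_apply g (basis_vec j)) \<in> span_first (n + Suc i)"
      if "j < Suc i" for j
    proof (cases "j = i")
      case True
      have "q = norm q *\<^sub>R b" using False by (simp add: b_def)
      then have "blinfun_apply r q = norm q *\<^sub>R basis_vec (n + i)"
        using r(2) by (metis blinfun.scaleR_right)
      moreover have "blinfun_apply r (mask {..<n + i} a) = mask {..<n + i} a"
        by (rule fx) (simp add: span_first_iff)
      ultimately have "blinfun_apply r a = mask {..<n + i} a + norm q *\<^sub>R basis_vec (n + i)"
        using aq by (metis blinfun.add_right)
      then show ?thesis
        using True by (simp add: span_first_iff a_def [symmetric])
    next
      case False
      then have j: "j < i" using that by simp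
      show ?thesis
        using fx [OF ki [OF j]] ki [OF j] by (auto simp: span_first_iff)
    qed
    ultimately show ?thesis by blast
  qed
qed

text \<open>Since \<open>g\<close> is conjugate under \<open>K_sub n\<close> to \<open>h s\<close> with \<open>s\<close> in \<open>K_sub n\<close>, the elements \<open>g\<close> and \<open>h\<close> move a
  \<open>K_sub n\<close>-fixed vector equally far.\<close>

lemma double_coset_form:
  fixes g :: "'k::lc_scalar op"
  assumes g: "g \<in> U_lim_0"
  shows "\<exists>k\<in>K_sub n. \<exists>h\<in>U_fin_0 (3 * n). \<exists>s\<in>K_sub n.
    k o\<^sub>L g = h o\<^sub>L s o\<^sub>L k \<and> norm (h - id_blinfun) \<le> 7 ^ n * norm (g - id_blinfun)"
proof -
  obtain k where k: "k \<in> K_sub n"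
    and kj: "\<And>j. j < n \<Longrightarrow> blinfun_apply k (blinfun_apply g (basis_vec j)) \<in> span_first (n + n)"
    using compress_frame [OF g order_refl] by blast
  have kl: "k \<in> U_lim_0" using k by (simp add: K_sub_iff)
  have ku: "k_unitary k" by (rule U_lim_0_unitary [OF kl])
  have ik: "inv_op k \<in> K_sub n" by (rule K_sub_inv [OF k])
  define c where "c = k o\<^sub>L g o\<^sub>L inv_op k"
  have cl: "c \<in> U_lim_0"
    unfolding c_def by (intro U_lim_0_compose g kl U_lim_0_inv)
  have cj: "blinfun_apply c (basis_vec j) = blinfun_apply k (blinfun_apply g (basis_vec j))" if "j < n" for j
    using ik that by (simp add: c_def K_sub_iff)
  have cn: "norm (c - id_blinfun) = norm (g - id_blinfun)"
  proof -
    have "c - id_blinfun = k o\<^sub>L ((g - id_blinfun) o\<^sub>L inv_op k)"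
      by (rule blinfun_eqI) (simp add: c_def ku)
    then show ?thesis
      by (simp add: norm_isom_compose_left norm_isom_compose_right ku isom_op_inv)
  qed
  have "\<exists>h\<in>U_fin_0 (n + n + n). (\<forall>j<n. blinfun_apply h (basis_vec j) = blinfun_apply c (basis_vec j)) \<and>
      norm (h - id_blinfun) \<le> (7 ^ n - 1) * norm (c - id_blinfun)"
    by (rule frame_lift [OF U_lim_0_unitary [OF cl], where n = n]) (auto simp: cj kj)
  then obtain h where h: "h \<in> U_fin_0 (n + n + n)"
    and hj: "\<And>j. j < n \<Longrightarrow> blinfun_apply h (basis_vec j) = blinfun_apply c (basis_vec j)"
    and hn: "norm (h - id_blinfun) \<le> (7 ^ n - 1) * norm (c - id_blinfun)"
    by auto
  have hl: "h \<in> U_lim_0" using h U_lim_0_iff by blast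
  have hu: "isom_op h" using U_lim_0_unitary [OF hl] by simp
  define s where "s = inv_op h o\<^sub>L c"
  have "s \<in> U_lim_0" unfolding s_def by (intro U_lim_0_compose U_lim_0_inv hl cl)
  moreover have "blinfun_apply s (basis_vec j) = basis_vec j" if "j < n" for j
    using hj [OF that] hu by (simp add: s_def) (metis inv_op_left)
  ultimately have s: "s \<in> K_sub n" by (simp add: K_sub_iff)
  have "k o\<^sub>L g = h o\<^sub>L s o\<^sub>L k"
    by (rule blinfun_eqI) (simp add: s_def c_def hu ku)
  moreover have "norm (h - id_blinfun) \<le> 7 ^ n * norm (g - id_blinfun)"
  proof -
    have "(7 ^ n - 1) * norm (c - id_blinfun) \<le> 7 ^ n * norm (g - id_blinfun)"
      unfolding cn by (intro mult_right_mono) auto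
    with hn show ?thesis by linarith
  qed
  moreover have "n + n + n = 3 * n" by simp
  ultimately show ?thesis using k h s by metis
qed

section \<open>Products of bounded length\<close>

primrec prods :: "('a::real_normed_vector \<Rightarrow>\<^sub>L 'a) set \<Rightarrow> nat \<Rightarrow> ('a \<Rightarrow>\<^sub>L 'a) set" where
  "prods A 0 = {id_blinfun}"
| "prods A (Suc N) = {a o\<^sub>L b | a b. a \<in> A \<and> b \<in> prods A N}"

lemma prods_image:
  assumes "\<phi> id_blinfun = id_blinfun" "\<And>a b. \<phi> (a o\<^sub>L b) = \<phi> a o\<^sub>L \<phi> b" "\<And>a. a \<in> A \<Longrightarrow> \<phi> a \<in> B"
  shows "g \<in> prods A N \<Longrightarrow> \<phi> g \<in> prods B N"
  using assms by (induction N arbitrary: g) (auto, blast)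



lemma prods_append: "g \<in> prods A M \<Longrightarrow> h \<in> prods A N \<Longrightarrow> g o\<^sub>L h \<in> prods A (M + N)"
proof (induction M arbitrary: g)
  case (Suc M)
  then obtain a b where "g = a o\<^sub>L b" "a \<in> A" "b \<in> prods A M" by auto
  with Suc show ?case by (auto simp: blinfun_compose_assoc)
qed auto

lemma prods_1: "a \<in> A \<Longrightarrow> a \<in> prods A 1"
  by (auto intro!: exI [of _ a] exI [of _ id_blinfun])

lemma prods_commute:
  assumes "\<And>a. a \<in> A \<Longrightarrow> a o\<^sub>L b = b o\<^sub>L a"
  shows "x \<in> prods A N \<Longrightarrow> x o\<^sub>L b = b o\<^sub>L x"
proof (induction N arbitrary: x)
  case (Suc N)
  then obtain a y where "x = a o\<^sub>L y" "a \<in> A" "y o\<^sub>L b = b o\<^sub>L y" by auto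
  then show ?case using assms [of a] by (metis blinfun_compose_assoc)
qed simp

text \<open>Products of commuting families can be formed factor by factor, which keeps their length.\<close>

lemma prods_disjoint:
  assumes c: "\<And>a b. a \<in> A \<Longrightarrow> b \<in> B \<Longrightarrow> a o\<^sub>L b = b o\<^sub>L a" and C: "\<And>a b. a \<in> A \<Longrightarrow> b \<in> B \<Longrightarrow> a o\<^sub>L b \<in> C"
  shows "x \<in> prods A N \<Longrightarrow> y \<in> prods B N \<Longrightarrow> x o\<^sub>L y \<in> prods C N"
proof (induction N arbitrary: x y)
  case (Suc N)
  then obtain a x' b y' where *: "x = a o\<^sub>L x'" "a \<in> A" "x' \<in> prods A N"
    "y = b o\<^sub>L y'" "b \<in> B" "y' \<in> prods B N" by auto
  have "x' o\<^sub>L b = b o\<^sub>L x'"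
    by (rule prods_commute [OF c *(3)]) (use * in auto)
  then have "x o\<^sub>L y = (a o\<^sub>L b) o\<^sub>L (x' o\<^sub>L y')"
    unfolding *(1,4) by (metis blinfun_compose_assoc)
  then show ?case
    using Suc.IH [OF *(3,6)] C [OF *(2,5)] by auto
qed auto

lemma prods_rot:
  fixes J :: "'k::lc_scalar op"
  assumes J: "rot_gen J" and N: "N > 0" and A: "rot J (t / real N) \<in> A"
  shows "rot J t \<in> prods A N"
proof -
  have "rot J (real k * (t / real N)) \<in> prods A k" for k
  proof (induction k)
    case (Suc k)
    have "rot J (real (Suc k) * (t / real N)) = rot J (t / real N) o\<^sub>L rot J (real k * (t / real N))"
      unfolding rot_add [OF J] by (rule arg_cong [where f = "rot J"]) (simp add: algebra_simps add_divide_distrib)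
    with Suc A show ?case by auto
  qed simp
  from this [of N] show ?thesis using N by simp
qed

section \<open>Exchanging two blocks of coordinates\<close>

text \<open>The rotation by a right angle generated by this operator takes the basis vector with index \<open>j\<close> to
  the one with index \<open>m + j\<close>, simultaneously for all \<open>j\<close> with \<open>n \<le> j < m\<close>.\<close>

definition swap_gen :: "nat \<Rightarrow> nat \<Rightarrow> 'k::rch_scalar op" where
  "swap_gen n m = (Shr m o\<^sub>L Mask {n..<m}) - (Mask {n..<m} o\<^sub>L Shl m)"

lemma coord_swap_gen: "coord (blinfun_apply (swap_gen n m) x) i =
    (if m + n \<le> i \<and> i < m + m then coord x (i - m) else 0) -
    (if n \<le> i \<and> i < m then coord x (i + m) else 0)"
  by (auto simp: swap_gen_def)

lemma inner_mask: "inner (mask I x) y = inner x (mask I y)"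
  unfolding inner_ell2_def by (rule arg_cong [where f = suminf]) auto

lemma rot_gen_swap_gen: "rot_gen (swap_gen n m :: 'k::lc_scalar op)"
  unfolding rot_gen_def
proof (intro conjI allI)
  show "klin (swap_gen n m :: 'k op)"
    unfolding swap_gen_def by (intro klin_diff klin_compose klin_Shr klin_Shl klin_Mask)
  show "inner (blinfun_apply (swap_gen n m) x) y = - inner x (blinfun_apply (swap_gen n m) y)"
    for x y :: "'k ell2"
  proof -
    have "inner (shift_left m u) v = inner u (shift_right m v)" for u v :: "'k ell2"
      by (metis inner_commute inner_shift)
    then show ?thesis
      by (simp add: swap_gen_def inner_diff inner_shift inner_mask)
  qed
  show "blinfun_apply (swap_gen n m) (blinfun_apply (swap_gen n m) (blinfun_apply (swap_gen n m) x)) =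
      - blinfun_apply (swap_gen n m) x" for x :: "'k ell2"
    by (rule ell2_eqI) (auto simp: coord_swap_gen)
qed

lemma coord_rot_swap: "coord (blinfun_apply (rot (swap_gen n m) (pi / 2)) x) i =
    (if n \<le> i \<and> i < m then - coord x (i + m)
     else if m + n \<le> i \<and> i < m + m then coord x (i - m) else coord x i)"
  for x :: "'k::lc_scalar ell2"
  by (auto simp: rot_right_angle [OF rot_gen_swap_gen] coord_swap_gen)

lemma swap_gen_basis:
  assumes "j < n \<or> j \<ge> 2 * m"
  shows "blinfun_apply (swap_gen n m) (basis_vec j :: 'k::lc_scalar ell2) = 0"
  by (rule ell2_eqI) (use assms in \<open>auto simp: coord_swap_gen\<close>)

text \<open>The rotation carries the coordinates between \<open>n\<close> and \<open>m\<close>, on which \<open>g\<close> acts, to the block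
  shifted by \<open>m\<close>, on which the translate of \<open>g\<close> acts in the same way.\<close>

lemma swap_conjugates:
  fixes g :: "'k::lc_scalar op"
  assumes g: "g \<in> U_fin m" and fixed: "\<And>j. j < n \<Longrightarrow> blinfun_apply g (basis_vec j) = basis_vec j"
  shows "rot (swap_gen n m) (pi / 2) o\<^sub>L g = translate m g o\<^sub>L rot (swap_gen n m) (pi / 2)"
proof (intro blinfun_eqI ell2_eqI)
  fix x :: "'k ell2" and i
  let ?r = "rot (swap_gen n m) (pi / 2)"
  have gu: "k_unitary g" using g by (simp add: U_fin_iff)
  have gc: "coord (blinfun_apply g y) j = coord y j" if "j < n \<or> j \<ge> m" for y j
    by (rule k_unitary_coord_fixed [OF gu]) (use that g fixed in \<open>auto simp: U_fin_iff\<close>)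
  let ?z = "blinfun_apply ?r x"
  let ?w = "shift_left m ?z"
  have w: "coord (blinfun_apply g ?w) j = coord (blinfun_apply g x) j" if j: "n \<le> j" "j < m" for j
  proof -
    have "blinfun_apply g (?w - x) = ?w - x"
      by (rule k_unitary_fixes [OF gu, where I = "{..<n} \<union> {m..}"])
        (use g fixed in \<open>auto simp: U_fin_iff coord_rot_swap\<close>)
    then have "coord (blinfun_apply g ?w) j - coord (blinfun_apply g x) j = coord ?w j - coord x j"
      by (metis blinfun.diff_right coord_simps(2))
    also have "\<dots> = 0" using j by (simp add: coord_rot_swap)
    finally show ?thesis by simp
  qed
  have "coord (blinfun_apply ?r (blinfun_apply g x)) i =
      coord (blinfun_apply (translate m g) ?z) i"
  proof (cases "m + n \<le> i \<and> i < m + m")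
    case True
    then have "n \<le> i - m" "i - m < m" by auto
    with True w show ?thesis by (simp add: coord_rot_swap)
  next
    case False
    show ?thesis
    proof (cases "i < m")
      case True
      then show ?thesis using False by (auto simp: coord_rot_swap gc)
    next
      case im: False
      then have "i - m < n \<or> m \<le> i - m" using False by auto
      from gc [OF this, of ?w] gc [of i x] im False show ?thesis
        by (auto simp: coord_rot_swap)
    qed
  qed
  then show "coord (blinfun_apply (?r o\<^sub>L g) x) i =
      coord (blinfun_apply (translate m g o\<^sub>L ?r) x) i"
    by simp
qed

section \<open>Bounded generation\<close>

definition small :: "real \<Rightarrow> 'k::rch_scalar op set" where
  "small \<delta> = {b \<in> U_lim_0. norm (b - id_blinfun) \<le> \<delta>}"

lemma norm_conj:
  fixes g :: "'a::real_normed_vector \<Rightarrow>\<^sub>L 'a"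
  assumes "isom_op g"
  shows "norm ((g o\<^sub>L b o\<^sub>L inv_op g) - id_blinfun) = norm (b - id_blinfun)"
proof -
  have "(g o\<^sub>L b o\<^sub>L inv_op g) - id_blinfun = g o\<^sub>L ((b - id_blinfun) o\<^sub>L inv_op g)"
    by (rule blinfun_eqI) (simp add: assms)
  then show ?thesis
    by (simp add: norm_isom_compose_left norm_isom_compose_right assms isom_op_inv)
qed

lemma conj_compose:
  assumes "isom_op g"
  shows "g o\<^sub>L (a o\<^sub>L b) o\<^sub>L inv_op g = (g o\<^sub>L a o\<^sub>L inv_op g) o\<^sub>L (g o\<^sub>L b o\<^sub>L inv_op g)"
  by (rule blinfun_eqI) (simp add: assms)

lemma conj_id: "isom_op g \<Longrightarrow> g o\<^sub>L id_blinfun o\<^sub>L inv_op g = id_blinfun"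
  by (simp add: inv_op_compose)

context
  fixes \<delta> :: real and N :: nat
  assumes \<delta>: "0 < \<delta>" and N: "0 < N" "pi / real N \<le> \<delta>"
begin

text \<open>The block operator with diagonal \<open>g\<close>, \<open>g\<^sup>-\<^sup>1\<close> is the commutator of \<open>g\<close> with the rotation that
  exchanges the two blocks. Cutting the right angle into \<open>N\<close> parts writes the rotation and its
  conjugate by \<open>g\<close> as products of \<open>N\<close> small elements each, whatever \<open>g\<close> and \<open>m\<close> are.\<close>

lemma double_in_prods:
  fixes g :: "'k::lc_scalar op"
  assumes g: "g \<in> U_fin_0 m"
  shows "g o\<^sub>L translate m (inv_op g) \<in> prods {b \<in> U_fin_0 (2 * m). norm (b - id_blinfun) \<le> \<delta>} (2 * N)"
proof -
  let ?A = "{b \<in> U_fin_0 (2 * m). norm (b - id_blinfun) \<le> \<delta>} :: 'k op set"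
  let ?J = "swap_gen 0 m :: 'k op"
  note J = rot_gen_swap_gen [where 'k = 'k, of 0 m]
  have gf: "inv_op g \<in> U_fin m" "g \<in> U_fin m" using U_fin_0_inv [OF g] g U_fin_0_subset by blast+
  then have gi: "isom_op g" by (simp add: U_fin_iff)
  have g2: "g \<in> U_fin_0 (2 * m)" using g U_fin_0_mono [of m "2 * m"] by auto
  have rU: "rot ?J t \<in> U_fin_0 (2 * m)" for t
    by (rule rot_U_fin_0 [OF J]) (simp add: swap_gen_basis)
  have rn: "norm (rot ?J (t / real N) - id_blinfun) \<le> \<delta>" if "\<bar>t\<bar> = pi / 2" for t
    using norm_rot_le [OF J, of "t / real N"] N that by simp
  have "rot ?J ((pi / 2) / real N) \<in> ?A" "rot ?J ((- (pi / 2)) / real N) \<in> ?A"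
    using rU rn [of "pi / 2"] rn [of "- (pi / 2)"] by simp_all
  then have r: "rot ?J (pi / 2) \<in> prods ?A N" "rot ?J (- (pi / 2)) \<in> prods ?A N"
    by (auto intro: prods_rot [OF J N(1)])
  have "g o\<^sub>L rot ?J (pi / 2) o\<^sub>L inv_op g \<in> prods ?A N"
  proof (rule prods_image [where \<phi> = "\<lambda>b. g o\<^sub>L b o\<^sub>L inv_op g" and A = ?A])
    show "g o\<^sub>L b o\<^sub>L inv_op g \<in> ?A" if "b \<in> ?A" for b
      using that g2 by (simp add: norm_conj gi U_fin_0_compose U_fin_0_inv)
  qed (simp_all only: conj_compose conj_id gi r)
  then have "(g o\<^sub>L rot ?J (pi / 2) o\<^sub>L inv_op g) o\<^sub>L rot ?J (- (pi / 2)) \<in> prods ?A (N + N)"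
    using r(2) by (rule prods_append)
  moreover have "translate m (inv_op g) = rot ?J (pi / 2) o\<^sub>L inv_op g o\<^sub>L rot ?J (- (pi / 2))"
  proof (rule blinfun_eqI)
    fix x
    have "blinfun_apply (rot ?J (pi / 2)) (blinfun_apply (inv_op g) (blinfun_apply (rot ?J (- (pi / 2))) x)) =
        blinfun_apply (translate m (inv_op g)) (blinfun_apply (rot ?J (pi / 2)) (blinfun_apply (rot ?J (- (pi / 2))) x))"
      by (rule compose_eq_apply, rule swap_conjugates [OF gf(1)]) simp
    then show "blinfun_apply (translate m (inv_op g)) x =
        blinfun_apply (rot ?J (pi / 2) o\<^sub>L inv_op g o\<^sub>L rot ?J (- (pi / 2))) x"
      by (simp add: rot_cancel [OF J])
  qed
  ultimately show ?thesis
    by (simp add: blinfun_compose_assoc mult_2)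
qed

text \<open>Further blocks can be added behind without using more factors, because the supports are
  disjoint.\<close>

lemma double_translate_in_prods:
  fixes g :: "'k::lc_scalar op"
  assumes g: "g \<in> U_fin_0 m" and D: "D \<in> prods (small \<delta>) (2 * N)"
  shows "g o\<^sub>L translate m (inv_op g) o\<^sub>L translate (2 * m) D \<in> prods (small \<delta>) (2 * N)"
proof (rule prods_disjoint [OF _ _ double_in_prods [OF g]])
  let ?B = "{b \<in> K_sub (2 * m). norm (b - id_blinfun) \<le> \<delta>} :: 'k op set"
  show "translate (2 * m) D \<in> prods ?B (2 * N)"
  proof (rule prods_image [OF _ _ _ D])
    show "translate (2 * m) a \<in> ?B" if "a \<in> small \<delta>" for a
      using that order_trans [OF norm_translate_le] by (auto simp: small_def translate_K_sub)
  qed (simp_all add: translate_compose)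
  fix a b :: "'k op"
  assume a: "a \<in> {b \<in> U_fin_0 (2 * m). norm (b - id_blinfun) \<le> \<delta>}" and b: "b \<in> ?B"
  have a1: "k_unitary a" "\<And>j. j \<ge> 2 * m \<Longrightarrow> blinfun_apply a (basis_vec j) = basis_vec j"
    using a U_fin_0D by auto
  have b1: "k_unitary b" "\<And>j. j < 2 * m \<Longrightarrow> blinfun_apply b (basis_vec j) = basis_vec j"
    using b K_subD by auto
  show "a o\<^sub>L b = b o\<^sub>L a"
    by (rule disjoint_commute [OF a1 b1])
  have "norm ((a o\<^sub>L b) - id_blinfun) \<le> \<delta>"
    by (rule norm_disjoint_le [OF a1 b1]) (use a b in auto)
  moreover have "a o\<^sub>L b \<in> U_lim_0"
    using a b by (intro U_lim_0_compose) (auto simp: K_sub_iff U_lim_0_iff)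
  ultimately show "a o\<^sub>L b \<in> small \<delta>"
    by (simp add: small_def)
qed

text \<open>A finite swindle. Take a chain \<open>1 = g\<^sub>0, \<dots>, g\<^sub>L = g\<close> in \<open>U_fin_0 m\<close> with steps at most \<open>\<delta>\<close>.
  The block diagonal operators
  \<open>D = (g\<^sub>L, g\<^sub>L\<^sup>-\<^sup>1, g\<^sub>L\<^sub>-\<^sub>1, g\<^sub>L\<^sub>-\<^sub>1\<^sup>-\<^sup>1, \<dots>)\<close> and
  \<open>translate m E = (1, g\<^sub>L\<^sub>-\<^sub>1, g\<^sub>L\<^sub>-\<^sub>1\<^sup>-\<^sup>1, g\<^sub>L\<^sub>-\<^sub>2, \<dots>)\<close> consist of pairs of the form \<open>h, h\<^sup>-\<^sup>1\<close>,
  hence are short products of small elements, and their product differs from \<open>(g, 1, 1, \<dots>)\<close> only by the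
  small steps of the chain, which \<open>\<Phi>\<close> collects. Neither length depends on \<open>L\<close>.\<close>

definition swindled :: "nat \<Rightarrow> 'k::lc_scalar op \<Rightarrow> bool" where
  "swindled m g \<longleftrightarrow> (\<exists>D\<in>prods (small \<delta>) (2 * N). \<exists>E\<in>prods (small \<delta>) (2 * N). \<exists>\<Phi>\<in>small \<delta>.
     g = translate m E o\<^sub>L \<Phi> o\<^sub>L D)"

lemma prods_U_lim_0: "D \<in> prods (small \<delta>) n \<Longrightarrow> D \<in> U_lim_0" for D :: "'k::lc_scalar op"
  by (induction n arbitrary: D) (auto simp: U_lim_0_id small_def intro: U_lim_0_compose)

lemma swindled_id: "swindled m (id_blinfun :: 'k::lc_scalar op)"
proof -
  have s: "(id_blinfun :: 'k op) \<in> small \<delta>"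
    using \<delta> by (simp add: small_def U_lim_0_id)
  have "(id_blinfun :: 'k op) \<in> prods (small \<delta>) n" for n
  proof (induction n)
    case (Suc n)
    then show ?case using s by (auto intro!: exI [of _ id_blinfun])
  qed simp
  with s show ?thesis
    unfolding swindled_def by (intro bexI [of _ id_blinfun]) simp_all
qed

text \<open>One step of the chain: the blocks of \<open>g'\<close> are moved two blocks further and a pair belonging to
  \<open>g\<close>, respectively \<open>g'\<close>, is put in front.\<close>

lemma swindled_step:
  fixes g g' :: "'k::lc_scalar op"
  assumes g': "g' \<in> U_fin_0 m" and g: "g \<in> U_fin_0 m" and "norm (g - g') \<le> \<delta>" and sw: "swindled m g'"
  shows "swindled m g"
proof -
  obtain D E \<Phi> where D: "D \<in> prods (small \<delta>) (2 * N)" and E: "E \<in> prods (small \<delta>) (2 * N)"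
    and \<Phi>: "\<Phi> \<in> small \<delta>" and eq: "g' = translate m E o\<^sub>L \<Phi> o\<^sub>L D"
    using sw by (auto simp: swindled_def)
  have gi: "isom_op g" "isom_op g'"
    using U_fin_0D [OF g] U_fin_0D [OF g'] by auto
  define h where "h = inv_op g' o\<^sub>L g"
  have h: "h \<in> U_fin_0 m" unfolding h_def by (intro U_fin_0_compose U_fin_0_inv g g')
  have hn: "norm (h - id_blinfun) \<le> \<delta>"
  proof -
    have "h - id_blinfun = inv_op g' o\<^sub>L (g - g')"
      by (rule blinfun_eqI) (simp add: h_def gi blinfun.diff_right [symmetric])
    then show ?thesis using assms(3) by (simp add: norm_isom_compose_left isom_op_inv gi)
  qed
  let ?t = "translate m" and ?T = "translate (2 * m)"
  define D' E' \<Phi>' where "D' = g o\<^sub>L ?t (inv_op g) o\<^sub>L ?T D" and "E' = g' o\<^sub>L ?t (inv_op g') o\<^sub>L ?T E"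
    and "\<Phi>' = ?t h o\<^sub>L ?T \<Phi>"
  have D': "D' \<in> prods (small \<delta>) (2 * N)" and E': "E' \<in> prods (small \<delta>) (2 * N)"
    unfolding D'_def E'_def by (rule double_translate_in_prods; fact)+
  have K: "?T X \<in> K_sub (2 * m)" if "X \<in> U_lim_0" for X :: "'k op"
    by (rule translate_K_sub [OF that])
  have F: "?t X \<in> U_fin_0 (2 * m)" if "X \<in> U_fin_0 m" for X :: "'k op"
    using translate_U_fin_0 [OF that, of m] by (simp add: mult_2)
  have g2: "g \<in> U_fin_0 (2 * m)" using g U_fin_0_mono [of m "2 * m"] by auto
  have comm: "x o\<^sub>L y = y o\<^sub>L x" if "x \<in> U_fin_0 n" "y \<in> K_sub n" for x y :: "'k op" and n
  proof (rule disjoint_commute)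
    show "k_unitary x" "\<And>j. j \<ge> n \<Longrightarrow> blinfun_apply x (basis_vec j) = basis_vec j"
      using U_fin_0D [OF that(1)] by auto
    show "k_unitary y" "\<And>j. j < n \<Longrightarrow> blinfun_apply y (basis_vec j) = basis_vec j"
      using K_subD [OF that(2)] by auto
  qed
  have \<Phi>': "\<Phi>' \<in> small \<delta>"
  proof -
    have a1: "k_unitary (?t h)" "\<And>j. j \<ge> 2 * m \<Longrightarrow> blinfun_apply (?t h) (basis_vec j) = basis_vec j"
      using U_fin_0D [OF F [OF h]] by auto
    have K\<Phi>: "?T \<Phi> \<in> K_sub (2 * m)" using \<Phi> by (intro K) (simp add: small_def)
    then have b1: "k_unitary (?T \<Phi>)" "\<And>j. j < 2 * m \<Longrightarrow> blinfun_apply (?T \<Phi>) (basis_vec j) = basis_vec j"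
      using K_subD [OF K\<Phi>] by auto
    have "norm (\<Phi>' - id_blinfun) \<le> \<delta>"
      unfolding \<Phi>'_def
      by (rule norm_disjoint_le [OF a1 b1])
        (use order_trans [OF norm_translate_le] hn \<Phi> in \<open>auto simp: small_def\<close>)
    moreover have "\<Phi>' \<in> U_lim_0"
      unfolding \<Phi>'_def using F [OF h] K\<Phi> by (intro U_lim_0_compose) (auto simp: K_sub_iff U_lim_0_iff)
    ultimately show ?thesis by (simp add: small_def)
  qed
  have "g = ?t E' o\<^sub>L \<Phi>' o\<^sub>L D'"
  proof (rule blinfun_eqI)
    fix x
    define X1 X2 X3 where "X1 = ?T (inv_op g' o\<^sub>L ?t E)" and "X2 = ?T \<Phi>" and "X3 = ?T D"
    \<comment> \<open>Everything translated by \<open>2 m\<close> commutes with the first two blocks and can be collected; by the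
      decomposition of \<open>g'\<close> it then cancels.\<close>
    have X: "X1 \<in> K_sub (2 * m)" "X2 \<in> K_sub (2 * m)"
    proof -
      have "?t E \<in> K_sub m" by (rule translate_K_sub [OF prods_U_lim_0 [OF E]])
      moreover have "g' \<in> U_lim_0" using g' by (auto simp: U_lim_0_iff)
      ultimately show "X1 \<in> K_sub (2 * m)"
        unfolding X1_def by (intro K U_lim_0_compose U_lim_0_inv) (simp_all add: K_sub_iff)
      show "X2 \<in> K_sub (2 * m)"
        unfolding X2_def using \<Phi> by (intro K) (simp add: small_def)
    qed
    have cX: "blinfun_apply Xi (blinfun_apply y z) = blinfun_apply y (blinfun_apply Xi z)"
      if "y \<in> U_fin_0 (2 * m)" "Xi \<in> K_sub (2 * m)" for y Xi :: "'k op" and z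
      by (rule compose_eq_apply, rule comm [OF that, symmetric])
    have X123: "blinfun_apply X1 (blinfun_apply X2 (blinfun_apply X3 z)) = z" for z
    proof -
      have "X1 o\<^sub>L X2 o\<^sub>L X3 = ?T (inv_op g' o\<^sub>L (?t E o\<^sub>L \<Phi> o\<^sub>L D))"
        by (simp add: X1_def X2_def X3_def translate_compose blinfun_compose_assoc)
      also have "\<dots> = id_blinfun"
        by (simp add: inv_op_compose gi flip: eq)
      finally show ?thesis by (metis blinfun_apply_blinfun_compose id_blinfun.rep_eq id_apply)
    qed
    have th: "blinfun_apply (?t g') (blinfun_apply (?t h) z) = blinfun_apply (?t g) z" for z
    proof -
      have "g' o\<^sub>L h = g" by (rule blinfun_eqI) (simp add: h_def gi)
      then show ?thesis by (metis translate_compose blinfun_apply_blinfun_compose)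
    qed
    have tg: "blinfun_apply (?t g) (blinfun_apply g z) = blinfun_apply g (blinfun_apply (?t g) z)" for z
    proof -
      have "?t g \<in> K_sub m" using g by (intro translate_K_sub) (auto simp: U_lim_0_iff)
      from comm [OF g this, symmetric] show ?thesis by (rule compose_eq_apply)
    qed
    have ti: "blinfun_apply (?t g) (blinfun_apply (?t (inv_op g)) z) = z" for z
      using inv_op_compose(2) [OF gi(1)]
      by (metis translate_compose translate_id blinfun_apply_blinfun_compose id_blinfun.rep_eq id_apply)
    have "?t E' = ?t g' o\<^sub>L X1"
    proof -
      have "?T X = ?t (?t X)" for X :: "'k op"
        by (simp add: translate_translate mult_2)
      then show ?thesis
        by (simp only: E'_def X1_def translate_compose blinfun_compose_assoc)
    qed
    then have "blinfun_apply (?t E' o\<^sub>L \<Phi>' o\<^sub>L D') x =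
        blinfun_apply (?t g') (blinfun_apply X1 (blinfun_apply (?t h) (blinfun_apply X2
          (blinfun_apply g (blinfun_apply (?t (inv_op g)) (blinfun_apply X3 x))))))"
      by (simp add: \<Phi>'_def D'_def X2_def X3_def)
    also have "\<dots> = blinfun_apply g x"
    proof -
      note ig = F [OF U_fin_0_inv [OF g]]
      show ?thesis
        by (simp add: cX [OF F [OF h] X(1)] cX [OF g2 X(1)] cX [OF ig X(1)] cX [OF g2 X(2)]
            cX [OF ig X(2)] X123 th tg ti)
    qed
    finally show "blinfun_apply g x = blinfun_apply (?t E' o\<^sub>L \<Phi>' o\<^sub>L D') x" ..
  qed
  with D' E' \<Phi>' show ?thesis unfolding swindled_def by blast
qed

text \<open>The chain exists because \<open>U_fin_0 m\<close> is connected.\<close>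

lemma swindled_all:
  fixes g :: "'k::lc_scalar op"
  assumes "g \<in> U_fin_0 m"
  shows "swindled m g"
proof (rule connected_induction_simple [OF connected_U_fin_0 [of m], of id_blinfun])
  fix a :: "'k op" assume a: "a \<in> U_fin_0 m"
  show "\<exists>T. openin (top_of_set (U_fin_0 m)) T \<and> a \<in> T \<and> (\<forall>x\<in>T. \<forall>y\<in>T. swindled m x \<longrightarrow> swindled m y)"
  proof (intro exI conjI ballI impI)
    show "openin (top_of_set (U_fin_0 m)) (U_fin_0 m \<inter> ball a (\<delta> / 2))"
      by (simp add: openin_open_Int)
    show "a \<in> U_fin_0 m \<inter> ball a (\<delta> / 2)"
      using a \<delta> by simp
    fix x y assume x: "x \<in> U_fin_0 m \<inter> ball a (\<delta> / 2)" and y: "y \<in> U_fin_0 m \<inter> ball a (\<delta> / 2)"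
      and sw: "swindled m x"
    have "dist y x \<le> \<delta>"
      using x y dist_triangle [of y x a] by (simp add: dist_commute)
    then show "swindled m y"
      using x y sw by (intro swindled_step [of x m y]) (auto simp: dist_norm)
  qed
qed (use assms in \<open>simp_all add: U_fin_0_id swindled_id\<close>)

text \<open>The factors in the decomposition of \<open>g\<close> need not fix the first \<open>n\<close> basis vectors. This is
  repaired by decomposing the translate of \<open>g\<close> by \<open>m \<ge> n\<close> instead, to which \<open>g\<close> is conjugate by an
  element \<open>r\<close> of \<open>K_sub n\<close>.\<close>

lemma K_sub_prods:
  fixes g :: "'k::lc_scalar op"
  assumes g: "g \<in> K_sub n"
  shows "g \<in> prods (K_sub n \<inter> small \<delta>) (2 * N + (1 + 2 * N))"
proof -
  let ?J = "\<lambda>m. swap_gen n m :: 'k op"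
  obtain m0 where "g \<in> U_fin_0 m0" using g by (auto simp: K_sub_iff U_lim_0_iff)
  moreover define m where "m = max n m0"
  ultimately have gm: "g \<in> U_fin_0 m" and nm: "n \<le> m" using U_fin_0_mono [of m0 m] by auto
  note J = rot_gen_swap_gen [where 'k = 'k, of n m]
  define r where "r = rot (?J m) (pi / 2)"
  have "r \<in> U_fin_0 (2 * m)"
    unfolding r_def by (rule rot_U_fin_0 [OF J]) (simp add: swap_gen_basis)
  then have r: "r \<in> K_sub n"
    by (auto simp: K_sub_iff U_lim_0_iff r_def swap_gen_basis intro!: rot_fixes)
  have ri: "isom_op r" using r U_lim_0_unitary K_sub_iff k_unitary_isom by blast
  have gf: "g \<in> U_fin m" using gm U_fin_0_subset by blast
  have rg: "r o\<^sub>L g = translate m g o\<^sub>L r"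
    unfolding r_def by (rule swap_conjugates [OF gf]) (use g in \<open>simp add: K_sub_iff\<close>)
  obtain D E \<Phi> where D: "D \<in> prods (small \<delta>) (2 * N)" and E: "E \<in> prods (small \<delta>) (2 * N)"
    and \<Phi>: "\<Phi> \<in> small \<delta>" and eq: "g = translate m E o\<^sub>L \<Phi> o\<^sub>L D"
    using swindled_all [OF gm] by (auto simp: swindled_def)
  have st: "translate m b \<in> small \<delta>" if "b \<in> small \<delta>" for b :: "'k op"
    using that order_trans [OF norm_translate_le] translate_K_sub [of b m] by (auto simp: small_def K_sub_iff)
  have "translate m E \<in> prods (small \<delta>) (2 * N)"
    by (rule prods_image [OF _ _ st E]) (simp_all add: translate_compose)
  then have gs: "g \<in> prods (small \<delta>) (2 * N + (1 + 2 * N))"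
    unfolding eq blinfun_compose_assoc by (intro prods_append prods_1 D \<Phi>)
  let ?\<phi> = "\<lambda>b. inv_op r o\<^sub>L translate m b o\<^sub>L inv_op (inv_op r)"
  have "?\<phi> g \<in> prods (K_sub n \<inter> small \<delta>) (2 * N + (1 + 2 * N))"
  proof (rule prods_image [OF _ _ _ gs])
    show "?\<phi> id_blinfun = id_blinfun"
      unfolding translate_id by (rule conj_id [OF isom_op_inv [OF ri]])
    show "?\<phi> (a o\<^sub>L b) = ?\<phi> a o\<^sub>L ?\<phi> b" for a b
      unfolding translate_compose by (rule conj_compose [OF isom_op_inv [OF ri]])
    fix b :: "'k op" assume b: "b \<in> small \<delta>"
    have "translate m b \<in> K_sub m" using b by (intro translate_K_sub) (simp add: small_def)
    then have "translate m b \<in> K_sub n" using nm by (auto simp: K_sub_iff)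
    then have "?\<phi> b \<in> K_sub n"
      by (intro K_sub_compose K_sub_inv r)
    moreover have "norm (?\<phi> b - id_blinfun) \<le> \<delta>"
      unfolding norm_conj [OF isom_op_inv [OF ri]] using st [OF b] by (simp add: small_def)
    ultimately show "?\<phi> b \<in> K_sub n \<inter> small \<delta>"
      by (simp add: small_def K_sub_iff)
  qed
  moreover have "?\<phi> g = g"
  proof (rule blinfun_eqI)
    fix x
    have i: "blinfun_apply (inv_op (inv_op r)) x = blinfun_apply r x"
      by (metis inv_op_left inv_op_right isom_op_inv ri)
    have "blinfun_apply (translate m g) (blinfun_apply r x) = blinfun_apply r (blinfun_apply g x)"
      by (rule compose_eq_apply [OF rg [symmetric]])
    then show "blinfun_apply (?\<phi> g) x = blinfun_apply g x"
      by (simp add: i ri)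
  qed
  ultimately show ?thesis by simp
qed

end

lemma bounded_generation:
  assumes "0 < \<delta>"
  shows "\<exists>N. \<forall>n. K_sub n \<subseteq> prods (K_sub n \<inter> (small \<delta> :: 'k::lc_scalar op set)) N"
proof -
  obtain N :: nat where N: "pi / \<delta> < real N"
    using reals_Archimedean2 by blast
  moreover have "0 < pi / \<delta>" using assms by simp
  ultimately have "0 < N" by (metis gr0I less_asym of_nat_0)
  then have "pi / real N \<le> \<delta>"
    using N assms by (simp add: field_simps)
  with K_sub_prods [OF assms \<open>0 < N\<close>] show ?thesis by blast
qed

section \<open>Complex Hilbert spaces\<close>

lemma cinner_add_left: "cinner (x + y) z = cinner x z + cinner y z" for x y z :: "'v::chilbert_space"
  by (metis cinner_add_right cinner_commute complex_cnj_add)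

lemma cinner_minus_right: "cinner x (- y) = - cinner x y" for x y :: "'v::chilbert_space"
proof -
  have "cinner x 0 = 0" using cinner_add_right [of x 0 0] by simp
  then show ?thesis
    using cinner_add_right [of x y "- y"] by (simp add: eq_neg_iff_add_eq_0 add.commute)
qed

text \<open>Together with the same identity for \<open>\<i> y\<close> this recovers the complex inner product from the
  norm.\<close>

lemma norm_add_sq_cinner: "(norm (x + y))\<^sup>2 = (norm x)\<^sup>2 + (norm y)\<^sup>2 + 2 * Re (cinner x y)"
  for x y :: "'v::chilbert_space"
proof -
  have "complex_of_real ((norm (x + y))\<^sup>2) =
      complex_of_real ((norm x)\<^sup>2) + complex_of_real ((norm y)\<^sup>2) + (cinner x y + cnj (cinner x y))"
    unfolding cinner_self [symmetric] cinner_commute [of y x, symmetric]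
    by (simp add: cinner_add_left cinner_add_right)
  also have "cinner x y + cnj (cinner x y) = complex_of_real (2 * Re (cinner x y))"
    by (rule complex_add_cnj)
  finally show ?thesis
    by (metis of_real_add of_real_eq_iff)
qed

lemma parallelogram: "(norm (x + y))\<^sup>2 + (norm (x - y))\<^sup>2 = 2 * (norm x)\<^sup>2 + 2 * (norm y)\<^sup>2"
  for x y :: "'v::chilbert_space"
  using norm_add_sq_cinner [of x y] norm_add_sq_cinner [of x "- y"] by (simp add: cinner_minus_right)

lemma norm_scaleC: "norm (a *\<^sub>C x) = cmod a * norm x" for x :: "'v::chilbert_space"
proof -
  have "cinner (a *\<^sub>C x) (a *\<^sub>C x) = a * (cnj a * cnj (cinner x x))"
    by (metis cinner_commute cinner_scaleC_right complex_cnj_mult)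
  then have "complex_of_real ((norm (a *\<^sub>C x))\<^sup>2) = complex_of_real ((cmod a * norm x)\<^sup>2)"
    by (simp add: cinner_self power_mult_distrib complex_norm_square del: of_real_power)
  then have "(norm (a *\<^sub>C x))\<^sup>2 = (cmod a * norm x)\<^sup>2"
    by (simp only: of_real_eq_iff)
  then show ?thesis by (rule power2_eq_imp_eq) auto
qed

lemma c_unitary_iff: "c_unitary u \<longleftrightarrow>
    (\<forall>a x. blinfun_apply u (a *\<^sub>C x) = a *\<^sub>C blinfun_apply u x) \<and> isom_op u"
  for u :: "'v::chilbert_space \<Rightarrow>\<^sub>L 'v"
proof
  assume u: "c_unitary u"
  have "norm (blinfun_apply u x) = norm x" for x
  proof -
    have "complex_of_real ((norm (blinfun_apply u x))\<^sup>2) = complex_of_real ((norm x)\<^sup>2)"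
      using u unfolding c_unitary_def by (metis cinner_self)
    then have "(norm (blinfun_apply u x))\<^sup>2 = (norm x)\<^sup>2"
      by (simp only: of_real_eq_iff)
    then show ?thesis by (rule power2_eq_imp_eq) auto
  qed
  with u show "(\<forall>a x. blinfun_apply u (a *\<^sub>C x) = a *\<^sub>C blinfun_apply u x) \<and> isom_op u"
    by (simp add: c_unitary_def isom_op_def)
next
  assume u: "(\<forall>a x. blinfun_apply u (a *\<^sub>C x) = a *\<^sub>C blinfun_apply u x) \<and> isom_op u"
  then have n: "norm (blinfun_apply u x) = norm x" for x by (simp add: isom_op_norm)
  have re: "Re (cinner (blinfun_apply u x) (blinfun_apply u y)) = Re (cinner x y)" for x y
    using norm_add_sq_cinner [of "blinfun_apply u x" "blinfun_apply u y"] norm_add_sq_cinner [of x y]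
      n [of "x + y"] by (simp add: n)
  have "Im (cinner (blinfun_apply u x) (blinfun_apply u y)) = Im (cinner x y)" for x y
    using re [of x "\<i> *\<^sub>C y"] u by (simp add: cinner_scaleC_right)
  with re u show "c_unitary u"
    by (simp add: c_unitary_def isom_op_def complex_eq_iff)
qed

text \<open>By the parallelogram law two almost shortest vectors of a convex set are close to each other.\<close>

lemma midpoint_min_norm:
  fixes x y :: "'v::chilbert_space"
  assumes C: "convex C" "x \<in> C" "y \<in> C" and d: "\<And>c. c \<in> C \<Longrightarrow> d \<le> (norm c)\<^sup>2"
  shows "(norm (x - y))\<^sup>2 \<le> 2 * (norm x)\<^sup>2 + 2 * (norm y)\<^sup>2 - 4 * d"
proof -
  have "(1 / 2) *\<^sub>R x + (1 / 2) *\<^sub>R y \<in> C"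
    using C by (intro convexD) auto
  from d [OF this] have "d \<le> (norm ((1 / 2) *\<^sub>R (x + y)))\<^sup>2"
    by (simp only: scaleR_add_right)
  also have "\<dots> = (norm (x + y))\<^sup>2 / 4"
    by (simp add: power_divide)
  finally show ?thesis using parallelogram [of x y] by simp
qed

lemma min_norm_exists:
  fixes C :: "'v::chilbert_space set"
  assumes C: "closed C" "convex C" "C \<noteq> {}"
  shows "\<exists>z\<in>C. \<forall>c\<in>C. norm z \<le> norm c"
proof -
  define d where "d = (INF c\<in>C. (norm c)\<^sup>2)"
  have d: "d \<le> (norm c)\<^sup>2" if "c \<in> C" for c
    unfolding d_def using that by (intro cINF_lower bdd_belowI2 [of _ 0]) auto
  have "\<exists>c\<in>C. (norm c)\<^sup>2 < d + 1 / real (Suc n)" for n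
  proof -
    have "(INF c\<in>C. (norm c)\<^sup>2) < d + 1 / real (Suc n)"
      unfolding d_def by simp
    then show ?thesis
      using C(3) cInf_lessD [of "(\<lambda>c. (norm c)\<^sup>2) ` C"] by blast
  qed
  then obtain x where x: "\<And>n. x n \<in> C" "\<And>n. (norm (x n))\<^sup>2 < d + 1 / real (Suc n)"
    by metis
  have xd: "(norm (x m - x n))\<^sup>2 \<le> 4 / real (Suc k)" if "k \<le> m" "k \<le> n" for k m n
  proof -
    have "1 / real (Suc m) \<le> 1 / real (Suc k)" "1 / real (Suc n) \<le> 1 / real (Suc k)"
      using that by (intro divide_left_mono; simp)+
    then show ?thesis
      using midpoint_min_norm [OF C(2) x(1) x(1) d, of m n] x(2) [of m] x(2) [of n] by simp
  qed
  have "Cauchy x"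
  proof (rule metric_CauchyI)
    fix e :: real assume e: "0 < e"
    obtain k :: nat where k: "4 / e\<^sup>2 < real k" using reals_Archimedean2 by blast
    then have "4 / e\<^sup>2 < real (Suc k)" by simp
    then have k': "4 / real (Suc k) < e\<^sup>2"
      using e by (simp add: field_simps)
    show "\<exists>M. \<forall>m\<ge>M. \<forall>n\<ge>M. dist (x m) (x n) < e"
    proof (intro exI allI impI)
      fix m n assume "k \<le> m" "k \<le> n"
      then have "(norm (x m - x n))\<^sup>2 < e\<^sup>2"
        using xd k' by (meson order_le_less_trans)
      then show "dist (x m) (x n) < e"
        using e by (simp add: dist_norm power2_less_imp_less)
    qed
  qed
  then obtain z where z: "x \<longlonglongrightarrow> z"
    using Cauchy_convergent_iff convergent_def by blast
  have zC: "z \<in> C"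
    using closed_sequentially [OF C(1) x(1) z] .
  have "(\<lambda>n. d + 1 / real (Suc n)) \<longlonglongrightarrow> d + 0"
    by (intro tendsto_add tendsto_const LIMSEQ_Suc [OF lim_1_over_n])
  moreover have "(\<lambda>n. (norm (x n))\<^sup>2) \<longlonglongrightarrow> (norm z)\<^sup>2"
    by (intro tendsto_intros z)
  ultimately have zd: "(norm z)\<^sup>2 \<le> d + 0"
  proof -
    assume lim: "(\<lambda>n. d + 1 / real (Suc n)) \<longlonglongrightarrow> d + 0" "(\<lambda>n. (norm (x n))\<^sup>2) \<longlonglongrightarrow> (norm z)\<^sup>2"
    have "\<exists>N. \<forall>n\<ge>N. (norm (x n))\<^sup>2 \<le> d + 1 / real (Suc n)"
      by (intro exI allI impI) (rule less_imp_le [OF x(2)])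
    then show "(norm z)\<^sup>2 \<le> d + 0"
      by (rule LIMSEQ_le [OF lim(2,1)])
  qed
  show ?thesis
  proof (intro bexI ballI)
    show "norm z \<le> norm c" if "c \<in> C" for c
    proof -
      have "(norm z)\<^sup>2 \<le> (norm c)\<^sup>2" using d [OF that] zd by linarith
      then show ?thesis by (rule power2_le_imp_le) simp
    qed
  qed (fact zC)
qed

lemma min_norm_unique:
  fixes C :: "'v::chilbert_space set"
  assumes C: "convex C" and z: "z \<in> C" "\<And>c. c \<in> C \<Longrightarrow> norm z \<le> norm c"
    and y: "y \<in> C" "norm y \<le> norm z"
  shows "y = z"
proof -
  have "(norm (y - z))\<^sup>2 \<le> 2 * (norm y)\<^sup>2 + 2 * (norm z)\<^sup>2 - 4 * (norm z)\<^sup>2"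
    by (rule midpoint_min_norm [OF C y(1) z(1)]) (use z(2) in \<open>simp add: power_mono\<close>)
  also have "\<dots> \<le> 0" using y(2) power_mono [OF y(2), of 2] by simp
  finally show ?thesis by simp
qed

section \<open>Representations\<close>

definition unirep :: "('k::rch_scalar op \<Rightarrow> 'v::chilbert_space \<Rightarrow>\<^sub>L 'v) \<Rightarrow> bool" where
  "unirep \<pi> \<longleftrightarrow> (\<forall>g\<in>U_lim_0. c_unitary (\<pi> g)) \<and>
     (\<forall>g\<in>U_lim_0. \<forall>h\<in>U_lim_0. \<pi> (g o\<^sub>L h) = \<pi> g o\<^sub>L \<pi> h)"

definition norm_continuous :: "('k::rch_scalar op \<Rightarrow> 'v::chilbert_space \<Rightarrow>\<^sub>L 'v) \<Rightarrow> bool" where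
  "norm_continuous \<pi> \<longleftrightarrow> (\<forall>v. \<forall>\<epsilon>>0. \<exists>\<delta>>0. \<forall>g\<in>U_lim_0. norm (g - id_blinfun) < \<delta> \<longrightarrow>
     norm (blinfun_apply (\<pi> g) v - v) < \<epsilon>)"

context
  fixes \<pi> :: "'k::lc_scalar op \<Rightarrow> 'v::chilbert_space \<Rightarrow>\<^sub>L 'v"
  assumes \<pi>: "unirep \<pi>"
begin

lemma unirep_isom: "g \<in> U_lim_0 \<Longrightarrow> isom_op (\<pi> g)"
  using \<pi> by (simp add: unirep_def c_unitary_iff)

lemma unirep_norm: "g \<in> U_lim_0 \<Longrightarrow> norm (blinfun_apply (\<pi> g) v) = norm v"
  by (simp add: unirep_isom isom_op_norm)

lemma unirep_compose: "g \<in> U_lim_0 \<Longrightarrow> h \<in> U_lim_0 \<Longrightarrow>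
    blinfun_apply (\<pi> (g o\<^sub>L h)) v = blinfun_apply (\<pi> g) (blinfun_apply (\<pi> h) v)"
  using \<pi> by (simp add: unirep_def)

lemma unirep_id: "blinfun_apply (\<pi> id_blinfun) v = v"
proof -
  have "blinfun_apply (\<pi> id_blinfun) (blinfun_apply (\<pi> id_blinfun) v) = blinfun_apply (\<pi> id_blinfun) v"
    using unirep_compose [OF U_lim_0_id U_lim_0_id, of v] by simp
  then show ?thesis
    using inv_op_left [OF unirep_isom [OF U_lim_0_id]] by metis
qed

lemma unirep_prods:
  assumes A: "A \<subseteq> U_lim_0" and le: "\<And>b. b \<in> A \<Longrightarrow> norm (blinfun_apply (\<pi> b) w - w) \<le> \<eta>"
  shows "g \<in> prods A N \<Longrightarrow> g \<in> U_lim_0 \<and> norm (blinfun_apply (\<pi> g) w - w) \<le> real N * \<eta>"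
proof (induction N arbitrary: g)
  case 0
  then show ?case by (simp add: U_lim_0_id unirep_id)
next
  case (Suc N)
  then obtain a b where g: "g = a o\<^sub>L b" and a: "a \<in> A" and b: "b \<in> prods A N" by auto
  note IH = Suc.IH [OF b]
  have al: "a \<in> U_lim_0" using a A by blast
  have "blinfun_apply (\<pi> g) w - w =
      blinfun_apply (\<pi> a) (blinfun_apply (\<pi> b) w - w) + (blinfun_apply (\<pi> a) w - w)"
    using IH al by (simp add: g unirep_compose)
  then have "norm (blinfun_apply (\<pi> g) w - w) \<le>
      norm (blinfun_apply (\<pi> a) (blinfun_apply (\<pi> b) w - w)) + norm (blinfun_apply (\<pi> a) w - w)"
    by (simp only: norm_triangle_ineq)
  also have "\<dots> \<le> real N * \<eta> + \<eta>"
    unfolding unirep_norm [OF al] using IH le [OF a] by (intro add_mono) auto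
  finally show ?case
    using IH al by (simp add: g U_lim_0_compose algebra_simps)
qed

text \<open>The vector \<open>w\<close> is an almost shortest element of the union of the convex sets \<open>W M\<close>. If \<open>b\<close> acts
  on the coordinates from \<open>M\<close> onwards, then \<open>b p\<close> is as close to the identity as \<open>b\<close> and \<open>p\<close> are, so
  \<open>\<pi> b w\<close> belongs to the same union. Having the same norm as \<open>w\<close>, it must be close to \<open>w\<close>.\<close>

lemma almost_fixed_by_small:
  assumes v: "\<And>p. p \<in> small \<delta> \<Longrightarrow> norm (blinfun_apply (\<pi> p) v - v) \<le> \<epsilon>"
    and \<delta>: "0 < \<delta>" and \<eta>: "0 < \<eta>"
  shows "\<exists>w M. norm (w - v) \<le> \<epsilon> \<and> (\<forall>b\<in>K_sub M \<inter> small \<delta>. norm (blinfun_apply (\<pi> b) w - w) \<le> \<eta>)"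
proof -
  define S where "S M = U_fin_0 M \<inter> (small \<delta> :: 'k op set)" for M
  define W where "W M = convex hull ((\<lambda>p. blinfun_apply (\<pi> p) v) ` S M)" for M
  define d where "d = (INF c\<in>(\<Union>M. W M). (norm c)\<^sup>2)"
  have d: "d \<le> (norm c)\<^sup>2" if "c \<in> W M" for c M
    unfolding d_def using that by (intro cINF_lower bdd_belowI2 [of _ 0]) auto
  have "id_blinfun \<in> S 0"
    using \<delta> by (simp add: S_def small_def U_fin_0_id U_lim_0_id)
  then have "(\<Union>M. W M) \<noteq> {}"
    unfolding W_def by (metis UN_I UNIV_I empty_iff hull_inc image_eqI)
  moreover have "d < d + \<eta>\<^sup>2 / 4" using \<eta> by simp
  ultimately obtain w M where w: "w \<in> W M" and wd: "(norm w)\<^sup>2 < d + \<eta>\<^sup>2 / 4"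
    using cInf_lessD [of "(\<lambda>c. (norm c)\<^sup>2) ` (\<Union>M. W M)" "d + \<eta>\<^sup>2 / 4"] unfolding d_def by auto
  have "W M \<subseteq> cball v \<epsilon>"
    unfolding W_def
  proof (rule hull_minimal)
    show "(\<lambda>p. blinfun_apply (\<pi> p) v) ` S M \<subseteq> cball v \<epsilon>"
      using v by (auto simp: S_def dist_norm norm_minus_commute)
  qed (rule convex_cball)
  with w have wv: "norm (w - v) \<le> \<epsilon>"
    by (auto simp: dist_norm norm_minus_commute)
  have "norm (blinfun_apply (\<pi> b) w - w) \<le> \<eta>" if b: "b \<in> K_sub M \<inter> small \<delta>" for b
  proof -
    have bl: "b \<in> U_lim_0" using b by (simp add: small_def)
    then obtain M0 where M0: "b \<in> U_fin_0 M0" by (auto simp: U_lim_0_iff)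
    define M' where "M' = max M M0"
    have M': "U_fin_0 M \<subseteq> (U_fin_0 M' :: 'k op set)" "b \<in> U_fin_0 M'"
      using M0 U_fin_0_mono [of M M'] U_fin_0_mono [of M0 M'] by (auto simp: M'_def)
    have "W M \<subseteq> W M'"
      unfolding W_def S_def using M'(1) by (intro hull_mono) blast
    with w have w': "w \<in> W M'" by blast
    have bS: "b o\<^sub>L p \<in> S M'" if p: "p \<in> S M" for p
    proof -
      have p1: "p \<in> U_fin_0 M" "p \<in> U_lim_0" "norm (p - id_blinfun) \<le> \<delta>"
        using p by (auto simp: S_def small_def)
      have "norm ((p o\<^sub>L b) - id_blinfun) \<le> \<delta>" and c: "p o\<^sub>L b = b o\<^sub>L p"
        using U_fin_0D [OF p1(1)] K_subD [of b M] b p1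
        by (auto intro!: norm_disjoint_le [of p M b] disjoint_commute [of p M b] simp: small_def)
      then show ?thesis
        using M' p1 bl by (auto simp: S_def small_def intro!: U_fin_0_compose U_lim_0_compose)
    qed
    have "blinfun_apply (\<pi> b) ` W M = convex hull (blinfun_apply (\<pi> b) ` (\<lambda>p. blinfun_apply (\<pi> p) v) ` S M)"
      unfolding W_def
      by (rule convex_hull_linear_image) (simp add: blinfun.bounded_linear_right bounded_linear.linear)
    also have "\<dots> \<subseteq> W M'"
      unfolding W_def
    proof (intro hull_mono subsetI)
      fix y assume "y \<in> blinfun_apply (\<pi> b) ` (\<lambda>p. blinfun_apply (\<pi> p) v) ` S M"
      then obtain p where p: "p \<in> S M" and y: "y = blinfun_apply (\<pi> b) (blinfun_apply (\<pi> p) v)" by auto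
      have "p \<in> U_lim_0" using p by (simp add: S_def small_def)
      then have "y = blinfun_apply (\<pi> (b o\<^sub>L p)) v"
        by (simp add: y unirep_compose bl)
      with bS [OF p] show "y \<in> (\<lambda>p. blinfun_apply (\<pi> p) v) ` S M'" by blast
    qed
    finally have bw: "blinfun_apply (\<pi> b) w \<in> W M'" using w by blast
    have "convex (W M')" unfolding W_def by (rule convex_convex_hull)
    from midpoint_min_norm [OF this bw w' d [where M = M']]
    have "(norm (blinfun_apply (\<pi> b) w - w))\<^sup>2 \<le> \<eta>\<^sup>2"
      using wd by (simp add: unirep_norm [OF bl])
    then show ?thesis by (rule power2_le_imp_le) (use \<eta> in simp)
  qed
  with wv show ?thesis by blast
qed

text \<open>The closed convex hull of the orbit of \<open>w\<close> is invariant, so its unique shortest element is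
  fixed.\<close>

lemma fixed_near_almost_fixed:
  assumes w: "\<And>g. g \<in> K_sub M \<Longrightarrow> norm (blinfun_apply (\<pi> g) w - w) \<le> \<epsilon>"
  shows "\<exists>z\<in>fixed_vectors (K_sub M) \<pi>. norm (z - w) \<le> \<epsilon>"
proof -
  define C where "C = closure (convex hull ((\<lambda>g. blinfun_apply (\<pi> g) w) ` K_sub M))"
  have cC: "convex C" unfolding C_def by (intro convex_closure convex_convex_hull)
  have "C \<noteq> {}" unfolding C_def using K_sub_id by auto
  then obtain z where z: "z \<in> C" "\<And>c. c \<in> C \<Longrightarrow> norm z \<le> norm c"
    using min_norm_exists [of C] cC unfolding C_def by auto
  have "C \<subseteq> cball w \<epsilon>"
    unfolding C_def
  proof (intro closure_minimal hull_minimal)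
    show "(\<lambda>g. blinfun_apply (\<pi> g) w) ` K_sub M \<subseteq> cball w \<epsilon>"
      using w by (auto simp: dist_norm norm_minus_commute)
  qed auto
  with z have zw: "norm (z - w) \<le> \<epsilon>"
    by (auto simp: dist_norm norm_minus_commute)
  have "blinfun_apply (\<pi> h) z = z" if h: "h \<in> K_sub M" for h
  proof -
    have hl: "h \<in> U_lim_0" using h by (simp add: K_sub_iff)
    have "blinfun_apply (\<pi> h) ` C \<subseteq> C"
      unfolding C_def
    proof (rule image_closure_subset)
      have "blinfun_apply (\<pi> h) ` (convex hull ((\<lambda>g. blinfun_apply (\<pi> g) w) ` K_sub M)) =
          convex hull (blinfun_apply (\<pi> h) ` (\<lambda>g. blinfun_apply (\<pi> g) w) ` K_sub M)"
        by (rule convex_hull_linear_image) (simp add: blinfun.bounded_linear_right bounded_linear.linear)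
      also have "\<dots> \<subseteq> convex hull ((\<lambda>g. blinfun_apply (\<pi> g) w) ` K_sub M)"
      proof (intro hull_mono subsetI)
        fix y assume "y \<in> blinfun_apply (\<pi> h) ` (\<lambda>g. blinfun_apply (\<pi> g) w) ` K_sub M"
        then obtain g where g: "g \<in> K_sub M" and y: "y = blinfun_apply (\<pi> h) (blinfun_apply (\<pi> g) w)" by auto
        have "y = blinfun_apply (\<pi> (h o\<^sub>L g)) w"
          using g hl by (simp add: y unirep_compose K_sub_iff)
        with K_sub_compose [OF h g] show "y \<in> (\<lambda>g. blinfun_apply (\<pi> g) w) ` K_sub M" by blast
      qed
      finally show "blinfun_apply (\<pi> h) ` (convex hull ((\<lambda>g. blinfun_apply (\<pi> g) w) ` K_sub M)) \<subseteq>
          closure (convex hull ((\<lambda>g. blinfun_apply (\<pi> g) w) ` K_sub M))"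
        using closure_subset by blast
    qed (auto intro!: continuous_intros)
    then show ?thesis
      using z by (intro min_norm_unique [OF cC z(1)]) (auto simp: unirep_norm [OF hl])
  qed
  then have "z \<in> fixed_vectors (K_sub M) \<pi>" by (simp add: fixed_vectors_def)
  with zw show ?thesis by blast
qed

lemma norm_continuous_imp_tame:
  assumes "norm_continuous \<pi>"
  shows "tame \<pi>"
proof -
  have "\<exists>z\<in>(\<Union>n. fixed_vectors (K_sub n) \<pi>). dist z v < \<epsilon>" if \<epsilon>: "0 < \<epsilon>" for v \<epsilon>
  proof -
    obtain \<delta>' where \<delta>': "0 < \<delta>'"
      "\<And>g. g \<in> U_lim_0 \<Longrightarrow> norm (g - id_blinfun) < \<delta>' \<Longrightarrow> norm (blinfun_apply (\<pi> g) v - v) < \<epsilon> / 3"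
      using assms \<epsilon> unfolding norm_continuous_def by (metis zero_less_divide_iff zero_less_numeral)
    define \<delta> where "\<delta> = \<delta>' / 2"
    have \<delta>: "0 < \<delta>" using \<delta>' by (simp add: \<delta>_def)
    have v: "norm (blinfun_apply (\<pi> p) v - v) \<le> \<epsilon> / 3" if "p \<in> small \<delta>" for p
      using \<delta>' that by (intro less_imp_le \<delta>'(2)) (auto simp: small_def \<delta>_def)
    obtain N where N: "\<And>n. K_sub n \<subseteq> prods (K_sub n \<inter> (small \<delta> :: 'k op set)) N"
      using bounded_generation [OF \<delta>] by blast
    \<comment> \<open>\<open>N\<close> is known before \<open>w\<close> is chosen, so \<open>w\<close> can be almost fixed up to an error that survives
      \<open>N\<close> factors.\<close>
    define \<eta> where "\<eta> = \<epsilon> / 3 / (real N + 1)"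
    have \<eta>: "0 < \<eta>" using \<epsilon> by (simp add: \<eta>_def)
    obtain w M where wv: "norm (w - v) \<le> \<epsilon> / 3"
      and w: "\<And>b. b \<in> K_sub M \<inter> small \<delta> \<Longrightarrow> norm (blinfun_apply (\<pi> b) w - w) \<le> \<eta>"
      using almost_fixed_by_small [OF v \<delta> \<eta>] by blast
    have "norm (blinfun_apply (\<pi> g) w - w) \<le> real N * \<eta>" if "g \<in> K_sub M" for g
    proof -
      have "K_sub M \<inter> small \<delta> \<subseteq> U_lim_0" by (auto simp: small_def)
      then show ?thesis
        using unirep_prods [OF _ w] N [of M] that by blast
    qed
    then obtain z where z: "z \<in> fixed_vectors (K_sub M) \<pi>" "norm (z - w) \<le> real N * \<eta>"
      using fixed_near_almost_fixed by blast
    have "real N * \<eta> < \<epsilon> / 3"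
      using \<epsilon> by (simp add: \<eta>_def field_simps)
    then have "dist z v < \<epsilon>"
      using z(2) wv \<epsilon> norm_triangle_ineq [of "z - w" "w - v"] by (simp add: dist_norm)
    with z(1) show ?thesis by blast
  qed
  then show ?thesis
    unfolding tame_def by (auto simp: closure_approachable)
qed

text \<open>A vector \<open>u\<close> near \<open>v\<close> that is fixed by \<open>K_sub n\<close> is moved by \<open>g\<close> as far as by an element \<open>h\<close> of
  \<open>U_fin_0 (3 n)\<close> that is close to the identity if \<open>g\<close> is.\<close>

lemma tame_imp_norm_continuous:
  assumes cont: "\<And>n v. continuous_on (U_fin_0 n) (\<lambda>g. blinfun_apply (\<pi> g) v)" and tame: "tame \<pi>"
  shows "norm_continuous \<pi>"
  unfolding norm_continuous_def
proof (intro allI impI)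
  fix v and \<epsilon> :: real assume \<epsilon>: "0 < \<epsilon>"
  have "v \<in> closure (\<Union>n. fixed_vectors (K_sub n) \<pi>)"
    using tame by (simp add: tame_def)
  then obtain u n where u: "u \<in> fixed_vectors (K_sub n) \<pi>" and uv: "norm (u - v) < \<epsilon> / 3"
    using \<epsilon> by (metis UN_E closure_approachable dist_norm zero_less_divide_iff zero_less_numeral)
  have uf: "blinfun_apply (\<pi> k) u = u" if "k \<in> K_sub n" for k
    using u that by (simp add: fixed_vectors_def)
  obtain \<delta> where \<delta>: "0 < \<delta>" and \<delta>u: "\<And>h. h \<in> U_fin_0 (3 * n) \<Longrightarrow> norm (h - id_blinfun) < \<delta> \<Longrightarrow>
      norm (blinfun_apply (\<pi> h) u - u) < \<epsilon> / 3"
  proof -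
    have "\<exists>d>0. \<forall>h\<in>U_fin_0 (3 * n). dist h id_blinfun < d \<longrightarrow>
        dist (blinfun_apply (\<pi> h) u) (blinfun_apply (\<pi> id_blinfun) u) < \<epsilon> / 3"
      using cont [of "3 * n" u] \<epsilon> U_fin_0_id unfolding continuous_on_iff
      by (metis zero_less_divide_iff zero_less_numeral)
    then show ?thesis
      using that by (auto simp: dist_norm unirep_id)
  qed
  show "\<exists>\<delta>>0. \<forall>g\<in>U_lim_0. norm (g - id_blinfun) < \<delta> \<longrightarrow> norm (blinfun_apply (\<pi> g) v - v) < \<epsilon>"
  proof (intro exI conjI ballI impI)
    show "0 < \<delta> / 7 ^ n" using \<delta> by simp
    fix g :: "'k op" assume g: "g \<in> U_lim_0" and gn: "norm (g - id_blinfun) < \<delta> / 7 ^ n"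
    obtain k h s where k: "k \<in> K_sub n" and h: "h \<in> U_fin_0 (3 * n)" and s: "s \<in> K_sub n"
      and eq: "k o\<^sub>L g = h o\<^sub>L s o\<^sub>L k" and hn: "norm (h - id_blinfun) \<le> 7 ^ n * norm (g - id_blinfun)"
      using double_coset_form [OF g, of n] by blast
    have hd: "norm (h - id_blinfun) < \<delta>"
      using hn gn by (simp add: field_simps)
    have l: "k \<in> U_lim_0" "h \<in> U_lim_0" "s \<in> U_lim_0"
      using k h s by (auto simp: K_sub_iff U_lim_0_iff)
    have "blinfun_apply (\<pi> k) (blinfun_apply (\<pi> g) u) = blinfun_apply (\<pi> (k o\<^sub>L g)) u"
      by (simp add: unirep_compose l g)
    also have "\<dots> = blinfun_apply (\<pi> h) u"
      unfolding eq by (simp add: unirep_compose l U_lim_0_compose uf k s)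
    finally have "blinfun_apply (\<pi> k) (blinfun_apply (\<pi> g) u - u) = blinfun_apply (\<pi> h) u - u"
      by (simp add: uf k)
    then have gu: "norm (blinfun_apply (\<pi> g) u - u) < \<epsilon> / 3"
      using \<delta>u [OF h hd] unirep_norm [OF l(1), of "blinfun_apply (\<pi> g) u - u"] by simp
    have "blinfun_apply (\<pi> g) v - v =
        blinfun_apply (\<pi> g) (v - u) + ((blinfun_apply (\<pi> g) u - u) + (u - v))"
      by simp
    then have "norm (blinfun_apply (\<pi> g) v - v) =
        norm (blinfun_apply (\<pi> g) (v - u) + ((blinfun_apply (\<pi> g) u - u) + (u - v)))"
      by (rule arg_cong)
    also have "\<dots> \<le> norm (blinfun_apply (\<pi> g) (v - u)) + (norm (blinfun_apply (\<pi> g) u - u) + norm (u - v))"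
      by (intro norm_triangle_le add_left_mono norm_triangle_ineq)
    also have "\<dots> < \<epsilon>"
      unfolding unirep_norm [OF g] using gu uv by (simp add: norm_minus_commute)
    finally show "norm (blinfun_apply (\<pi> g) v - v) < \<epsilon>" .
  qed
qed

end

section \<open>Compact operators\<close>

lemma compact_operator_iff: "compact_operator T \<longleftrightarrow> (\<exists>C. compact C \<and> blinfun_apply T ` cball 0 1 \<subseteq> C)"
proof
  assume "compact_operator T"
  then have "compact (closure (blinfun_apply T ` cball 0 1))"
    by (simp add: compact_operator_def)
  then show "\<exists>C. compact C \<and> blinfun_apply T ` cball 0 1 \<subseteq> C"
    by (intro exI [of _ "closure (blinfun_apply T ` cball 0 1)"] conjI Elementary_Topology.closure_subset)
next
  assume "\<exists>C. compact C \<and> blinfun_apply T ` cball 0 1 \<subseteq> C"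
  then obtain C where C: "compact C" "blinfun_apply T ` cball 0 1 \<subseteq> C" by blast
  show "compact_operator T"
    unfolding compact_operator_def
  proof (intro allI impI)
    fix B :: "'a set" assume "bounded B"
    then obtain r where r: "0 < r" "\<And>x. x \<in> B \<Longrightarrow> norm x \<le> r"
      using bounded_pos by blast
    let ?C = "(\<lambda>y. r *\<^sub>R y) ` C"
    have cC: "compact ?C" using C(1) by (rule compact_scaling)
    have "blinfun_apply T ` B \<subseteq> ?C"
    proof (clarify)
      fix x assume "x \<in> B"
      then have "(1 / r) *\<^sub>R x \<in> cball 0 1" using r by (simp add: field_simps)
      then have "blinfun_apply T ((1 / r) *\<^sub>R x) \<in> C" using C(2) by blast
      moreover have "blinfun_apply T x = r *\<^sub>R blinfun_apply T ((1 / r) *\<^sub>R x)" using r by simp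
      ultimately show "blinfun_apply T x \<in> ?C" by blast
    qed
    then have "closure (blinfun_apply T ` B) \<subseteq> ?C"
      using compact_imp_closed [OF cC] by (rule closure_minimal)
    then have "closure (blinfun_apply T ` B) = ?C \<inter> closure (blinfun_apply T ` B)" by blast
    then show "compact (closure (blinfun_apply T ` B))"
      using compact_Int_closed [OF cC closed_closure] by metis
  qed
qed

lemma compact_operator_add:
  assumes "compact_operator S" "compact_operator T"
  shows "compact_operator (S + T)"
proof -
  obtain C D where "compact C" "blinfun_apply S ` cball 0 1 \<subseteq> C" "compact D" "blinfun_apply T ` cball 0 1 \<subseteq> D"
    using assms unfolding compact_operator_iff by blast
  note C = this
  have "compact {x + y | x y. x \<in> C \<and> y \<in> D}"
    by (rule compact_sums [OF C(1,3)])
  moreover have "blinfun_apply (S + T) ` cball 0 1 \<subseteq> {x + y | x y. x \<in> C \<and> y \<in> D}"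
  proof (rule image_subsetI)
    fix x :: 'a assume "x \<in> cball 0 1"
    then have "blinfun_apply S x \<in> C" "blinfun_apply T x \<in> D" using C(2,4) by blast+
    then show "blinfun_apply (S + T) x \<in> {x + y | x y. x \<in> C \<and> y \<in> D}" by auto
  qed
  ultimately show ?thesis
    unfolding compact_operator_iff by blast
qed

lemma compact_operator_compose_left:
  assumes "compact_operator T"
  shows "compact_operator (A o\<^sub>L T)"
proof -
  obtain C where "compact C" "blinfun_apply T ` cball 0 1 \<subseteq> C"
    using assms unfolding compact_operator_iff by blast
  then show ?thesis
    unfolding compact_operator_iff
    by (intro exI [of _ "blinfun_apply A ` C"]) (auto intro!: compact_continuous_image continuous_intros)
qed

lemma compact_operator_compose_right:
  assumes "compact_operator T"
  shows "compact_operator (T o\<^sub>L A)"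
proof -
  have "bounded (blinfun_apply A ` B)" if "bounded B" for B
    by (rule bounded_linear_image [OF that blinfun.bounded_linear_right])
  moreover have "blinfun_apply (T o\<^sub>L A) ` B = blinfun_apply T ` (blinfun_apply A ` B)" for B
    by (simp add: image_image)
  ultimately show ?thesis
    using assms unfolding compact_operator_def by simp
qed

lemma compact_operator_scaleR:
  assumes "compact_operator T"
  shows "compact_operator (r *\<^sub>R T)"
proof -
  have "r *\<^sub>R T = (r *\<^sub>R id_blinfun) o\<^sub>L T" by (rule blinfun_eqI) simp
  then show ?thesis using compact_operator_compose_left [OF assms] by metis
qed

text \<open>Adding one coordinate adds the continuous image of a ball of scalars, which is compact.\<close>

lemma compact_bounded_span_first:
  "\<exists>C. compact C \<and> {x :: 'k::lc_scalar ell2. x \<in> span_first n \<and> norm x \<le> r} \<subseteq> C"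
proof -
  have "\<exists>C. compact C \<and> {x :: 'k ell2. x \<in> span_first n \<and> (\<forall>j. norm (coord x j) \<le> r)} \<subseteq> C"
  proof (induction n)
    case 0
    have "{x :: 'k ell2. x \<in> span_first 0 \<and> (\<forall>j. norm (coord x j) \<le> r)} \<subseteq> {0}"
      by (auto simp: span_first_iff intro: ell2_eqI)
    then show ?case by (intro exI [of _ "{0}"]) simp
  next
    case (Suc n)
    then obtain C where C: "compact C"
      "{x :: 'k ell2. x \<in> span_first n \<and> (\<forall>j. norm (coord x j) \<le> r)} \<subseteq> C" by blast
    have "bounded_linear (\<lambda>c. (basis_vec n :: 'k ell2) \<cdot>\<^sub>K c)"
      by (rule bounded_linear_intro [where K = 1]) (simp_all add: norm_scaleK)
    then have D: "compact ((\<lambda>c. (basis_vec n :: 'k ell2) \<cdot>\<^sub>K c) ` cball 0 r)" (is "compact ?D")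
      by (intro compact_continuous_image linear_continuous_on) auto
    have "x \<in> {x + y | x y. x \<in> C \<and> y \<in> ?D}"
      if x: "x \<in> span_first (Suc n)" "\<And>j. norm (coord x j) \<le> r" for x
    proof -
      have "norm (coord x 0) \<le> r" using x(2) .
      then have r: "0 \<le> r" using norm_ge_zero order_trans by blast
      have "mask {..<n} x \<in> C"
        using x r by (intro subsetD [OF C(2)]) (auto simp: span_first_iff)
      moreover have "basis_vec n \<cdot>\<^sub>K coord x n \<in> ?D" using x(2) by simp
      moreover have "x = mask {..<n} x + basis_vec n \<cdot>\<^sub>K coord x n"
        using x(1) by (intro ell2_eqI) (auto simp: span_first_iff)
      ultimately show ?thesis by blast
    qed
    with compact_sums [OF C(1) D] show ?case by blast
  qed
  then obtain C where "compact C" "{x :: 'k ell2. x \<in> span_first n \<and> (\<forall>j. norm (coord x j) \<le> r)} \<subseteq> C"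
    by blast
  then show ?thesis
    by (intro exI [of _ C]) (auto dest!: subsetD intro: order_trans [OF norm_coord_le])
qed

lemma U_fin_subset_U_infty: "U_fin n \<subseteq> (U_infty :: 'k::lc_scalar op set)"
proof
  fix g :: "'k op" assume g: "g \<in> U_fin n"
  then have gu: "k_unitary g" by (simp add: U_fin_iff)
  obtain C where C: "compact C" "{x :: 'k ell2. x \<in> span_first n \<and> norm x \<le> norm (g - id_blinfun)} \<subseteq> C"
    using compact_bounded_span_first by blast
  have "blinfun_apply (g - id_blinfun) x \<in> C" if x: "x \<in> cball 0 1" for x
  proof (rule subsetD [OF C(2)], intro CollectI conjI)
    show "blinfun_apply (g - id_blinfun) x \<in> span_first n"
      using g k_unitary_coord_fixed [OF gu] by (auto simp: span_first_iff U_fin_iff)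
    have "norm (g - id_blinfun) * norm x \<le> norm (g - id_blinfun) * 1"
      using x by (intro mult_left_mono) auto
    then show "norm (blinfun_apply (g - id_blinfun) x) \<le> norm (g - id_blinfun)"
      using norm_blinfun [of "g - id_blinfun" x] by linarith
  qed
  then have "compact_operator (g - id_blinfun)"
    unfolding compact_operator_iff using C(1) by blast
  with gu show "g \<in> U_infty" by (simp add: U_infty_def)
qed

lemma U_lim_0_subset_U_infty_0: "U_lim_0 \<subseteq> (U_infty_0 :: 'k::lc_scalar op set)"
proof -
  have "U_fin_0 n \<subseteq> (U_infty_0 :: 'k op set)" for n
    unfolding U_infty_0_def
    by (rule connected_component_maximal)
      (use U_fin_0_id connected_U_fin_0 U_fin_0_subset U_fin_subset_U_infty in blast)+
  then show ?thesis unfolding U_lim_0_def by (rule UN_least)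
qed

section \<open>Inverting compact perturbations of the identity\<close>

lemma diff_apply_lower_bound:
  fixes X :: "'a::real_normed_vector \<Rightarrow>\<^sub>L 'a"
  shows "(1 - norm X) * norm z \<le> norm (z - blinfun_apply X z)"
  using norm_blinfun [of X z] norm_triangle_ineq2 [of z "blinfun_apply X z"] by (simp add: algebra_simps)

text \<open>The Picard iterates of \<open>z = y + X z\<close> form a Cauchy sequence. Their images under \<open>X\<close> stay in a
  compact set, which supplies the limit.\<close>

lemma compact_contraction_surj:
  fixes X :: "'a::real_normed_vector \<Rightarrow>\<^sub>L 'a"
  assumes X: "compact_operator X" "norm X < 1"
  shows "\<exists>z. z - blinfun_apply X z = y"
proof -
  define F where "F z = y + blinfun_apply X z" for z
  define x where "x k = (F ^^ k) 0" for k
  define R where "R = norm y / (1 - norm X)"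
  have R: "norm y + norm X * R = R" "0 \<le> R"
    using X(2) by (simp_all add: R_def field_simps)
  have xR: "norm (x k) \<le> R" for k
  proof (induction k)
    case (Suc k)
    have "norm (x (Suc k)) \<le> norm y + norm (blinfun_apply X (x k))"
      by (simp add: x_def F_def norm_triangle_ineq)
    also have "\<dots> \<le> norm y + norm X * R"
      using norm_blinfun [of X "x k"] mult_left_mono [OF Suc norm_ge_zero [of X]] by linarith
    finally show ?case by (simp only: R(1))
  qed (simp add: x_def R)
  have F: "norm ((F ^^ k) a - (F ^^ k) b) \<le> norm X ^ k * norm (a - b)" for k a b
  proof (induction k)
    case (Suc k)
    have "(F ^^ Suc k) a - (F ^^ Suc k) b = blinfun_apply X ((F ^^ k) a - (F ^^ k) b)"
      by (simp add: F_def)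
    then have "norm ((F ^^ Suc k) a - (F ^^ Suc k) b) \<le> norm X * norm ((F ^^ k) a - (F ^^ k) b)"
      by (simp only: norm_blinfun)
    also have "\<dots> \<le> norm X * (norm X ^ k * norm (a - b))"
      by (intro mult_left_mono Suc) simp
    finally show ?case by (simp add: mult.assoc)
  qed simp
  have xd: "norm (x n - x k) \<le> norm X ^ k * R" if kn: "k \<le> n" for k n
  proof -
    obtain m where n: "n = k + m" using le_Suc_ex [OF kn] by blast
    have 1: "x n = (F ^^ k) (x m)" and 2: "x k = (F ^^ k) 0"
      by (simp_all add: n x_def funpow_add)
    have "norm (x n - x k) \<le> norm X ^ k * norm (x m - 0)"
      unfolding 1 2 by (rule F)
    then have "norm (x n - x k) \<le> norm X ^ k * norm (x m)"
      by (simp only: diff_zero)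
    also have "\<dots> \<le> norm X ^ k * R" by (intro mult_left_mono xR) simp
    finally show ?thesis .
  qed
  have "Cauchy x"
  proof (rule metric_CauchyI)
    fix e :: real assume e: "0 < e"
    have "(\<lambda>k. norm X ^ k * R) \<longlonglongrightarrow> 0 * R"
      by (intro tendsto_mult tendsto_const LIMSEQ_realpow_zero) (use X(2) in auto)
    then have "\<forall>\<^sub>F k in sequentially. norm X ^ k * R < e / 2"
      using e by (intro order_tendstoD(2)) auto
    then obtain k where k: "norm X ^ k * R < e / 2"
      by (auto simp: eventually_sequentially)
    show "\<exists>M. \<forall>m\<ge>M. \<forall>n\<ge>M. dist (x m) (x n) < e"
    proof (intro exI allI impI)
      fix m n assume "k \<le> m" "k \<le> n"
      then show "dist (x m) (x n) < e"
        using xd [of k m] xd [of k n] k dist_triangle2 [of "x m" "x n" "x k"] by (simp add: dist_norm)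
    qed
  qed
  define C where "C = closure (blinfun_apply X ` cball 0 R)"
  have "compact C" using X(1) by (simp add: C_def compact_operator_def)
  moreover have "blinfun_apply X (x k) \<in> C" for k
    unfolding C_def by (rule subsetD [OF closure_subset]) (simp add: xR)
  moreover have "Cauchy (\<lambda>k. blinfun_apply X (x k))"
    by (rule bounded_linear.Cauchy [OF blinfun.bounded_linear_right \<open>Cauchy x\<close>])
  ultimately obtain l where l: "(\<lambda>k. blinfun_apply X (x k)) \<longlonglongrightarrow> l"
    using compact_imp_complete unfolding complete_def by metis
  have "(\<lambda>k. x (Suc k)) \<longlonglongrightarrow> y + l"
    using tendsto_add [OF tendsto_const [of y] l] by (simp add: x_def F_def)
  then have "x \<longlonglongrightarrow> y + l" by (rule LIMSEQ_imp_Suc)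
  then have "(\<lambda>k. blinfun_apply X (x k)) \<longlonglongrightarrow> blinfun_apply X (y + l)"
    by (intro tendsto_intros)
  then have "blinfun_apply X (y + l) = l" using l LIMSEQ_unique by blast
  then show ?thesis by (intro exI [of _ "y + l"]) simp
qed

lemma compact_contraction_inverse:
  fixes X :: "'a::real_normed_vector \<Rightarrow>\<^sub>L 'a"
  assumes X: "compact_operator X" "norm X < 1"
  obtains Y where "\<And>x. blinfun_apply Y (x - blinfun_apply X x) = x"
    "\<And>x. blinfun_apply Y x - blinfun_apply X (blinfun_apply Y x) = x"
proof -
  obtain S where S: "\<And>y. S y - blinfun_apply X (S y) = y"
    using compact_contraction_surj [OF X] by metis
  have inj: "a = b" if "a - blinfun_apply X a = b - blinfun_apply X b" for a b
  proof -
    have z: "(a - b) - blinfun_apply X (a - b) = 0" using that by (simp add: algebra_simps)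
    have "(1 - norm X) * norm (a - b) \<le> 0"
      using diff_apply_lower_bound [of X "a - b"] unfolding z norm_zero .
    then show ?thesis using X(2) by (simp add: mult_le_0_iff)
  qed
  have "bounded_linear S"
  proof (rule bounded_linear_intro)
    show "S (x + y) = S x + S y" for x y
    proof (rule inj)
      have "S x + S y - blinfun_apply X (S x + S y) =
          (S x - blinfun_apply X (S x)) + (S y - blinfun_apply X (S y))"
        by simp
      then show "S (x + y) - blinfun_apply X (S (x + y)) = S x + S y - blinfun_apply X (S x + S y)"
        by (simp only: S)
    qed
    show "S (r *\<^sub>R x) = r *\<^sub>R S x" for r x
    proof (rule inj)
      have "r *\<^sub>R S x - blinfun_apply X (r *\<^sub>R S x) = r *\<^sub>R (S x - blinfun_apply X (S x))"
        by (simp add: scaleR_diff_right)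
      then show "S (r *\<^sub>R x) - blinfun_apply X (S (r *\<^sub>R x)) = r *\<^sub>R S x - blinfun_apply X (r *\<^sub>R S x)"
        by (simp only: S)
    qed
    show "norm (S x) \<le> norm x * (1 / (1 - norm X))" for x
      using diff_apply_lower_bound [of X "S x"] X(2) by (simp add: S field_simps)
  qed
  then have a: "blinfun_apply (Blinfun S) = S" by (rule bounded_linear_Blinfun_apply)
  show ?thesis
  proof (rule that)
    show "blinfun_apply (Blinfun S) (x - blinfun_apply X x) = x" for x
      unfolding a by (rule inj) (rule S)
    show "blinfun_apply (Blinfun S) x - blinfun_apply X (blinfun_apply (Blinfun S) x) = x" for x
      unfolding a by (rule S)
  qed
qed

lemma klin_inverse:
  assumes X: "klin X" and Z: "\<And>x. blinfun_apply Z (x - blinfun_apply X x) = x"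
    "\<And>x. blinfun_apply Z x - blinfun_apply X (blinfun_apply Z x) = x"
  shows "klin Z"
  unfolding klin_def
proof (intro allI)
  fix x c
  let ?y = "blinfun_apply Z x"
  have "x \<cdot>\<^sub>K c = ?y \<cdot>\<^sub>K c - blinfun_apply X (?y \<cdot>\<^sub>K c)"
    using Z(2) [of x] by (simp add: klinD [OF X] flip: scaleK_simps)
  then show "blinfun_apply Z (x \<cdot>\<^sub>K c) = ?y \<cdot>\<^sub>K c"
    using Z(1) by metis
qed

section \<open>The Cayley transform\<close>

text \<open>The domain of the Cayley transform \<open>S \<mapsto> (1 + S) (1 - S)\<^sup>-\<^sup>1\<close>. The transform \<open>h\<close> is handled through
  the equation \<open>h (x - S x) = x + S x\<close>, which determines it when \<open>1 - S\<close> is onto.\<close>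

definition skew_op :: "'k::rch_scalar op \<Rightarrow> bool" where
  "skew_op S \<longleftrightarrow> klin S \<and> compact_operator S \<and>
     (\<forall>x y. inner (blinfun_apply S x) y = - inner x (blinfun_apply S y))"

lemma skew_op_inner_self: "skew_op S \<Longrightarrow> inner x (blinfun_apply S x) = 0"
proof -
  assume "skew_op S"
  then have "inner (blinfun_apply S x) x = - inner x (blinfun_apply S x)"
    unfolding skew_op_def by blast
  then show ?thesis by (simp add: inner_commute)
qed

lemma norm_skew_op:
  assumes "skew_op S"
  shows "norm (x + blinfun_apply S x) = norm (x - blinfun_apply S x)"
    and "norm x \<le> norm (x - blinfun_apply S x)"
proof -
  have p: "(norm (x + blinfun_apply S x))\<^sup>2 = (norm x)\<^sup>2 + (norm (blinfun_apply S x))\<^sup>2"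
    and m: "(norm (x - blinfun_apply S x))\<^sup>2 = (norm x)\<^sup>2 + (norm (blinfun_apply S x))\<^sup>2"
    using skew_op_inner_self [OF assms, of x]
    by (simp_all add: power2_norm_eq_inner inner_add inner_diff inner_commute)
  show "norm (x + blinfun_apply S x) = norm (x - blinfun_apply S x)"
    by (rule power2_eq_imp_eq) (simp_all add: p m)
  show "norm x \<le> norm (x - blinfun_apply S x)"
    by (rule power2_le_imp_le) (simp_all add: m)
qed

lemma cayley_exists:
  fixes S :: "'k::lc_scalar op"
  assumes S: "skew_op S" "norm S < 1"
  shows "\<exists>h. k_unitary h \<and> (\<forall>x. blinfun_apply h (x - blinfun_apply S x) = x + blinfun_apply S x)"
proof -
  have k: "klin S" and c: "compact_operator S" using S(1) by (auto simp: skew_op_def)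
  obtain Z where Z: "\<And>x. blinfun_apply Z (x - blinfun_apply S x) = x"
    "\<And>x. blinfun_apply Z x - blinfun_apply S (blinfun_apply Z x) = x"
    using compact_contraction_inverse [OF c S(2)] by blast
  define h where "h = (id_blinfun + S) o\<^sub>L Z"
  have h: "blinfun_apply h (x - blinfun_apply S x) = x + blinfun_apply S x" for x
    unfolding h_def blinfun_apply_blinfun_compose Z(1) by simp
  have "klin h"
    unfolding h_def by (intro klin_compose klin_add klin_id k klin_inverse [OF k Z])
  moreover have "norm (blinfun_apply h x) = norm x" for x
    using h [of "blinfun_apply Z x"] norm_skew_op(1) [OF S(1), of "blinfun_apply Z x"] by (simp add: Z)
  moreover have "surj (blinfun_apply h)"
    unfolding surj_def
  proof
    fix w
    have "- S = (- 1) *\<^sub>R S" by simp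
    then have "compact_operator (- S)" using compact_operator_scaleR [OF c] by metis
    then obtain y where "y - blinfun_apply (- S) y = w"
      using compact_contraction_surj [of "- S" w] S(2) by auto
    then show "\<exists>x. w = blinfun_apply h x"
      using h [of y] by (intro exI [of _ "y - blinfun_apply S y"]) simp
  qed
  ultimately show ?thesis
    using h by (auto simp: k_unitary_iff isom_op_def)
qed

text \<open>Evaluate at \<open>y = x - S' x\<close>, where \<open>h\<close> and \<open>h'\<close> differ by \<open>d + h d\<close> with \<open>d = (S - S') x\<close>, and use
  \<open>\<parallel>x\<parallel> \<le> \<parallel>y\<parallel>\<close>.\<close>

lemma cayley_lipschitz:
  fixes S S' h h' :: "'k::lc_scalar op"
  assumes h: "k_unitary h" "\<And>x. blinfun_apply h (x - blinfun_apply S x) = x + blinfun_apply S x"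
    and h': "\<And>x. blinfun_apply h' (x - blinfun_apply S' x) = x + blinfun_apply S' x"
    and S': "skew_op S'" "norm S' < 1"
  shows "norm (h - h') \<le> 2 * norm (S - S')"
proof (rule norm_blinfun_bound)
  fix y
  have "compact_operator S'" using S' by (simp add: skew_op_def)
  then obtain x where x: "x - blinfun_apply S' x = y"
    using compact_contraction_surj S'(2) by blast
  let ?d = "blinfun_apply (S - S') x"
  have "y = (x - blinfun_apply S x) + ?d" using x by (simp add: algebra_simps)
  then have "blinfun_apply h y = (x + blinfun_apply S x) + blinfun_apply h ?d"
    using h(2) by (metis blinfun.add_right)
  moreover have "blinfun_apply h' y = x + blinfun_apply S' x"
    using h' x by metis
  ultimately have "blinfun_apply (h - h') y = ?d + blinfun_apply h ?d"
    by simp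
  then have "norm (blinfun_apply (h - h') y) \<le> norm ?d + norm ?d"
    by (metis norm_triangle_ineq k_unitary_norm [OF h(1)])
  also have "\<dots> \<le> 2 * norm (S - S') * norm x"
    using norm_blinfun [of "S - S'" x] by simp
  also have "\<dots> \<le> 2 * norm (S - S') * norm y"
    using norm_skew_op(2) [OF S'(1), of x] x by (intro mult_left_mono) auto
  finally show "norm (blinfun_apply (h - h') y) \<le> 2 * norm (S - S') * norm y" .
qed simp

text \<open>The Cayley transforms of \<open>t S\<close> for \<open>t\<close> between \<open>0\<close> and \<open>1\<close> form a path from the identity to
  that of \<open>S\<close>.\<close>

lemma cayley_U_fin_0:
  fixes S :: "'k::lc_scalar op"
  assumes S: "skew_op S" "norm S < 1" and M: "\<And>j. j \<ge> M \<Longrightarrow> blinfun_apply S (basis_vec j) = 0"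
  shows "\<exists>h\<in>U_fin_0 M. \<forall>x. blinfun_apply h (x - blinfun_apply S x) = x + blinfun_apply S x"
proof -
  have tS: "skew_op (t *\<^sub>R S)" for t
    using S(1) by (simp add: skew_op_def klin_scaleR compact_operator_scaleR)
  have tn: "norm (t *\<^sub>R S) < 1" if "t \<in> {0..1}" for t
    using that S(2) mult_left_le_one_le [of "norm S" t] by (simp add: mult.commute)
  have "\<forall>t\<in>{0..1}. \<exists>h. k_unitary h \<and>
      (\<forall>x. blinfun_apply h (x - t *\<^sub>R blinfun_apply S x) = x + t *\<^sub>R blinfun_apply S x)"
    using cayley_exists [OF tS tn] by simp
  then obtain h where hu: "\<And>t. t \<in> {0..1} \<Longrightarrow> k_unitary (h t)"
    and hx: "\<And>t x. t \<in> {0..1} \<Longrightarrow> blinfun_apply (h t) (x - t *\<^sub>R blinfun_apply S x) = x + t *\<^sub>R blinfun_apply S x"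
    by metis
  have hl: "norm (h s - h t) \<le> 2 * norm S * \<bar>s - t\<bar>" if "s \<in> {0..1}" "t \<in> {0..1}" for s t
  proof -
    have "norm (h s - h t) \<le> 2 * norm (s *\<^sub>R S - t *\<^sub>R S)"
      by (rule cayley_lipschitz [OF hu [OF that(1)] _ _ tS tn [OF that(2)]])
        (simp_all only: hx that blinfun.scaleR_left)
    also have "s *\<^sub>R S - t *\<^sub>R S = (s - t) *\<^sub>R S" by (simp add: scaleR_diff_left)
    finally show ?thesis by (simp add: mult_ac)
  qed
  have "h ` {0..1} \<subseteq> U_fin_0 M"
  proof (rule U_fin_0_connectI)
    have "continuous_on {0..1} h"
    proof (rule continuous_onI)
      fix t e :: real assume t: "t \<in> {0..1}" and e: "0 < e"
      show "\<exists>d>0. \<forall>s\<in>{0..1}. dist s t < d \<longrightarrow> dist (h s) (h t) \<le> e"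
      proof (intro exI conjI ballI impI)
        show "0 < e / (2 * norm S + 1)" using e by (simp add: add_nonneg_pos)
        fix s assume s: "s \<in> {0..1::real}" and d: "dist s t < e / (2 * norm S + 1)"
        have "(2 * norm S + 1) * \<bar>s - t\<bar> \<le> e"
        proof -
          have "0 < 2 * norm S + 1" by (simp add: add_nonneg_pos)
          then have "\<bar>s - t\<bar> * (2 * norm S + 1) < e"
            using d by (simp only: dist_real_def pos_less_divide_eq)
          then show ?thesis by (simp only: mult.commute less_imp_le)
        qed
        moreover have "2 * norm S * \<bar>s - t\<bar> \<le> (2 * norm S + 1) * \<bar>s - t\<bar>"
          by (intro mult_right_mono) auto
        ultimately show "dist (h s) (h t) \<le> e"
          using hl [OF s t] by (simp add: dist_norm)
      qed
    qed
    then show "connected (h ` {0..1})" by (rule connected_continuous_image) simp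
    have "h 0 = id_blinfun" using hx [of 0] by (intro blinfun_eqI) simp
    then show "id_blinfun \<in> h ` {0..1}" by (metis atLeastAtMost_iff image_eqI order_refl zero_le_one)
    show "h ` {0..1} \<subseteq> U_fin M"
    proof (clarify)
      fix t :: real assume t: "t \<in> {0..1}"
      have "blinfun_apply (h t) (basis_vec j) = basis_vec j" if "j \<ge> M" for j
        using hx [OF t, of "basis_vec j"] M [OF that] by simp
      then show "h t \<in> U_fin M" using hu [OF t] by (simp add: U_fin_iff)
    qed
  qed
  then have "h 1 \<in> U_fin_0 M" by force
  moreover have "\<forall>x. blinfun_apply (h 1) (x - blinfun_apply S x) = x + blinfun_apply S x"
    using hx [of 1] by simp
  ultimately show ?thesis by blast
qed

section \<open>Density of the direct limit\<close>

lemma tail_small: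
  fixes x :: "'k::lc_scalar ell2"
  assumes "0 < \<epsilon>"
  shows "\<exists>m. norm (mask {m..} x) < \<epsilon>"
proof -
  have "(\<lambda>m. \<Sum>n<m. (norm (coord x n))\<^sup>2) \<longlonglongrightarrow> (norm x)\<^sup>2"
    using summable_LIMSEQ [OF summable_coord [of x]]
    by (simp add: norm_ell2_def suminf_nonneg summable_coord)
  then have "\<forall>\<^sub>F m in sequentially. (norm x)\<^sup>2 - \<epsilon>\<^sup>2 < (\<Sum>n<m. (norm (coord x n))\<^sup>2)"
    using assms by (intro order_tendstoD(1)) auto
  then obtain m where m: "(norm x)\<^sup>2 - \<epsilon>\<^sup>2 < (\<Sum>n<m. (norm (coord x n))\<^sup>2)"
    by (auto simp: eventually_sequentially)
  have "(norm (mask {..<m} x))\<^sup>2 = (\<Sum>n. (norm (coord (mask {..<m} x) n))\<^sup>2)"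
    by (simp only: norm_ell2_def real_sqrt_pow2 suminf_nonneg summable_coord zero_le_power2)
  also have "\<dots> = (\<Sum>n<m. (norm (coord x n))\<^sup>2)"
    by (subst suminf_finite [of "{..<m}"]) auto
  finally have "(norm (mask (- {..<m}) x))\<^sup>2 < \<epsilon>\<^sup>2"
    using m norm_mask_split [of x "{..<m}"] by simp
  moreover have "- {..<m} = {m..}" by auto
  ultimately have "norm (mask {m..} x) < \<epsilon>"
    using assms by (simp add: power2_less_imp_less)
  then show ?thesis ..
qed

lemma norm_mask_mono: "I \<subseteq> J \<Longrightarrow> norm (mask I x) \<le> norm (mask J x)"
proof -
  assume "I \<subseteq> J"
  then have "mask I x = mask I (mask J x)" by (intro ell2_eqI) auto
  then show ?thesis by (metis norm_mask_le)
qed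

text \<open>The projections to the coordinates from \<open>m\<close> onwards are contractions that converge to zero
  pointwise, hence uniformly on compact sets.\<close>

lemma compact_tail_small:
  fixes S :: "'k::lc_scalar op"
  assumes S: "compact_operator S" and \<epsilon>: "0 < \<epsilon>"
  shows "\<exists>m. \<forall>x. norm (mask {m..} (blinfun_apply S x)) \<le> \<epsilon> * norm x"
proof -
  obtain C where C: "compact C" "blinfun_apply S ` cball 0 1 \<subseteq> C"
    using S unfolding compact_operator_iff by blast
  obtain f where f: "\<And>x :: 'k ell2. norm (mask {f x..} x) < \<epsilon> / 2"
    using tail_small [of "\<epsilon> / 2"] \<epsilon> by (metis half_gt_zero)
  obtain D where D: "D \<subseteq> C" "finite D" "C \<subseteq> (\<Union>x\<in>D. ball x (\<epsilon> / 2))"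
    using compactE_image [OF C(1), of C "\<lambda>x. ball x (\<epsilon> / 2)"] \<epsilon> by force
  define m where "m = Max (insert 0 (f ` D))"
  have y: "norm (mask {m..} y) \<le> \<epsilon>" if yC: "y \<in> C" for y
  proof -
    obtain x where x: "x \<in> D" "norm (y - x) < \<epsilon> / 2"
    proof -
      obtain x where "x \<in> D" "y \<in> ball x (\<epsilon> / 2)" using D(3) yC by blast
      then show ?thesis by (intro that [of x]) (simp_all add: dist_norm norm_minus_commute)
    qed
    have "f x \<le> m" unfolding m_def using x(1) D(2) by (intro Max_ge) auto
    then have "norm (mask {m..} x) < \<epsilon> / 2"
      using f [of x] norm_mask_mono [of "{m..}" "{f x..}" x] by auto
    moreover have "mask {m..} y = mask {m..} (y - x) + mask {m..} x"
      by (rule ell2_eqI) auto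
    then have "norm (mask {m..} y) \<le> norm (mask {m..} (y - x)) + norm (mask {m..} x)"
      by (metis norm_triangle_ineq)
    ultimately show ?thesis using x(2) norm_mask_le [of "{m..}" "y - x"] by linarith
  qed
  have "norm (mask {m..} (blinfun_apply S x)) \<le> \<epsilon> * norm x" for x
  proof (cases "x = 0")
    case True
    have "mask {m..} (0 :: 'k ell2) = 0" by (rule ell2_eqI) simp
    with True show ?thesis by simp
  next
    case False
    have "blinfun_apply S ((1 / norm x) *\<^sub>R x) \<in> C" using False by (intro subsetD [OF C(2)] imageI) simp
    from y [OF this] have "norm (mask {m..} ((1 / norm x) *\<^sub>R blinfun_apply S x)) \<le> \<epsilon>"
      by (simp only: blinfun.scaleR_right)
    moreover have "mask {m..} ((1 / norm x) *\<^sub>R blinfun_apply S x) = (1 / norm x) *\<^sub>R mask {m..} (blinfun_apply S x)"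
      by (rule ell2_eqI) auto
    ultimately show ?thesis using False by (simp add: field_simps)
  qed
  then show ?thesis by blast
qed

lemma skew_op_truncate:
  fixes S :: "'k::lc_scalar op"
  assumes S: "skew_op S"
  shows "skew_op (Mask I o\<^sub>L S o\<^sub>L Mask I)" "norm (Mask I o\<^sub>L S o\<^sub>L Mask I) \<le> norm S"
proof -
  show "skew_op (Mask I o\<^sub>L S o\<^sub>L Mask I)"
    using S unfolding skew_op_def
    by (simp add: klin_compose klin_Mask compact_operator_compose_left compact_operator_compose_right inner_mask)
  show "norm (Mask I o\<^sub>L S o\<^sub>L Mask I) \<le> norm S"
  proof (rule norm_blinfun_bound)
    fix x
    have "norm (blinfun_apply (Mask I o\<^sub>L S o\<^sub>L Mask I) x) \<le> norm (blinfun_apply S (mask I x))"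
      by (simp add: norm_mask_le)
    also have "\<dots> \<le> norm S * norm (mask I x)" by (rule norm_blinfun)
    also have "\<dots> \<le> norm S * norm x" by (intro mult_left_mono norm_mask_le) simp
    finally show "norm (blinfun_apply (Mask I o\<^sub>L S o\<^sub>L Mask I) x) \<le> norm S * norm x" .
  qed simp
qed

text \<open>Compactness makes the rows of \<open>S\<close> from \<open>m\<close> onwards small, and skewness transfers this to the
  columns.\<close>

lemma skew_op_approx:
  fixes S :: "'k::lc_scalar op"
  assumes S: "skew_op S" and \<epsilon>: "0 < \<epsilon>"
  shows "\<exists>m. norm ((Mask {..<m} o\<^sub>L S o\<^sub>L Mask {..<m}) - S) \<le> 2 * \<epsilon>"
proof -
  have c: "compact_operator S" and sk: "\<And>x y. inner (blinfun_apply S x) y = - inner x (blinfun_apply S y)"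
    using S by (auto simp: skew_op_def)
  obtain m where m: "\<And>x. norm (mask {m..} (blinfun_apply S x)) \<le> \<epsilon> * norm x"
    using compact_tail_small [OF c \<epsilon>] by blast
  have split: "x = mask {..<m} x + mask {m..} x" for x :: "'k ell2"
    by (rule ell2_eqI) auto
  have m2: "norm (blinfun_apply S (mask {m..} x)) \<le> \<epsilon> * norm x" for x
  proof -
    let ?z = "blinfun_apply S (mask {m..} x)"
    have "norm ?z * norm ?z = inner ?z ?z"
      by (simp only: power2_norm_eq_inner flip: power2_eq_square)
    also have "\<dots> = - inner x (mask {m..} (blinfun_apply S ?z))"
      using sk [of "mask {m..} x" ?z] by (simp only: inner_mask)
    also have "\<dots> \<le> norm x * norm (mask {m..} (blinfun_apply S ?z))"
      using Cauchy_Schwarz_ineq2 [of x "mask {m..} (blinfun_apply S ?z)"] by linarith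
    also have "\<dots> \<le> norm x * (\<epsilon> * norm ?z)" by (intro mult_left_mono m) simp
    finally have "norm ?z * norm ?z \<le> (\<epsilon> * norm x) * norm ?z" by (simp add: mult_ac)
    then show ?thesis using \<epsilon> by (cases "norm ?z = 0") (auto simp: mult_le_cancel_right)
  qed
  let ?T = "Mask {..<m} o\<^sub>L S o\<^sub>L Mask {..<m}"
  have "norm (?T - S) \<le> 2 * \<epsilon>"
  proof (rule norm_blinfun_bound)
    fix x :: "'k ell2"
    let ?y = "mask {..<m} x"
    have 1: "blinfun_apply S x = blinfun_apply S ?y + blinfun_apply S (mask {m..} x)"
      using split [of x] by (metis blinfun.add_right)
    have 2: "blinfun_apply S ?y = mask {..<m} (blinfun_apply S ?y) + mask {m..} (blinfun_apply S ?y)"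
      by (rule split)
    have 3: "blinfun_apply S x = mask {..<m} (blinfun_apply S ?y) + mask {m..} (blinfun_apply S ?y) +
        blinfun_apply S (mask {m..} x)"
      by (rule trans [OF 1 arg_cong [OF 2, of "\<lambda>u. u + blinfun_apply S (mask {m..} x)"]])
    have "blinfun_apply (?T - S) x = mask {..<m} (blinfun_apply S ?y) - blinfun_apply S x"
      by simp
    also have "\<dots> = - (mask {m..} (blinfun_apply S ?y) + blinfun_apply S (mask {m..} x))"
      unfolding 3 by (simp only: add.assoc diff_add_eq_diff_diff_swap minus_add_distrib) simp
    finally have "norm (blinfun_apply (?T - S) x) \<le>
        norm (mask {m..} (blinfun_apply S ?y)) + norm (blinfun_apply S (mask {m..} x))"
      by (simp only: norm_minus_cancel norm_triangle_ineq)
    also have "\<dots> \<le> \<epsilon> * norm x + \<epsilon> * norm x"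
    proof (intro add_mono m2)
      have "\<epsilon> * norm ?y \<le> \<epsilon> * norm x" using \<epsilon> by (intro mult_left_mono norm_mask_le) simp
      with m [of ?y] show "norm (mask {m..} (blinfun_apply S ?y)) \<le> \<epsilon> * norm x" by linarith
    qed
    finally show "norm (blinfun_apply (?T - S) x) \<le> 2 * \<epsilon> * norm x" by simp
  qed (use \<epsilon> in simp)
  then show ?thesis ..
qed

text \<open>Solving \<open>g (1 - S) = 1 + S\<close> gives \<open>S = H (1 + H)\<^sup>-\<^sup>1\<close> with \<open>H = (g - 1) / 2\<close>. Here \<open>H\<close> is
  compact of norm below \<open>1 / 2\<close>, so \<open>1 + H\<close> has a bounded inverse \<open>Y\<close> and \<open>\<parallel>S\<parallel> < 1\<close>. Skewness of \<open>S\<close>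
  expresses that \<open>g\<close> is isometric.\<close>

lemma inverse_cayley:
  fixes g :: "'k::lc_scalar op"
  assumes g: "g \<in> U_infty" and g1: "norm (g - id_blinfun) < 1"
  shows "\<exists>S. skew_op S \<and> norm S < 1 \<and> (\<forall>x. blinfun_apply g (x - blinfun_apply S x) = x + blinfun_apply S x)"
proof -
  have gu: "k_unitary g" and gc: "compact_operator (g - id_blinfun)"
    using g by (auto simp: U_infty_def)
  define H where "H = (1 / 2) *\<^sub>R (g - id_blinfun)"
  have H: "compact_operator H" unfolding H_def by (rule compact_operator_scaleR [OF gc])
  have Hn: "norm H < 1 / 2" using g1 by (simp add: H_def)
  have Hx: "blinfun_apply g x = x + 2 *\<^sub>R blinfun_apply H x" for x
    by (simp add: H_def)
  have Hk: "klin H" unfolding H_def by (intro klin_scaleR klin_diff klin_id k_unitary_klin gu)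
  have "- H = (- 1) *\<^sub>R H" by simp
  then have "compact_operator (- H)" using compact_operator_scaleR [OF H] by metis
  moreover have "norm (- H) < 1" using Hn by simp
  ultimately obtain Y where Y: "\<And>x. blinfun_apply Y (x - blinfun_apply (- H) x) = x"
    "\<And>x. blinfun_apply Y x - blinfun_apply (- H) (blinfun_apply Y x) = x"
    by (rule compact_contraction_inverse) blast
  have Y1: "blinfun_apply Y (x + blinfun_apply H x) = x"
    and Y2: "blinfun_apply Y x + blinfun_apply H (blinfun_apply Y x) = x" for x
    using Y [of x] by simp_all
  define S where "S = H o\<^sub>L Y"
  have "klin Y" by (rule klin_inverse [OF klin_minus [OF Hk] Y])
  then have "klin S" unfolding S_def by (intro klin_compose Hk)
  moreover have "compact_operator S"
    unfolding S_def by (rule compact_operator_compose_right [OF H])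
  moreover have "inner (blinfun_apply S x) y = - inner x (blinfun_apply S y)" for x y
  proof -
    let ?x = "blinfun_apply Y x" and ?y = "blinfun_apply Y y"
    have "inner (blinfun_apply g ?x) (blinfun_apply g ?y) = inner ?x ?y"
      by (rule inner_isom) (simp add: gu)
    then have "inner (blinfun_apply H ?x) (?y + blinfun_apply H ?y) =
        - inner (?x + blinfun_apply H ?x) (blinfun_apply H ?y)"
      by (simp add: Hx inner_add algebra_simps)
    then show ?thesis by (simp add: S_def Y2)
  qed
  ultimately have "skew_op S" by (simp add: skew_op_def)
  moreover have "norm S < 1"
  proof -
    have "norm S \<le> norm H / (1 - norm H)"
    proof (rule norm_blinfun_bound)
      fix x
      let ?x = "blinfun_apply Y x"
      have "norm ?x \<le> norm x / (1 - norm H)"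
        using diff_apply_lower_bound [of "- H" ?x] Y2 [of x] Hn by (simp add: field_simps)
      then have "norm H * norm ?x \<le> norm H * (norm x / (1 - norm H))"
        by (intro mult_left_mono) auto
      then show "norm (blinfun_apply S x) \<le> norm H / (1 - norm H) * norm x"
        using norm_blinfun [of H ?x] by (simp add: S_def)
    qed (use Hn in simp)
    also have "\<dots> < 1" using Hn by (simp add: field_simps)
    finally show ?thesis .
  qed
  moreover have "blinfun_apply g (x - blinfun_apply S x) = x + blinfun_apply S x" for x
  proof -
    let ?x = "blinfun_apply Y x"
    have "x - blinfun_apply S x = ?x" "x + blinfun_apply S x = ?x + 2 *\<^sub>R blinfun_apply H ?x"
      using Y2 [of x] by (simp_all add: S_def algebra_simps scaleR_2)
    then show ?thesis by (simp only: Hx)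
  qed
  ultimately show ?thesis by blast
qed

lemma near_id_in_closure:
  fixes g :: "'k::lc_scalar op"
  assumes g: "g \<in> U_infty" and g1: "norm (g - id_blinfun) < 1"
  shows "g \<in> closure U_lim_0"
  unfolding closure_approachable
proof (intro allI impI)
  fix e :: real assume e: "0 < e"
  obtain S where S: "skew_op S" "norm S < 1"
    and gS: "\<And>x. blinfun_apply g (x - blinfun_apply S x) = x + blinfun_apply S x"
    using inverse_cayley [OF assms] by blast
  obtain m where m: "norm ((Mask {..<m} o\<^sub>L S o\<^sub>L Mask {..<m}) - S) \<le> 2 * (e / 8)"
    using skew_op_approx [OF S(1), of "e / 8"] e by auto
  define S' where "S' = Mask {..<m} o\<^sub>L S o\<^sub>L Mask {..<m}"
  have S': "skew_op S'" "norm S' < 1"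
    using skew_op_truncate [OF S(1), of "{..<m}"] S(2) by (auto simp: S'_def)
  have "blinfun_apply S' (basis_vec j) = 0" if "j \<ge> m" for j
  proof -
    have "mask {..<m} (basis_vec j :: 'k ell2) = 0"
      using that by (intro ell2_eqI) auto
    moreover have "mask {..<m} (0 :: 'k ell2) = 0" by (rule ell2_eqI) simp
    ultimately show ?thesis by (simp add: S'_def)
  qed
  then obtain h where h: "h \<in> U_fin_0 m" "\<And>x. blinfun_apply h (x - blinfun_apply S' x) = x + blinfun_apply S' x"
    using cayley_U_fin_0 [OF S'] by blast
  have "norm (h - g) \<le> 2 * norm (S' - S)"
    by (rule cayley_lipschitz [OF U_fin_0D(1) [OF h(1)] h(2) gS S])
  also have "\<dots> < e" using m e by (simp add: S'_def)
  finally show "\<exists>y\<in>U_lim_0. dist y g < e"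
    using h(1) by (intro bexI [of _ h]) (auto simp: dist_norm U_lim_0_iff)
qed

text \<open>If \<open>x\<close> is a limit of finite elements and \<open>y\<close> is close to \<open>x\<close>, choose \<open>p\<close> in the direct limit
  close to both; then \<open>p\<^sup>-\<^sup>1 y\<close> is near the identity, hence also a limit. So the limits form a set that is
  open and closed in the component.\<close>

lemma U_infty_0_subset_closure: "U_infty_0 \<subseteq> closure (U_lim_0 :: 'k::lc_scalar op set)"
proof
  fix g :: "'k op" assume g: "g \<in> U_infty_0"
  have conn: "connected (U_infty_0 :: 'k op set)"
    unfolding U_infty_0_def by (rule connected_connected_component)
  show "g \<in> closure U_lim_0"
  proof (rule connected_induction_simple [OF conn, of id_blinfun])
    show "id_blinfun \<in> (U_infty_0 :: 'k op set)"
      using U_lim_0_id U_lim_0_subset_U_infty_0 by blast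
    show "id_blinfun \<in> closure (U_lim_0 :: 'k op set)"
      using U_lim_0_id closure_subset by blast
    fix a :: "'k op" assume a: "a \<in> U_infty_0"
    show "\<exists>T. openin (top_of_set U_infty_0) T \<and> a \<in> T \<and>
        (\<forall>x\<in>T. \<forall>y\<in>T. x \<in> closure U_lim_0 \<longrightarrow> y \<in> closure U_lim_0)"
    proof (intro exI conjI ballI impI)
      show "openin (top_of_set U_infty_0) (U_infty_0 \<inter> ball a (1 / 4))"
        by (simp add: openin_open_Int)
      show "a \<in> U_infty_0 \<inter> ball a (1 / 4)" using a by simp
      fix x y assume x: "x \<in> U_infty_0 \<inter> ball a (1 / 4)" and y: "y \<in> U_infty_0 \<inter> ball a (1 / 4)"
        and xc: "x \<in> closure U_lim_0"
      obtain p where p: "p \<in> U_lim_0" "dist p x < 1 / 4"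
      proof -
        have "0 < (1 / 4 :: real)" by simp
        with xc obtain p where "p \<in> U_lim_0" "dist p x < 1 / 4"
          unfolding closure_approachable by blast
        then show ?thesis by (rule that)
      qed
      have "dist y p < 1"
        using x y p(2) dist_triangle [of y p x] dist_triangle [of y x a] by (simp add: dist_commute)
      then have yp: "norm (y - p) < 1" by (simp add: dist_norm)
      have pi: "isom_op p" using U_lim_0_unitary [OF p(1)] by simp
      define q where "q = inv_op p o\<^sub>L y"
      have "y \<in> U_infty" using y unfolding U_infty_0_def using connected_component_subset by blast
      then have yu: "k_unitary y" "compact_operator (y - id_blinfun)" by (auto simp: U_infty_def)
      have ip: "inv_op p \<in> U_lim_0" by (rule U_lim_0_inv [OF p(1)])
      then have "inv_op p \<in> U_infty"
        using U_fin_0_subset U_fin_subset_U_infty U_lim_0_iff by blast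
      then have "compact_operator (inv_op p - id_blinfun)" by (simp add: U_infty_def)
      moreover have "q - id_blinfun = (inv_op p o\<^sub>L (y - id_blinfun)) + (inv_op p - id_blinfun)"
        by (rule blinfun_eqI) (simp add: q_def)
      ultimately have "compact_operator (q - id_blinfun)"
        by (simp only: compact_operator_add compact_operator_compose_left yu(2))
      then have "q \<in> U_infty"
        using yu(1) U_lim_0_unitary [OF ip] by (simp add: U_infty_def q_def k_unitary_compose)
      moreover have "norm (q - id_blinfun) < 1"
      proof -
        have "q - id_blinfun = inv_op p o\<^sub>L (y - p)"
          by (rule blinfun_eqI) (simp add: q_def pi)
        then show ?thesis using yp by (simp add: norm_isom_compose_left isom_op_inv pi)
      qed
      ultimately have q: "q \<in> closure U_lim_0" by (rule near_id_in_closure)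
      have "(\<lambda>b. p o\<^sub>L b) ` closure U_lim_0 \<subseteq> closure U_lim_0"
      proof (rule image_closure_subset)
        show "(\<lambda>b. p o\<^sub>L b) ` U_lim_0 \<subseteq> closure U_lim_0"
          using U_lim_0_compose [OF p(1)] closure_subset by blast
      qed (auto intro!: continuous_intros)
      moreover have "y = p o\<^sub>L q" by (rule blinfun_eqI) (simp add: q_def pi)
      ultimately show "y \<in> closure U_lim_0" using q by blast
    qed
  qed (fact g)
qed

section \<open>Extending representations\<close>

lemma hom_op_groupD:
  assumes "\<rho> \<in> hom (op_group G) (op_group H)"
  shows "g \<in> G \<Longrightarrow> \<rho> g \<in> H" "g \<in> G \<Longrightarrow> h \<in> G \<Longrightarrow> \<rho> (g o\<^sub>L h) = \<rho> g o\<^sub>L \<rho> h"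
  using assms by (auto simp: hom_def op_group_def)

lemma unitary_rep_imp_unirep:
  assumes "unitary_rep direct_limit_topology \<pi>"
  shows "unirep \<pi>"
proof -
  have "\<pi> \<in> hom (op_group U_lim_0) (op_group {u. c_unitary u})"
    using assms by (simp add: unitary_rep_def topspace_direct_limit_topology)
  from hom_op_groupD [OF this] show ?thesis by (auto simp: unirep_def)
qed

lemma unitary_rep_continuous_on:
  assumes "unitary_rep direct_limit_topology \<pi>"
  shows "continuous_on (U_fin_0 n) (\<lambda>g. blinfun_apply (\<pi> g) v)"
proof -
  have c: "continuous_map direct_limit_topology euclidean (\<lambda>g. blinfun_apply (\<pi> g) v)"
    using assms by (simp add: unitary_rep_def)
  have sub: "U_fin_0 n \<subseteq> U_lim_0" by (auto simp: U_lim_0_def)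
  have into_UNIV: "(\<lambda>g. blinfun_apply (\<pi> g) v) \<in> U_fin_0 n \<rightarrow> UNIV" by simp
  show ?thesis
    unfolding continuous_on_open_gen [OF into_UNIV]
  proof (intro allI impI)
    fix V :: "'b set" assume "openin (top_of_set UNIV) V"
    then have "openin euclidean V" by simp
    from openin_continuous_map_preimage [OF c this]
    have "openin (top_of_set (U_fin_0 n)) ({g \<in> U_lim_0. blinfun_apply (\<pi> g) v \<in> V} \<inter> U_fin_0 n)"
      unfolding topspace_direct_limit_topology openin_direct_limit_topology by blast
    moreover have "{g \<in> U_lim_0. blinfun_apply (\<pi> g) v \<in> V} \<inter> U_fin_0 n =
        U_fin_0 n \<inter> (\<lambda>g. blinfun_apply (\<pi> g) v) -` V"
      using sub by auto
    ultimately show "openin (top_of_set (U_fin_0 n)) (U_fin_0 n \<inter> (\<lambda>g. blinfun_apply (\<pi> g) v) -` V)"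
      by simp
  qed
qed

lemma extends_imp_norm_continuous:
  fixes \<pi> :: "'k::lc_scalar op \<Rightarrow> 'v::chilbert_space \<Rightarrow>\<^sub>L 'v"
  assumes \<pi>: "unirep \<pi>" and ext: "extends_to_U_infty_0 \<pi>"
  shows "norm_continuous \<pi>"
  unfolding norm_continuous_def
proof (intro allI impI)
  fix v and \<epsilon> :: real assume \<epsilon>: "0 < \<epsilon>"
  obtain \<rho> where "unitary_rep (top_of_set U_infty_0) \<rho>" and eq: "\<And>g. g \<in> U_lim_0 \<Longrightarrow> \<rho> g = \<pi> g"
    using ext by (auto simp: extends_to_U_infty_0_def)
  then have "continuous_on U_infty_0 (\<lambda>g. blinfun_apply (\<rho> g) v)"
    by (simp add: unitary_rep_def)
  moreover have "id_blinfun \<in> (U_infty_0 :: 'k op set)"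
    using U_lim_0_id U_lim_0_subset_U_infty_0 by blast
  ultimately obtain d where d: "0 < d" "\<And>g. g \<in> U_infty_0 \<Longrightarrow> dist g id_blinfun < d \<Longrightarrow>
      dist (blinfun_apply (\<rho> g) v) (blinfun_apply (\<rho> id_blinfun) v) < \<epsilon>"
    using \<epsilon> unfolding continuous_on_iff by metis
  have "norm (blinfun_apply (\<pi> g) v - v) < \<epsilon>" if "g \<in> U_lim_0" "norm (g - id_blinfun) < d" for g
    using d(2) [of g] that U_lim_0_subset_U_infty_0
    by (auto simp: dist_norm eq U_lim_0_id unirep_id [OF \<pi>])
  with d(1) show "\<exists>\<delta>>0. \<forall>g\<in>U_lim_0. norm (g - id_blinfun) < \<delta> \<longrightarrow> norm (blinfun_apply (\<pi> g) v - v) < \<epsilon>"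
    by blast
qed

lemma norm_inv_diff:
  fixes p g :: "'a::real_normed_vector \<Rightarrow>\<^sub>L 'a"
  assumes "isom_op p" "isom_op g"
  shows "norm (inv_op p - inv_op g) = norm (p - g)"
proof -
  have "inv_op p - inv_op g = inv_op p o\<^sub>L ((g - p) o\<^sub>L inv_op g)"
    by (rule blinfun_eqI) (simp add: assms)
  then show ?thesis
    using assms by (simp add: norm_isom_compose_left norm_isom_compose_right isom_op_inv norm_minus_commute)
qed

text \<open>The extension is taken vector by vector, and every algebraic property of \<open>\<pi>\<close> passes to the
  limit along a sequence in the direct limit. Surjectivity holds because inversion is continuous, so
  that the closure contains the inverses of its unitary elements.\<close>

lemma norm_continuous_imp_extends:
  fixes \<pi> :: "'k::lc_scalar op \<Rightarrow> 'v::chilbert_space \<Rightarrow>\<^sub>L 'v"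
  assumes \<pi>: "unirep \<pi>" and cont: "norm_continuous \<pi>"
  shows "extends_to_U_infty_0 \<pi>"
proof -
  let ?L = "U_lim_0 :: 'k op set"
  have uc: "uniformly_continuous_on ?L (\<lambda>g. blinfun_apply (\<pi> g) v)" for v
    unfolding uniformly_continuous_on_def
  proof (intro allI impI)
    fix e :: real assume "0 < e"
    then obtain d where d: "0 < d"
      "\<And>g. g \<in> ?L \<Longrightarrow> norm (g - id_blinfun) < d \<Longrightarrow> norm (blinfun_apply (\<pi> g) v - v) < e"
      using cont unfolding norm_continuous_def by metis
    show "\<exists>d>0. \<forall>x\<in>?L. \<forall>y\<in>?L. dist y x < d \<longrightarrow>
        dist (blinfun_apply (\<pi> y) v) (blinfun_apply (\<pi> x) v) < e"
    proof (intro exI conjI ballI impI)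
      fix x y assume x: "x \<in> ?L" and y: "y \<in> ?L" and xy: "dist y x < d"
      have ix: "isom_op x" using U_lim_0_unitary [OF x] by simp
      define q where "q = inv_op x o\<^sub>L y"
      have q: "q \<in> ?L" unfolding q_def by (intro U_lim_0_compose U_lim_0_inv x y)
      have "q - id_blinfun = inv_op x o\<^sub>L (y - x)"
        by (rule blinfun_eqI) (simp add: q_def ix)
      then have "norm (q - id_blinfun) < d"
        using xy by (simp add: norm_isom_compose_left isom_op_inv ix dist_norm)
      from d(2) [OF q this] have "norm (blinfun_apply (\<pi> x) (blinfun_apply (\<pi> q) v - v)) < e"
        by (simp only: unirep_norm [OF \<pi> x])
      moreover have "x o\<^sub>L q = y" by (rule blinfun_eqI) (simp add: q_def ix)
      then have "blinfun_apply (\<pi> x) (blinfun_apply (\<pi> q) v) = blinfun_apply (\<pi> y) v"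
        using unirep_compose [OF \<pi> x q, of v] by simp
      ultimately show "dist (blinfun_apply (\<pi> y) v) (blinfun_apply (\<pi> x) v) < e"
        by (simp add: dist_norm)
    qed (fact d(1))
  qed
  have "\<exists>e. continuous_on (closure ?L) e \<and> (\<forall>g\<in>?L. e g = blinfun_apply (\<pi> g) v)" for v
    using uniformly_continuous_on_extension_on_closure [OF uc [of v]] uniformly_continuous_imp_continuous
    by metis
  then obtain E where Ec: "\<And>v. continuous_on (closure ?L) (E v)"
    and EL: "\<And>v g. g \<in> ?L \<Longrightarrow> E v g = blinfun_apply (\<pi> g) v"
    by metis
  have lim: "(\<lambda>n. blinfun_apply (\<pi> (p n)) v) \<longlonglongrightarrow> E v g"
    if p: "\<And>n. p n \<in> ?L" "p \<longlonglongrightarrow> g" for p g v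
  proof -
    have "g \<in> closure ?L" using p closure_sequential by blast
    then have "(\<lambda>n. E v (p n)) \<longlonglongrightarrow> E v g"
      using Ec [of v] p closure_subset [of ?L] unfolding continuous_on_sequentially comp_def by blast
    then show ?thesis by (simp add: EL p)
  qed
  have app: "\<exists>p. (\<forall>n. p n \<in> ?L) \<and> p \<longlonglongrightarrow> g" if "g \<in> closure ?L" for g
    using that closure_sequential by blast
  have En: "norm (E v g) = norm v" if g: "g \<in> closure ?L" for v g
  proof -
    obtain p where p: "\<And>n. p n \<in> ?L" "p \<longlonglongrightarrow> g" using app [OF g] by blast
    have "(\<lambda>n. norm (blinfun_apply (\<pi> (p n)) v)) \<longlonglongrightarrow> norm (E v g)"
      by (intro tendsto_norm lim p)
    then show ?thesis
      by (simp add: unirep_norm [OF \<pi> p(1)] LIMSEQ_const_iff)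
  qed
  have Eadd: "E (v + w) g = E v g + E w g" if g: "g \<in> closure ?L" for v w g
  proof -
    obtain p where p: "\<And>n. p n \<in> ?L" "p \<longlonglongrightarrow> g" using app [OF g] by blast
    have "(\<lambda>n. blinfun_apply (\<pi> (p n)) (v + w)) \<longlonglongrightarrow> E v g + E w g"
      unfolding blinfun.add_right by (intro tendsto_add lim p)
    with lim [OF p, of "v + w"] show ?thesis by (rule LIMSEQ_unique)
  qed
  have EC: "E (a *\<^sub>C v) g = a *\<^sub>C E v g" if g: "g \<in> closure ?L" for a v g
  proof -
    obtain p where p: "\<And>n. p n \<in> ?L" "p \<longlonglongrightarrow> g" using app [OF g] by blast
    have "bounded_linear (\<lambda>v :: 'v. a *\<^sub>C v)"
    proof (rule bounded_linear_intro)
      show "a *\<^sub>C (r *\<^sub>R x) = r *\<^sub>R (a *\<^sub>C x)" for r and x :: 'v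
        by (simp add: scaleC_scaleC mult.commute flip: scaleC_of_real)
      show "norm (a *\<^sub>C x) \<le> norm x * cmod a" for x :: 'v by (simp add: norm_scaleC)
    qed (rule scaleC_add_right)
    from bounded_linear.tendsto [OF this lim [OF p, of v]]
    have "(\<lambda>n. blinfun_apply (\<pi> (p n)) (a *\<^sub>C v)) \<longlonglongrightarrow> a *\<^sub>C E v g"
      using \<pi> p(1) by (simp add: unirep_def c_unitary_def)
    with lim [OF p, of "a *\<^sub>C v"] show ?thesis by (rule LIMSEQ_unique)
  qed
  define \<rho> where "\<rho> g = Blinfun (\<lambda>v. E v g)" for g
  have \<rho>: "blinfun_apply (\<rho> g) v = E v g" if g: "g \<in> closure ?L" for g v
  proof -
    have "bounded_linear (\<lambda>v. E v g)"
    proof (rule bounded_linear_intro)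
      show "E (r *\<^sub>R x) g = r *\<^sub>R E x g" for r x
        using EC [OF g, of "complex_of_real r" x] by (simp add: scaleC_of_real)
      show "norm (E x g) \<le> norm x * 1" for x by (simp add: En [OF g])
    qed (rule Eadd [OF g])
    then show ?thesis unfolding \<rho>_def by (simp add: bounded_linear_Blinfun_apply)
  qed
  have mult: "g o\<^sub>L h \<in> closure ?L \<and> \<rho> (g o\<^sub>L h) = \<rho> g o\<^sub>L \<rho> h"
    if g: "g \<in> closure ?L" and h: "h \<in> closure ?L" for g h
  proof -
    obtain p where p: "\<And>n. p n \<in> ?L" "p \<longlonglongrightarrow> g" using app [OF g] by blast
    obtain q where q: "\<And>n. q n \<in> ?L" "q \<longlonglongrightarrow> h" using app [OF h] by blast
    have pq: "\<And>n. p n o\<^sub>L q n \<in> ?L" "(\<lambda>n. p n o\<^sub>L q n) \<longlonglongrightarrow> (g o\<^sub>L h)"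
      by (auto intro!: U_lim_0_compose p q bounded_bilinear.tendsto [OF bounded_bilinear_blinfun_compose])
    have gh: "g o\<^sub>L h \<in> closure ?L"
      unfolding closure_sequential by (rule exI, rule conjI [OF allI], rule pq(1), rule pq(2))
    have "E v (g o\<^sub>L h) = E (E v h) g" for v
    proof -
      have "(\<lambda>n. norm (blinfun_apply (\<pi> (q n)) v - E v h)) \<longlonglongrightarrow> 0"
        by (intro tendsto_norm_zero LIM_zero lim q)
      then have "(\<lambda>n. blinfun_apply (\<pi> (p n)) (blinfun_apply (\<pi> (q n)) v - E v h)) \<longlonglongrightarrow> 0"
        by (subst tendsto_norm_zero_iff [symmetric]) (simp only: unirep_norm [OF \<pi> p(1)])
      from tendsto_add [OF this lim [OF p, of "E v h"]]
      have "(\<lambda>n. blinfun_apply (\<pi> (p n o\<^sub>L q n)) v) \<longlonglongrightarrow> E (E v h) g"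
        by (simp add: unirep_compose [OF \<pi> p(1) q(1)])
      with lim [OF pq, of v] show ?thesis by (rule LIMSEQ_unique)
    qed
    then have "\<rho> (g o\<^sub>L h) = \<rho> g o\<^sub>L \<rho> h"
      by (intro blinfun_eqI) (simp add: \<rho> g h gh)
    with gh show ?thesis by blast
  qed
  have \<rho>L: "\<rho> g = \<pi> g" if "g \<in> ?L" for g
    using that closure_subset [of ?L] by (intro blinfun_eqI) (auto simp: \<rho> EL)
  have sub: "g \<in> closure ?L" if "g \<in> U_infty_0" for g
    using that U_infty_0_subset_closure by blast
  have uni: "c_unitary (\<rho> g)" if g: "g \<in> U_infty_0" for g
  proof -
    note gc = sub [OF g]
    have "g \<in> U_infty" using g connected_component_subset unfolding U_infty_0_def by blast
    then have gi: "isom_op g" by (simp add: U_infty_def)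
    have "inv_op g \<in> closure ?L"
      unfolding closure_approachable
    proof (intro allI impI)
      fix e :: real assume "0 < e"
      then obtain p where p: "p \<in> ?L" "dist p g < e"
        using gc unfolding closure_approachable by blast
      have "dist (inv_op p) (inv_op g) < e"
        using p U_lim_0_unitary [OF p(1)] by (simp add: dist_norm norm_inv_diff gi)
      then show "\<exists>y\<in>?L. dist y (inv_op g) < e"
        using U_lim_0_inv [OF p(1)] by blast
    qed
    then have "\<rho> g o\<^sub>L \<rho> (inv_op g) = \<rho> id_blinfun"
      using mult [OF gc] inv_op_compose(2) [OF gi] by metis
    then have r: "blinfun_apply (\<rho> g) (blinfun_apply (\<rho> (inv_op g)) v) = v" for v
      using unirep_id [OF \<pi>, of v] \<rho>L [OF U_lim_0_id] by (metis blinfun_apply_blinfun_compose)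
    have "surj (blinfun_apply (\<rho> g))"
      using r by (rule surjI [where f = "blinfun_apply (\<rho> (inv_op g))"])
    then show ?thesis
      by (simp add: c_unitary_iff isom_op_def \<rho> gc En EC)
  qed
  have "unitary_rep (top_of_set U_infty_0) \<rho>"
    unfolding unitary_rep_def
  proof (intro conjI allI)
    show "\<rho> \<in> hom (op_group (topspace (top_of_set U_infty_0))) (op_group {u. c_unitary u})"
      using uni mult sub by (auto simp: hom_def op_group_def)
    fix v
    have "continuous_on U_infty_0 (E v)"
      using Ec U_infty_0_subset_closure by (rule continuous_on_subset)
    then have "continuous_on U_infty_0 (\<lambda>g. blinfun_apply (\<rho> g) v)"
      by (rule continuous_on_eq) (simp add: \<rho> sub)
    then show "continuous_map (top_of_set U_infty_0) euclidean (\<lambda>g. blinfun_apply (\<rho> g) v)"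
      by simp
  qed
  then show ?thesis
    unfolding extends_to_U_infty_0_def using \<rho>L by blast
qed

theorem tame_iff_extends:
  fixes \<pi> :: "'k::lc_scalar op \<Rightarrow> 'v::chilbert_space \<Rightarrow>\<^sub>L 'v"
  assumes "unitary_rep direct_limit_topology \<pi>"
  shows "tame \<pi> \<longleftrightarrow> extends_to_U_infty_0 \<pi>"
  using unitary_rep_imp_unirep [OF assms] unitary_rep_continuous_on [OF assms]
    norm_continuous_imp_tame tame_imp_norm_continuous extends_imp_norm_continuous norm_continuous_imp_extends
  by blast

theorem theorem3p20:
  shows "(\<forall>\<pi> :: real op \<Rightarrow> 'v::chilbert_space \<Rightarrow>\<^sub>L 'v.
            unitary_rep direct_limit_topology \<pi> \<longrightarrow> (tame \<pi> \<longleftrightarrow> extends_to_U_infty_0 \<pi>)) \<and>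
         (\<forall>\<pi> :: complex op \<Rightarrow> 'v \<Rightarrow>\<^sub>L 'v.
            unitary_rep direct_limit_topology \<pi> \<longrightarrow> (tame \<pi> \<longleftrightarrow> extends_to_U_infty_0 \<pi>)) \<and>
         (\<forall>\<pi> :: quat op \<Rightarrow> 'v \<Rightarrow>\<^sub>L 'v.
            unitary_rep direct_limit_topology \<pi> \<longrightarrow> (tame \<pi> \<longleftrightarrow> extends_to_U_infty_0 \<pi>))"
  by (intro conjI allI impI tame_iff_extends)

end
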